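(* Let $\lambda\in\mathbb{C}\setminus\mathbb{Z}$ and $t\in\mathbb{C}\setminus\{0\}$. In the Lie superalgebra (with supercommutator) of polynomial differential operators on $\mathbb{C}[x,\theta]$ with $x$ even and $\theta$ odd, consider the odd operators $X=x\partial_\theta+x\theta\partial_x-\lambda\theta$, $Z=t(\partial_x\partial_\theta-\theta\partial_x^2)$, $U=\partial_\theta-\theta\partial_x$ and the even operator $Y=\partial_x$, and let $\mathfrak{sl}(\lambda|\lambda+1)$ be the Lie subsuperalgebra they generate. Let $\mathfrak F$ be the free Lie superalgebra on odd generators $X,Z,U$ and an even generator $Y$; put $Y_i=(\operatorname{ad}X)^iY$, $Z_i=(\operatorname{ad}X)^iZ$. Then the natural homomorphism $\mathfrak F\to\mathfrak{sl}(\lambda|\lambda+1)$ is surjective and its kernel is the ideal generated by: (0.1) $[Y,Y_1]=0$; (0.2) $[Y_2,Y]=2Y$; (0.3) $[Y_2,X]=-X$; (0.4) $[Y,U]=0$; (0.5) $[U,U]=-2Y$; (0.6) $[U,Y_1]=0$; (0.7) $[[X,X],[X,U]]=0$; (0.8) $[Y_2,U]=U$; (1.1) $[Y,Z]=0$; (1.2) $[[X,Y],Z]=0$; (1.3) $(\operatorname{ad}X)^7Z=0$; (1.4) $[Y_2,Z]=3Z$; (1.5) $3[Z,[X,U]]-[U,Z_1]=0$; (1.6) $[[X,U],Z_1]=0$; (2.1) $3[Z,Z_3]+2[Z_1,Z_2]=6t(2\lambda+1)\,Z$; (2.2) $[Z_1,Z_3]=2t^2(\lambda-1)(\lambda+2)\,Y+2t(2\lambda+1)\,Z_1$;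 (2.3) $[Z,[U,Z]]=0$; (2.4) $[Z_1,[U,Z]]=0$; (3.1) $[Z_1,[Z,Z]]=0$.
   Context: All brackets are supercommutators $[a,b]=ab-(-1)^{p(a)p(b)}ba$ (so for odd $a$, $[a,a]=2a^2$), and $\operatorname{ad}X(w)=[X,w]$. $X$ is the image of the odd generator $\nabla^+$ of a superprincipally embedded $\mathfrak{osp}(1|2)$; $Z$ is a lowest weight vector of weight $-3$ of a 7-dimensional irreducible $\mathfrak{osp}(1|2)$-submodule and $U$ is a lowest weight vector of weight $-1$ of a 3-dimensional irreducible $\mathfrak{osp}(1|2)$-submodule. The Lie superalgebra $\mathfrak{sl}(\lambda|\lambda+1)$ is the superanalog of the Lie algebra of traceless matrices of complex size, and the subsuperalgebra generated by $X,Y,Z$ alone is $\mathfrak{osp}(\lambda+1|\lambda)$. *)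

theory Defs
  imports "HOL-Computational_Algebra.Polynomial"
begin

text \<open>An element p + q*theta of C[x,theta] (p, q in C[x]) is represented by the pair (p, q).
  Operators are maps on such pairs; the polynomial differential operators act faithfully,
  so the Lie subsuperalgebra they generate is realized inside these maps.\<close>

type_synonym sv = "complex poly \<times> complex poly"
type_synonym op = "sv \<Rightarrow> sv"

definition add_op :: "op \<Rightarrow> op \<Rightarrow> op" where
  "add_op F G = (\<lambda>v. (fst (F v) + fst (G v), snd (F v) + snd (G v)))"

definition smul_op :: "complex \<Rightarrow> op \<Rightarrow> op" where
  "smul_op c F = (\<lambda>v. (smult c (fst (F v)), smult c (snd (F v))))"

definition zero_op :: op where
  "zero_op = (\<lambda>v. (0, 0))"

definition even_part :: "op \<Rightarrow> op" where
  "even_part F = (\<lambda>(p, q). (fst (F (p, 0)), snd (F (0, q))))"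

definition odd_part :: "op \<Rightarrow> op" where
  "odd_part F = (\<lambda>(p, q). (fst (F (0, q)), snd (F (p, 0))))"

text \<open>Supercommutator, extended bilinearly: [F,G] = FG - GF + 2 G_odd F_odd.\<close>
definition sbr :: "op \<Rightarrow> op \<Rightarrow> op" where
  "sbr F G = add_op (add_op (F \<circ> G) (smul_op (-1) (G \<circ> F)))
                    (smul_op 2 (odd_part G \<circ> odd_part F))"

text \<open>X = x d_theta + x theta d_x - lam theta,  Y = d_x,  U = d_theta - theta d_x,
      Z = t (d_x d_theta - theta d_x^2).\<close>
definition opX :: "complex \<Rightarrow> op" where
  "opX lam = (\<lambda>(p, q). ([:0, 1:] * q, [:0, 1:] * pderiv p - smult lam p))"

definition opY :: op where
  "opY = (\<lambda>(p, q). (pderiv p, pderiv q))"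

definition opU :: op where
  "opU = (\<lambda>(p, q). (q, - pderiv p))"

definition opZ :: "complex \<Rightarrow> op" where
  "opZ t = (\<lambda>(p, q). (smult t (pderiv q), - smult t (pderiv (pderiv p))))"

inductive_set sl_gen :: "complex \<Rightarrow> complex \<Rightarrow> op set" for lam t where
  gX: "opX lam \<in> sl_gen lam t"
| gY: "opY \<in> sl_gen lam t"
| gZ: "opZ t \<in> sl_gen lam t"
| gU: "opU \<in> sl_gen lam t"
| zero: "zero_op \<in> sl_gen lam t"
| add: "F \<in> sl_gen lam t \<Longrightarrow> G \<in> sl_gen lam t \<Longrightarrow> add_op F G \<in> sl_gen lam t"
| smul: "F \<in> sl_gen lam t \<Longrightarrow> smul_op c F \<in> sl_gen lam t"
| br: "F \<in> sl_gen lam t \<Longrightarrow> G \<in> sl_gen lam t \<Longrightarrow> sbr F G \<in> sl_gen lam t"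

datatype gen = GX | GY | GZ | GU

datatype tree = Gen gen | Br tree tree

text \<open>parity: True = odd.  X, Z, U odd, Y even.\<close>
fun par :: "tree \<Rightarrow> bool" where
  "par (Gen g) = (g \<noteq> GY)"
| "par (Br a b) = (par a \<noteq> par b)"

definition sgn :: "tree \<Rightarrow> tree \<Rightarrow> complex" where
  "sgn a b = (if par a \<and> par b then -1 else 1)"

text \<open>Elements of the magma algebra: finitely supported functions tree => complex.\<close>
type_synonym mag = "tree \<Rightarrow> complex"

definition fin_supp :: "mag \<Rightarrow> bool" where
  "fin_supp f \<longleftrightarrow> finite {w. f w \<noteq> 0}"

definition lc :: "(complex \<times> tree) list \<Rightarrow> mag" where
  "lc xs = (\<lambda>w. \<Sum>(c, v)\<leftarrow>xs. if v = w then c else 0)"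

definition mmul :: "mag \<Rightarrow> mag \<Rightarrow> mag" where
  "mmul f g = (\<lambda>w. case w of Gen _ \<Rightarrow> 0 | Br a b \<Rightarrow> f a * g b)"

fun eval_tree :: "complex \<Rightarrow> complex \<Rightarrow> tree \<Rightarrow> op" where
  "eval_tree lam t (Gen GX) = opX lam"
| "eval_tree lam t (Gen GY) = opY"
| "eval_tree lam t (Gen GZ) = opZ t"
| "eval_tree lam t (Gen GU) = opU"
| "eval_tree lam t (Br a b) = sbr (eval_tree lam t a) (eval_tree lam t b)"

definition ev :: "complex \<Rightarrow> complex \<Rightarrow> mag \<Rightarrow> op" where
  "ev lam t f = (\<lambda>v.
     ((\<Sum>w\<in>{w. f w \<noteq> 0}. smult (f w) (fst (eval_tree lam t w v))),
      (\<Sum>w\<in>{w. f w \<noteq> 0}. smult (f w) (snd (eval_tree lam t w v)))))"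

inductive_set mag_ideal :: "mag set \<Rightarrow> mag set" for S where
  base: "r \<in> S \<Longrightarrow> r \<in> mag_ideal S"
| zero: "(\<lambda>w. 0) \<in> mag_ideal S"
| add: "a \<in> mag_ideal S \<Longrightarrow> b \<in> mag_ideal S \<Longrightarrow> (\<lambda>w. a w + b w) \<in> mag_ideal S"
| smul: "a \<in> mag_ideal S \<Longrightarrow> (\<lambda>w. c * a w) \<in> mag_ideal S"
| mull: "a \<in> mag_ideal S \<Longrightarrow> mmul (lc [(1, u)]) a \<in> mag_ideal S"
| mulr: "a \<in> mag_ideal S \<Longrightarrow> mmul a (lc [(1, u)]) \<in> mag_ideal S"

text \<open>Defining relations of the free Lie superalgebra inside the magma algebra:
  super-antisymmetry and super-Jacobi for bracket words (homogeneous elements).\<close>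
definition lie_super_rels :: "mag set" where
  "lie_super_rels =
     {lc [(1, Br a b), (sgn a b, Br b a)] | a b. True} \<union>
     {lc [(1, Br a (Br b c)), (-1, Br (Br a b) c), (- sgn a b, Br b (Br a c))] | a b c. True}"

abbreviation "tX \<equiv> Gen GX"
abbreviation "tY \<equiv> Gen GY"
abbreviation "tZ \<equiv> Gen GZ"
abbreviation "tU \<equiv> Gen GU"

definition adX :: "nat \<Rightarrow> tree \<Rightarrow> tree" where
  "adX i w = ((\<lambda>u. Br tX u) ^^ i) w"

text \<open>The relations (0.1)-(3.1), written as (lhs - rhs).\<close>
definition paper_rels :: "complex \<Rightarrow> complex \<Rightarrow> mag set" where
  "paper_rels lam t = {
     lc [(1, Br tY (adX 1 tY))],
     lc [(1, Br (adX 2 tY) tY), (-2, tY)],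
     lc [(1, Br (adX 2 tY) tX), (1, tX)],
     lc [(1, Br tY tU)],
     lc [(1, Br tU tU), (2, tY)],
     lc [(1, Br tU (adX 1 tY))],
     lc [(1, Br (Br tX tX) (Br tX tU))],
     lc [(1, Br (adX 2 tY) tU), (-1, tU)],
     lc [(1, Br tY tZ)],
     lc [(1, Br (Br tX tY) tZ)],
     lc [(1, adX 7 tZ)],
     lc [(1, Br (adX 2 tY) tZ), (-3, tZ)],
     lc [(3, Br tZ (Br tX tU)), (-1, Br tU (adX 1 tZ))],
     lc [(1, Br (Br tX tU) (adX 1 tZ))],
     lc [(3, Br tZ (adX 3 tZ)), (2, Br (adX 1 tZ) (adX 2 tZ)), (- 6 * t * (2 * lam + 1), tZ)],
     lc [(1, Br (adX 1 tZ) (adX 3 tZ)), (- 2 * t^2 * (lam - 1) * (lam + 2), tY),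
         (- 2 * t * (2 * lam + 1), adX 1 tZ)],
     lc [(1, Br tZ (Br tU tZ))],
     lc [(1, Br (adX 1 tZ) (Br tU tZ))],
     lc [(1, Br (adX 1 tZ) (Br tZ tZ))] }"

end

theory Submission
  imports Defs "HOL-Library.Poly_Mapping" "HOL-Library.Product_Plus"
begin

text \<open>The element \<open>c = [X, U]\<close> grades the presented algebra \<open>L\<close> and splits the odd generators
  into parts of degree 1 and -1. Both \<open>Y\<close> and \<open>[X, Z]\<close> act by the derivative, with different
  scalars on the two blocks of \<open>sl(\<lambda>|\<lambda>+1)\<close>; together with \<open>[X, X]\<close> they generate two commuting
  copies of sl(2) inside \<open>L\<close>. Over these, the lowest odd vectors \<open>u\<close> and \<open>v\<close> of degree 1 and -1
  generate modules \<open>W u\<close> and \<open>W v\<close>, spanned by \<open>e\<close>-powers applied to one lowest weight vector in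
  each odd dimension, and hence mapped injectively to operators. A subalgebra \<open>E0\<close> of degree 0
  preserves both modules, and \<open>[W u, W u] = [W v, W v] = 0\<close>, \<open>[W u, W v] \<subseteq> E0\<close>, so that
  \<open>L = W u + E0 + W v\<close>. Finally \<open>E0 = [u, W v] + [[e, u], W v]\<close>, and \<open>q \<mapsto> [u, [[e, u], q]]\<close> is
  a bijection from \<open>W v\<close> to \<open>W u\<close>; bracketing an element of \<open>E0\<close> in the kernel of the evaluation with \<open>u\<close> and
  \<open>[e, u]\<close> therefore shows that it vanishes.\<close>

section \<open>Lie superalgebras and modules over two copies of sl(2)\<close>

text \<open>The obstacle is degree zero: an element of \<open>E0\<close> commuting with
  \<open>u\<close> and \<open>[e, u]\<close> escapes every test by brackets with them, and no basis
  of \<open>E0\<close> is at hand to show that it vanishes. The spanning statement for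
  \<open>E0\<close> is what removes such elements. Its proof has the shape of an argument about
  central extensions: every element of \<open>E0\<close> is a sum of brackets of the required form
  plus a centralizing one, the latter commutes with the diagonal sl(2), and therefore all of
  \<open>[e, E0]\<close>, \<open>[f, E0]\<close> and \<open>[H, E0]\<close> already lies in the
  span. Elements of nonzero weight are then multiples of their own \<open>H\<close>-images, while
  elements of weight zero have to be found as images under \<open>e\<close> or \<open>f\<close>; in
  one case this takes an explicit computation. Throughout, the structure constants are those of the
  block matrix operators and can be predicted there, but each has to be derived from the relations.
  The scarce information is the interplay of \<open>ft\<close> with \<open>y\<close>: the relation
  for \<open>[eT, y]\<close> comes from comparing an identity with its mirror image under the
  exchange of \<open>u\<close> and \<open>v\<close>.\<close>

locale lie_superalgebra = vector_space scale
  for scale :: "complex \<Rightarrow> 'a::ab_group_add \<Rightarrow> 'a" (infixr "*s" 75) +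
  fixes br :: "'a \<Rightarrow> 'a \<Rightarrow> 'a" (infixr "\<cdot>" 80)
    and Ev Od :: "'a set"
  assumes br_add_left: "(x + y) \<cdot> z = x \<cdot> z + y \<cdot> z"
    and br_add_right: "x \<cdot> (y + z) = x \<cdot> y + x \<cdot> z"
    and br_scale_left: "(k *s x) \<cdot> z = k *s x \<cdot> z"
    and br_scale_right: "x \<cdot> (k *s z) = k *s x \<cdot> z"
    and subspace_Ev: "subspace Ev"
    and subspace_Od: "subspace Od"
    and br_Ev_Ev: "x \<in> Ev \<Longrightarrow> y \<in> Ev \<Longrightarrow> x \<cdot> y \<in> Ev"
    and br_Ev_Od: "x \<in> Ev \<Longrightarrow> y \<in> Od \<Longrightarrow> x \<cdot> y \<in> Od"
    and br_Od_Od: "x \<in> Od \<Longrightarrow> y \<in> Od \<Longrightarrow> x \<cdot> y \<in> Ev"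
    and antisym_Ev: "x \<in> Ev \<Longrightarrow> y \<cdot> x = - (x \<cdot> y)"
    and sym_Od: "x \<in> Od \<Longrightarrow> y \<in> Od \<Longrightarrow> y \<cdot> x = x \<cdot> y"
    and jacobi_Ev: "x \<in> Ev \<Longrightarrow> x \<cdot> y \<cdot> z = (x \<cdot> y) \<cdot> z + y \<cdot> x \<cdot> z"
    and jacobi_Od: "x \<in> Od \<Longrightarrow> y \<in> Od \<Longrightarrow> x \<cdot> y \<cdot> z = (x \<cdot> y) \<cdot> z - y \<cdot> x \<cdot> z"
begin

definition dual :: "('a \<Rightarrow> complex) \<Rightarrow> bool" where
  "dual h \<longleftrightarrow> Vector_Spaces.linear scale (*) h"

text \<open>A first-order wrapper for application, so that the simplifier can use \<open>dual_simps\<close>.\<close>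
definition coord :: "('a \<Rightarrow> complex) \<Rightarrow> 'a \<Rightarrow> complex" where
  "coord h x = h x"

lemma coord_cong: "x = z \<Longrightarrow> coord h x = coord h z"
  by simp

lemma dual_simps:
  assumes "dual h"
  shows "coord h (x + y) = coord h x + coord h y" "coord h (x - y) = coord h x - coord h y"
    "coord h (- x) = - coord h x" "coord h (k *s x) = k * coord h x" "coord h 0 = 0"
proof -
  interpret l: Vector_Spaces.linear scale "(*)" h
    using assms by (simp add: dual_def)
  show "coord h (x + y) = coord h x + coord h y" "coord h (x - y) = coord h x - coord h y"
    "coord h (- x) = - coord h x" "coord h (k *s x) = k * coord h x" "coord h 0 = 0"
    by (simp_all add: coord_def l.add l.diff l.neg l.scale l.zero)
qed

text \<open>Turns linear identities between vectors into polynomial identities between complex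
  numbers, which \<open>algebra\<close> can decide.\<close>
lemma vec_eqI:
  assumes "\<And>h. dual h \<Longrightarrow> coord h x = coord h y"
  shows "x = y"
proof (rule ccontr)
  assume "x \<noteq> y"
  then have ind: "independent {x - y}"
    by simp
  interpret p: vector_space_pair scale "(*) :: complex \<Rightarrow> complex \<Rightarrow> complex"
    by unfold_locales (simp_all add: algebra_simps)
  obtain g where g: "Vector_Spaces.linear scale (*) g" "\<forall>z\<in>{x - y}. g z = (\<lambda>_. 1) z"
    using p.linear_independent_extend[OF ind, of "\<lambda>_. 1"] by blast
  then have "dual g" by (simp add: dual_def)
  from dual_simps(2)[OF this, of x y] assms[OF this] g(2) show False
    by (simp add: coord_def)
qed

lemma br_zero [simp]: "0 \<cdot> x = 0" "x \<cdot> 0 = 0"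
  using br_scale_left[of 0 0 x] br_scale_right[of x 0 0] by simp_all

lemma br_minus: "(- x) \<cdot> y = - (x \<cdot> y)" "x \<cdot> (- y) = - (x \<cdot> y)"
  using br_scale_left[of "-1" x y] br_scale_right[of x "-1" y] by simp_all

lemma br_diff: "(x - y) \<cdot> z = x \<cdot> z - y \<cdot> z" "x \<cdot> (y - z) = x \<cdot> y - x \<cdot> z"
  using br_add_left[of x "- y" z] br_add_right[of x y "- z"] by (simp_all add: br_minus)

lemmas br_simps = br_add_left br_add_right br_scale_left br_scale_right br_minus br_diff

lemma Ev_closed: "x \<in> Ev \<Longrightarrow> y \<in> Ev \<Longrightarrow> x + y \<in> Ev" "x \<in> Ev \<Longrightarrow> y \<in> Ev \<Longrightarrow> x - y \<in> Ev"
  "x \<in> Ev \<Longrightarrow> - x \<in> Ev" "x \<in> Ev \<Longrightarrow> k *s x \<in> Ev" "x \<in> Ev \<Longrightarrow> y \<in> Ev \<Longrightarrow> x \<cdot> y \<in> Ev"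
  "x \<in> Od \<Longrightarrow> y \<in> Od \<Longrightarrow> x \<cdot> y \<in> Ev"
  by (simp_all add: subspace_Ev subspace_add subspace_diff subspace_neg subspace_scale br_Ev_Ev br_Od_Od)

lemma Od_closed: "x \<in> Od \<Longrightarrow> y \<in> Od \<Longrightarrow> x + y \<in> Od" "x \<in> Od \<Longrightarrow> y \<in> Od \<Longrightarrow> x - y \<in> Od"
  "x \<in> Od \<Longrightarrow> - x \<in> Od" "x \<in> Od \<Longrightarrow> k *s x \<in> Od" "x \<in> Ev \<Longrightarrow> y \<in> Od \<Longrightarrow> x \<cdot> y \<in> Od"
  by (simp_all add: subspace_Od subspace_add subspace_diff subspace_neg subspace_scale br_Ev_Od)

lemma Od_br_Ev: "x \<in> Od \<Longrightarrow> y \<in> Ev \<Longrightarrow> x \<cdot> y \<in> Od"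
  using antisym_Ev Od_closed by metis

lemma span_br_closed:
  assumes "\<And>x. x \<in> B \<Longrightarrow> a \<cdot> x \<in> S" "subspace S" "x \<in> span B"
  shows "a \<cdot> x \<in> S"
proof -
  have "subspace {x. a \<cdot> x \<in> S}"
    using assms(2) by (auto simp: subspace_def br_simps)
  then have "span B \<subseteq> {x. a \<cdot> x \<in> S}"
    using assms(1) by (intro span_minimal) auto
  then show ?thesis using assms(3) by auto
qed

lemma self_br_Ev: "x \<in> Ev \<Longrightarrow> x \<cdot> x = 0"
proof -
  assume "x \<in> Ev"
  then have "x \<cdot> x + x \<cdot> x = 0"
    using antisym_Ev[of x x] by (simp only: eq_neg_iff_add_eq_0)
  then have "2 *s x \<cdot> x = 0"
    using scale_left_distrib[of 1 1 "x \<cdot> x"] by simp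
  then show ?thesis by simp
qed

end

text \<open>\<open>e\<close> and \<open>f\<close> generate the diagonal sl(2); \<open>ft\<close>, \<open>hT = [e, ft]\<close> and
  \<open>eT = [e, hT] / 2\<close> span its first factor.\<close>

locale sl2_triple_pair = lie_superalgebra +
  fixes e f ft :: 'a and \<mu> :: complex
  assumes e_Ev [simp]: "e \<in> Ev" and f_Ev [simp]: "f \<in> Ev" and ft_Ev [simp]: "ft \<in> Ev"
    and H_e: "(e \<cdot> f) \<cdot> e = (-2) *s e"
    and f_ft: "f \<cdot> ft = 0"
    and H_ft: "(e \<cdot> f) \<cdot> ft = 2 *s ft"
    and e3_ft: "e \<cdot> e \<cdot> e \<cdot> ft = 0"
    and ft_e_ft: "ft \<cdot> e \<cdot> ft = (-2) *s ft"
begin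

definition "H = e \<cdot> f"
definition "hT = e \<cdot> ft"
definition "eT = (1/2) *s e \<cdot> hT"

lemma Ev_simps [simp]: "H \<in> Ev" "hT \<in> Ev" "eT \<in> Ev"
  by (simp_all add: H_def hT_def eT_def Ev_closed)

lemma e_hT: "e \<cdot> hT = 2 *s eT"
  by (simp add: eT_def)

lemma ft_hT: "ft \<cdot> hT = (-2) *s ft"
  by (simp add: ft_e_ft hT_def)

lemma hT_ft: "hT \<cdot> ft = 2 *s ft"
  using antisym_Ev[of ft hT] ft_hT by simp

lemma e_eT: "e \<cdot> eT = 0"
  by (simp add: eT_def hT_def br_simps e3_ft)

lemma eT_ft: "eT \<cdot> ft = hT"
proof -
  have "e \<cdot> hT \<cdot> ft = (2 *s eT) \<cdot> ft + hT \<cdot> hT"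
    unfolding jacobi_Ev[OF e_Ev, of hT ft] e_hT by (simp only: hT_def)
  moreover have "e \<cdot> hT \<cdot> ft = 2 *s hT"
    unfolding hT_ft br_scale_right by (simp only: hT_def)
  moreover have "hT \<cdot> hT = 0" by (rule self_br_Ev) simp
  ultimately have "2 *s hT = 2 *s eT \<cdot> ft"
    by (simp add: br_scale_left)
  then show ?thesis by simp
qed

lemma eT_hT: "eT \<cdot> hT = 2 *s eT"
  using jacobi_Ev[OF e_Ev, of eT ft] by (simp add: e_eT eT_ft e_hT flip: hT_def)

text \<open>Oriented as a rewrite rule: here and below \<open>e\<close> moves to the left, and
  \<open>ft\<close> moves to the left of everything but \<open>e\<close>, which is the order of
  letters in \<open>ew\<close>.\<close>

lemma ft_e: "ft \<cdot> e \<cdot> z = e \<cdot> ft \<cdot> z - hT \<cdot> z"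
  using jacobi_Ev[OF e_Ev, of ft z] by (simp add: hT_def)

lemma hT_e: "hT \<cdot> e \<cdot> z = e \<cdot> hT \<cdot> z - 2 *s eT \<cdot> z"
  using jacobi_Ev[OF e_Ev, of hT z] by (simp add: e_hT br_simps)

lemma eT_e: "eT \<cdot> e \<cdot> z = e \<cdot> eT \<cdot> z"
  using jacobi_Ev[OF e_Ev, of eT z] by (simp add: e_eT br_simps)

lemma hT_ft': "hT \<cdot> ft \<cdot> z = ft \<cdot> hT \<cdot> z + 2 *s ft \<cdot> z"
  using jacobi_Ev[of hT ft z] by (simp add: hT_ft br_simps)

lemma eT_ft': "eT \<cdot> ft \<cdot> z = ft \<cdot> eT \<cdot> z + hT \<cdot> z"
  using jacobi_Ev[of eT ft z] by (simp add: eT_ft br_simps)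

lemma eT_hT': "eT \<cdot> hT \<cdot> z = hT \<cdot> eT \<cdot> z + 2 *s eT \<cdot> z"
  using jacobi_Ev[of eT hT z] by (simp add: eT_hT br_simps)

lemma f_e: "f \<cdot> e \<cdot> z = e \<cdot> f \<cdot> z - H \<cdot> z"
  using jacobi_Ev[OF e_Ev, of f z] by (simp add: H_def)

lemma H_e': "H \<cdot> e \<cdot> z = e \<cdot> H \<cdot> z - 2 *s e \<cdot> z"
  using jacobi_Ev[of H e z] H_e by (simp add: br_simps H_def Ev_closed)

lemma H_ft': "H \<cdot> ft \<cdot> z = ft \<cdot> H \<cdot> z + 2 *s ft \<cdot> z"
  using jacobi_Ev[of H ft z] H_ft by (simp add: br_simps H_def Ev_closed)

lemma f_ft': "f \<cdot> ft \<cdot> z = ft \<cdot> f \<cdot> z"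
  using jacobi_Ev[of f ft z] f_ft by (simp add: br_simps)

text \<open>\<open>vac x\<close> says that \<open>x\<close> is a lowest weight vector of a two-dimensional module of the
  diagonal sl(2), together with the relation that removes the two-dimensional constituent
  of the span of \<open>ft, hT, eT\<close> applied to that module.\<close>
definition vac :: "'a \<Rightarrow> bool" where
  "vac x \<longleftrightarrow> f \<cdot> x = 0 \<and> H \<cdot> x = x \<and> e \<cdot> e \<cdot> x = 0 \<and>
     3 *s ft \<cdot> e \<cdot> x = e \<cdot> ft \<cdot> x - (3 * \<mu>) *s x"

section \<open>Lowest weight modules over two copies of sl(2)\<close>

definition wv :: "'a \<Rightarrow> nat \<Rightarrow> 'a" where
  "wv x n = ((br ft) ^^ n) x"

definition ew :: "'a \<Rightarrow> nat \<Rightarrow> nat \<Rightarrow> 'a" where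
  "ew x i n = ((br e) ^^ i) (wv x n)"

definition W :: "'a \<Rightarrow> 'a set" where
  "W x = span {ew x i n | i n. True}"

lemma wv_simps: "wv x 0 = x" "ft \<cdot> wv x n = wv x (Suc n)"
  by (simp_all add: wv_def)

lemma ew_simps: "ew x 0 n = wv x n" "e \<cdot> ew x i n = ew x (Suc i) n"
  by (simp_all add: ew_def)

lemma subspace_W: "subspace (W x)"
  by (simp add: W_def)

lemma W_closed: "0 \<in> W x" "a \<in> W x \<Longrightarrow> b \<in> W x \<Longrightarrow> a + b \<in> W x" "a \<in> W x \<Longrightarrow> b \<in> W x \<Longrightarrow> a - b \<in> W x"
  "a \<in> W x \<Longrightarrow> k *s a \<in> W x" "a \<in> W x \<Longrightarrow> - a \<in> W x"
  by (simp_all add: subspace_W subspace_add subspace_diff subspace_scale subspace_0 subspace_neg)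

lemma ew_in_W [simp]: "ew x i n \<in> W x"
  unfolding W_def by (rule span_base) auto

lemma W_br:
  assumes "\<And>i n. a \<cdot> ew x i n \<in> W x" "z \<in> W x"
  shows "a \<cdot> z \<in> W x"
proof (rule span_br_closed)
  show "z \<in> span {ew x i n | i n. True}" using assms(2) by (simp add: W_def)
qed (use assms(1) subspace_W in auto)

lemma W_e: "z \<in> W x \<Longrightarrow> e \<cdot> z \<in> W x"
  by (rule W_br) (simp_all add: ew_simps)

lemma W_f_H_wv:
  assumes "vac x"
  shows "f \<cdot> wv x n = 0" "H \<cdot> wv x n = (2 * of_nat n + 1) *s wv x n"
proof -
  show "f \<cdot> wv x n = 0"
    by (induction n) (use assms in \<open>auto simp: wv_def vac_def f_ft'\<close>)
  show "H \<cdot> wv x n = (2 * of_nat n + 1) *s wv x n"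
  proof (induction n)
    case 0 then show ?case using assms by (simp add: vac_def wv_def)
  next
    case (Suc n)
    have "H \<cdot> wv x (Suc n) = (2 * of_nat n + 1) *s wv x (Suc n) + 2 *s wv x (Suc n)"
      using Suc by (simp add: H_ft' br_simps flip: wv_simps(2))
    also have "\<dots> = (2 * of_nat (Suc n) + 1) *s wv x (Suc n)"
      by (rule vec_eqI) (simp add: dual_simps algebra_simps)
    finally show ?case .
  qed
qed

lemma H_ew:
  assumes "vac x"
  shows "H \<cdot> ew x i n = (2 * of_nat n + 1 - 2 * of_nat i) *s ew x i n"
proof (induction i)
  case 0 then show ?case by (simp add: ew_simps W_f_H_wv assms)
next
  case (Suc i)
  have "H \<cdot> ew x (Suc i) n = (2 * of_nat n + 1 - 2 * of_nat i) *s ew x (Suc i) n - 2 *s ew x (Suc i) n"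
    using Suc by (simp add: H_e' br_simps flip: ew_simps(2))
  also have "\<dots> = (2 * of_nat n + 1 - 2 * of_nat (Suc i)) *s ew x (Suc i) n"
    by (rule vec_eqI) (simp add: dual_simps algebra_simps)
  finally show ?case .
qed

text \<open>The usual sl(2) ladder coefficient. It first vanishes at \<open>i = 2 * n + 1\<close>,
  which bounds the range in which \<open>f\<close> can undo \<open>e\<close> on the string of
  \<open>wv x n\<close>.\<close>

lemma f_ew:
  assumes "vac x"
  shows "f \<cdot> ew x (Suc i) n = (- (of_nat (Suc i) * (2 * of_nat n + 1 - of_nat i))) *s ew x i n"
proof (induction i)
  case 0
  show ?case unfolding ew_simps(2)[symmetric] ew_simps(1) f_e W_f_H_wv[OF assms]
    by (rule vec_eqI) (simp add: dual_simps algebra_simps)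
next
  case (Suc i)
  have "f \<cdot> ew x (Suc (Suc i)) n = e \<cdot> f \<cdot> ew x (Suc i) n - H \<cdot> ew x (Suc i) n"
    by (simp add: f_e flip: ew_simps(2))
  also have "\<dots> = (- (of_nat (Suc i) * (2 * of_nat n + 1 - of_nat i))) *s ew x (Suc i) n
      - (2 * of_nat n + 1 - 2 * of_nat (Suc i)) *s ew x (Suc i) n"
    unfolding Suc br_scale_right H_ew[OF assms] ew_simps ..
  also have "\<dots> = (- (of_nat (Suc (Suc i)) * (2 * of_nat n + 1 - of_nat (Suc i)))) *s ew x (Suc i) n"
    by (rule vec_eqI) (simp add: dual_simps algebra_simps)
  finally show ?case .
qed

lemma hT_vac:
  assumes "vac x"
  shows "3 *s hT \<cdot> x = 2 *s e \<cdot> ft \<cdot> x + (3 * \<mu>) *s x"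
proof (rule vec_eqI)
  fix h assume d: "dual h"
  have "3 *s ft \<cdot> e \<cdot> x = e \<cdot> ft \<cdot> x - (3 * \<mu>) *s x"
    using assms by (simp add: vac_def)
  from coord_cong[OF this, of h] coord_cong[OF ft_e[of x], of h]
  show "coord h (3 *s hT \<cdot> x) = coord h (2 *s e \<cdot> ft \<cdot> x + (3 * \<mu>) *s x)"
    by (simp add: dual_simps[OF d]; algebra)
qed

text \<open>Applying \<open>f\<close> forces the first coefficient: \<open>[f, hT]\<close> is
  \<open>-2 ft\<close>, and \<open>f \<cdot> e \<cdot> wv x (Suc n)\<close> is minus the weight
  \<open>2n + 3\<close> times \<open>wv x (Suc n)\<close>. Later steps only use that some
  \<open>b\<close> exists.\<close>

lemma hT_wv:
  assumes "vac x"
  shows "\<exists>b. hT \<cdot> wv x n = (2 / (2 * of_nat n + 3)) *s e \<cdot> wv x (Suc n) + b *s wv x n"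
proof (induction n)
  case 0
  have "hT \<cdot> x = (1/3) *s (3 *s hT \<cdot> x)" by simp
  also have "\<dots> = (2/3) *s e \<cdot> ft \<cdot> x + \<mu> *s x"
    unfolding hT_vac[OF assms] by (rule vec_eqI) (simp add: dual_simps field_simps)
  finally have "hT \<cdot> x = (2/3) *s e \<cdot> ft \<cdot> x + \<mu> *s x" .
  then show ?case by (auto simp: wv_def)
next
  case (Suc n)
  then obtain b where b: "hT \<cdot> wv x n = (2 / (2 * of_nat n + 3)) *s e \<cdot> wv x (Suc n) + b *s wv x n"
    by blast
  let ?a = "2 / (2 * of_nat n + 3) :: complex"
  have nz: "2 * of_nat n + 3 \<noteq> (0::complex)" "2 * of_nat n + 5 \<noteq> (0::complex)"
    using of_nat_eq_0_iff[of "2*n+3", where 'a=complex] of_nat_eq_0_iff[of "2*n+5", where 'a=complex]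
    by (simp_all del: of_nat_eq_0_iff)
  have 1: "hT \<cdot> wv x (Suc n) = ft \<cdot> hT \<cdot> wv x n + 2 *s wv x (Suc n)"
    by (simp add: hT_ft' flip: wv_simps(2))
  have 2: "ft \<cdot> hT \<cdot> wv x n = ?a *s (e \<cdot> wv x (Suc (Suc n)) - hT \<cdot> wv x (Suc n)) + b *s wv x (Suc n)"
    by (simp add: b br_simps ft_e wv_simps)
  have "hT \<cdot> wv x (Suc n) = (2 / (2 * of_nat (Suc n) + 3)) *s e \<cdot> wv x (Suc (Suc n))
      + ((b + 2) * (2 * of_nat n + 3) / (2 * of_nat n + 5)) *s wv x (Suc n)"
  proof (rule vec_eqI)
    fix h assume d: "dual h"
    show "coord h (hT \<cdot> wv x (Suc n)) = coord h ((2 / (2 * of_nat (Suc n) + 3)) *s e \<cdot> wv x (Suc (Suc n))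
      + ((b + 2) * (2 * of_nat n + 3) / (2 * of_nat n + 5)) *s wv x (Suc n))"
      using coord_cong[OF 1, of h] coord_cong[OF 2, of h] nz
      by (simp add: dual_simps[OF d] divide_simps; algebra)
  qed
  then show ?case by blast
qed

lemma ft_e_e: "ft \<cdot> e \<cdot> e \<cdot> z = e \<cdot> e \<cdot> ft \<cdot> z - 2 *s e \<cdot> hT \<cdot> z + 2 *s eT \<cdot> z"
proof -
  have "ft \<cdot> e \<cdot> e \<cdot> z = e \<cdot> (e \<cdot> ft \<cdot> z - hT \<cdot> z) - (e \<cdot> hT \<cdot> z - 2 *s eT \<cdot> z)"
    by (simp only: ft_e[of "e \<cdot> z"] ft_e[of z] hT_e)
  then show ?thesis
    by (simp only:) (rule vec_eqI, simp add: dual_simps br_simps)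
qed

text \<open>The three terms are the Clebsch-Gordan constituents of dimensions 2n+4, 2n+2 and 2n.
  Applying \<open>f\<close> twice forces the leading coefficient: the left side becomes
  \<open>2 *s wv x (Suc n)\<close>, and \<open>e \<cdot> e \<cdot> wv x (Suc n)\<close> becomes
  \<open>2 (2n + 2) (2n + 3)\<close> times that vector.\<close>

lemma eT_wv:
  assumes "vac x"
  shows "\<exists>b g. eT \<cdot> wv x n = (1 / ((2 * of_nat n + 3) * (2 * of_nat n + 2))) *s e \<cdot> e \<cdot> wv x (Suc n)
    + b *s e \<cdot> wv x n + g *s (case n of 0 \<Rightarrow> 0 | Suc m \<Rightarrow> wv x m)"
proof (induction n)
  case 0
  have 1: "3 *s ft \<cdot> e \<cdot> x = e \<cdot> ft \<cdot> x - (3 * \<mu>) *s x" and 2: "e \<cdot> e \<cdot> x = 0"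
    using assms by (simp_all add: vac_def)
  have 3: "e \<cdot> (3 *s ft \<cdot> e \<cdot> x) = e \<cdot> (e \<cdot> ft \<cdot> x - (3 * \<mu>) *s x)"
    by (simp only: 1)
  have "eT \<cdot> x = (1/6) *s e \<cdot> e \<cdot> ft \<cdot> x + \<mu> *s e \<cdot> x"
  proof (rule vec_eqI)
    fix h assume d: "dual h"
    show "coord h (eT \<cdot> x) = coord h ((1/6) *s e \<cdot> e \<cdot> ft \<cdot> x + \<mu> *s e \<cdot> x)"
      using coord_cong[OF 3, of h] coord_cong[OF ft_e_e[of x], of h]
        arg_cong[OF ft_e[of x], of "\<lambda>z. coord h (e \<cdot> z)"]
      by (simp add: dual_simps[OF d] br_simps 2; algebra)
  qed
  then have "eT \<cdot> wv x 0 = (1 / ((2 * of_nat 0 + 3) * (2 * of_nat 0 + 2))) *s e \<cdot> e \<cdot> wv x (Suc 0)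
    + \<mu> *s e \<cdot> wv x 0 + 0 *s (case 0 of 0 \<Rightarrow> 0 | Suc m \<Rightarrow> wv x m)"
    by (simp add: wv_def)
  then show ?case by blast
next
  case (Suc n)
  define r where "r = (case n of 0 \<Rightarrow> 0 | Suc m \<Rightarrow> wv x m)"
  define \<alpha> where "\<alpha> = (1 / ((2 * of_nat n + 3) * (2 * of_nat n + 2)) :: complex)"
  from Suc obtain b g where eTn: "eT \<cdot> wv x n = \<alpha> *s e \<cdot> e \<cdot> wv x (Suc n) + b *s e \<cdot> wv x n + g *s r"
    unfolding r_def \<alpha>_def by blast
  \<comment> \<open>For \<open>n = 0\<close> the vector \<open>r\<close> is 0, so
    \<open>ft \<cdot> r\<close> is not \<open>wv x 0\<close> and the coefficient has to be
    reset.\<close>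
  define g' where "g' = (if n = 0 then 0 else g)"
  have r: "g *s ft \<cdot> r = g' *s wv x n"
    by (cases n) (auto simp: r_def g'_def wv_simps)
  define a where "a = (2 / (2 * of_nat n + 3) :: complex)"
  define a' where "a' = (2 / (2 * of_nat n + 5) :: complex)"
  obtain c where c: "hT \<cdot> wv x n = a *s e \<cdot> wv x (Suc n) + c *s wv x n"
    using hT_wv[OF assms, of n] unfolding a_def by blast
  obtain c' where c': "hT \<cdot> wv x (Suc n) = a' *s e \<cdot> wv x (Suc (Suc n)) + c' *s wv x (Suc n)"
    using hT_wv[OF assms, of "Suc n"] by (auto simp: a'_def algebra_simps)
  have nz: "2 * of_nat n + k \<noteq> (0::complex)" if "k \<in> {1,2,3,4,5}" for k
  proof -
    have "k \<in> \<nat>" using that by auto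
    then obtain m where m: "k = of_nat m" by (auto elim: Nats_cases)
    with that have "m > 0" by (cases m) auto
    then have "of_nat (2 * n + m) \<noteq> (0::complex)" by (simp only: of_nat_eq_0_iff)
    then show ?thesis by (simp add: m)
  qed
  have nzs: "2 * of_nat n + 1 \<noteq> (0::complex)" "2 * of_nat n + 2 \<noteq> (0::complex)" "2 * of_nat n + 3 \<noteq> (0::complex)"
    "2 * of_nat n + 4 \<noteq> (0::complex)" "2 * of_nat n + 5 \<noteq> (0::complex)"
    using nz by blast+
  \<comment> \<open>Moving \<open>ft\<close> past \<open>e \<cdot> e\<close> in the term with
    \<open>\<alpha>\<close> reproduces \<open>2 *s eT \<cdot> wv x (Suc n)\<close>, so the recursion
    is an equation in which \<open>1 - 2 * \<alpha>\<close> must be divided out.\<close>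
  have k: "1 - 2 * \<alpha> = (2 * of_nat n + 1) * (2 * of_nat n + 4) / ((2 * of_nat n + 3) * (2 * of_nat n + 2))"
    using nzs by (simp add: \<alpha>_def divide_simps; algebra)
  then have k0: "1 - 2 * \<alpha> \<noteq> 0" using nzs by simp
  have main: "\<alpha> * (1 - 2 * a') / (1 - 2 * \<alpha>) = 1 / ((2 * of_nat (Suc n) + 3) * (2 * of_nat (Suc n) + 2))"
  proof -
    have 1: "1 - 2 * a' = (2 * of_nat n + 1) / (2 * of_nat n + 5)"
      using nzs by (simp add: a'_def divide_simps)
    have 2: "2 * of_nat (Suc n) + 3 = (2 * of_nat n + 5 :: complex)" "2 * of_nat (Suc n) + 2 = (2 * of_nat n + 4 :: complex)"
      by simp_all
    show ?thesis unfolding k 1 2 using nzs by (simp add: \<alpha>_def)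
  qed
  have 1: "eT \<cdot> wv x (Suc n) = ft \<cdot> eT \<cdot> wv x n + hT \<cdot> wv x n"
    by (simp add: eT_ft' flip: wv_simps(2))
  have "eT \<cdot> wv x (Suc n) = (\<alpha> * (1 - 2 * a') / (1 - 2 * \<alpha>)) *s e \<cdot> e \<cdot> wv x (Suc (Suc n))
    + ((b * (1 - a) + a - 2 * \<alpha> * c') / (1 - 2 * \<alpha>)) *s e \<cdot> wv x (Suc n)
    + ((g' + c - b * c) / (1 - 2 * \<alpha>)) *s wv x n"
  proof (rule vec_eqI)
    fix h assume d: "dual h"
    have r': "g * coord h (ft \<cdot> r) = g' * coord h (wv x n)"
      using coord_cong[OF r, of h] by (simp add: dual_simps[OF d])
    have "coord h (eT \<cdot> wv x (Suc n)) * (1 - 2 * \<alpha>) = \<alpha> * (1 - 2 * a') * coord h (e \<cdot> e \<cdot> wv x (Suc (Suc n)))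
      + (b * (1 - a) + a - 2 * \<alpha> * c') * coord h (e \<cdot> wv x (Suc n)) + (g' + c - b * c) * coord h (wv x n)"
      using coord_cong[OF 1, of h] r'
      by (simp add: eTn br_simps ft_e_e ft_e hT_e wv_simps c c' dual_simps[OF d]; algebra)
    then show "coord h (eT \<cdot> wv x (Suc n)) = coord h ((\<alpha> * (1 - 2 * a') / (1 - 2 * \<alpha>)) *s e \<cdot> e \<cdot> wv x (Suc (Suc n))
      + ((b * (1 - a) + a - 2 * \<alpha> * c') / (1 - 2 * \<alpha>)) *s e \<cdot> wv x (Suc n)
      + ((g' + c - b * c) / (1 - 2 * \<alpha>)) *s wv x n)"
      using k0 by (simp add: dual_simps[OF d] divide_simps; algebra)
  qed
  then show ?case unfolding main by auto
qed

lemma T_ew: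
  assumes "vac x"
  shows "ft \<cdot> ew x i n \<in> W x \<and> hT \<cdot> ew x i n \<in> W x \<and> eT \<cdot> ew x i n \<in> W x"
proof (induction i arbitrary: n)
  case 0
  have "ft \<cdot> ew x 0 n \<in> W x"
    using ew_in_W[of x 0 "Suc n"] by (simp add: ew_simps wv_simps)
  moreover have "hT \<cdot> ew x 0 n \<in> W x"
  proof -
    obtain a b where "hT \<cdot> wv x n = a *s e \<cdot> wv x (Suc n) + b *s wv x n"
      using hT_wv[OF assms] by blast
    moreover have "e \<cdot> wv x (Suc n) \<in> W x" "wv x n \<in> W x"
      using ew_in_W[of x 0] W_e[OF ew_in_W[of x 0]] by (simp_all add: ew_simps)
    ultimately show ?thesis by (simp add: ew_simps W_closed)
  qed
  moreover have "eT \<cdot> ew x 0 n \<in> W x"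
  proof -
    obtain a b g where "eT \<cdot> wv x n = a *s e \<cdot> e \<cdot> wv x (Suc n) + b *s e \<cdot> wv x n
        + g *s (case n of 0 \<Rightarrow> 0 | Suc m \<Rightarrow> wv x m)"
      using eT_wv[OF assms] by blast
    moreover have "wv x m \<in> W x" for m
      using ew_in_W[of x 0] by (simp add: ew_simps)
    ultimately show ?thesis by (simp add: ew_simps W_closed W_e split: nat.split)
  qed
  ultimately show ?case by blast
next
  case (Suc i)
  then show ?case
    by (simp add: ft_e hT_e eT_e W_closed W_e flip: ew_simps(2))
qed

lemma W_ft_hT_eT:
  assumes "vac x" "z \<in> W x"
  shows "ft \<cdot> z \<in> W x" "hT \<cdot> z \<in> W x" "eT \<cdot> z \<in> W x"
  using T_ew[OF assms(1)] assms(2) by (auto intro: W_br)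

lemma f_ew_in_W: "vac x \<Longrightarrow> f \<cdot> ew x i n \<in> W x"
  by (cases i) (simp_all add: f_ew ew_simps W_f_H_wv W_closed)

lemma W_f_H:
  assumes "vac x" "z \<in> W x"
  shows "f \<cdot> z \<in> W x" "H \<cdot> z \<in> W x"
  using assms by (auto intro!: W_br[of _ x z] simp: f_ew_in_W H_ew W_closed)

text \<open>Leibniz rule for the powers of \<open>e\<close>, cut off after three terms because
  \<open>e \<cdot> eT = 0\<close>. The exponent starts at 2 to avoid subtraction of natural
  numbers.\<close>

lemma e_pow_ft:
  "((br e) ^^ (m + 2)) (ft \<cdot> z) = ft \<cdot> ((br e) ^^ (m + 2)) z
    + (of_nat (m + 2)) *s hT \<cdot> ((br e) ^^ (m + 1)) z
    + (of_nat ((m + 2) * (m + 1))) *s eT \<cdot> ((br e) ^^ m) z"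
proof (induction m)
  case 0
  show ?case
    by (rule vec_eqI) (simp add: eval_nat_numeral dual_simps ft_e_e hT_e br_simps)
next
  case (Suc m)
  let ?p = "\<lambda>k. ((br e) ^^ k) z"
  have p3: "?p (m + 3) = e \<cdot> e \<cdot> e \<cdot> ?p m" by (simp add: numeral_3_eq_3)
  have e_ft: "e \<cdot> ft \<cdot> y = ft \<cdot> e \<cdot> y + hT \<cdot> y" for y by (simp add: ft_e)
  have e_hT: "e \<cdot> hT \<cdot> y = hT \<cdot> e \<cdot> y + 2 *s eT \<cdot> y" for y by (simp add: hT_e)
  have e_eT: "e \<cdot> eT \<cdot> y = eT \<cdot> e \<cdot> y" for y by (simp add: eT_e)
  have "((br e) ^^ (Suc m + 2)) (ft \<cdot> z) = e \<cdot> ((br e) ^^ (m + 2)) (ft \<cdot> z)"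
    by simp
  also have "\<dots> = ft \<cdot> ?p (m + 3) + hT \<cdot> ?p (m + 2)
    + (of_nat (m + 2)) *s (hT \<cdot> ?p (m + 2) + 2 *s eT \<cdot> ?p (m + 1))
    + (of_nat ((m + 2) * (m + 1))) *s eT \<cdot> ?p (m + 1)"
    unfolding Suc br_add_right br_scale_right e_ft e_hT e_eT
    by (simp add: p3)
  finally have 1: "((br e) ^^ (Suc m + 2)) (ft \<cdot> z) = ft \<cdot> ?p (m + 3) + hT \<cdot> ?p (m + 2)
    + (of_nat (m + 2)) *s (hT \<cdot> ?p (m + 2) + 2 *s eT \<cdot> ?p (m + 1))
    + (of_nat ((m + 2) * (m + 1))) *s eT \<cdot> ?p (m + 1)" .
  have 2: "Suc m + 2 = m + 3" "Suc m + 1 = m + 2" "Suc m = m + 1" by simp_all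
  show ?case unfolding 1 unfolding 2
    by (rule vec_eqI) (simp add: dual_simps algebra_simps p3)
qed

text \<open>Each \<open>ft\<close> costs two further powers of \<open>e\<close>: by
  \<open>e_pow_ft\<close>, at least \<open>2 * n + 2\<close> of the \<open>2 * n + 4\<close> powers
  still act on \<open>wv x n\<close>.\<close>

lemma e_pow_wv: "vac x \<Longrightarrow> ((br e) ^^ (2 * n + 2)) (wv x n) = 0"
proof (induction n)
  case 0
  then show ?case by (simp add: wv_def vac_def eval_nat_numeral)
next
  case (Suc n)
  have z: "((br e) ^^ (k + (2 * n + 2))) (wv x n) = 0" for k
    by (induction k) (use Suc in auto)
  have "2 * Suc n + 2 = (2 * n + 2) + 2" by simp
  then have "((br e) ^^ (2 * Suc n + 2)) (wv x (Suc n)) = ((br e) ^^ ((2 * n + 2) + 2)) (ft \<cdot> wv x n)"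
    by (simp only: wv_simps)
  also have "\<dots> = 0"
    unfolding e_pow_ft using z[of 0] z[of 1] z[of 2] by (simp add: add_ac)
  finally show ?case .
qed

lemma ew_zero:
  assumes "vac x" "i \<ge> 2 * n + 2"
  shows "ew x i n = 0"
proof -
  have "ew x (k + (2 * n + 2)) n = 0" for k
  proof (induction k)
    case 0 then show ?case using e_pow_wv[OF assms(1), of n] by (simp only: ew_def add_0)
  next
    case (Suc k) then show ?case by (simp add: ew_def)
  qed
  from this[of "i - (2 * n + 2)"] show ?thesis
    by (simp only: le_add_diff_inverse2[OF assms(2)])
qed

lemma f_pow_ew_zero: "vac x \<Longrightarrow> i < k \<Longrightarrow> ((br f) ^^ k) (ew x i n) = 0"
proof (induction k arbitrary: i)
  case 0 then show ?case by simp
next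
  case (Suc k)
  have lin: "((br f) ^^ k) (a *s y) = a *s ((br f) ^^ k) y" for a y
    by (induction k) (simp_all add: br_simps)
  have z: "((br f) ^^ k) 0 = 0"
    by (induction k) simp_all
  show ?case
  proof (cases i)
    case 0
    then show ?thesis using Suc.prems z
      by (simp add: funpow_swap1 ew_simps W_f_H_wv)
  next
    case (Suc j)
    then have "((br f) ^^ Suc k) (ew x i n) = ((br f) ^^ k) (f \<cdot> ew x (Suc j) n)"
      by (simp add: funpow_swap1)
    also have "\<dots> = 0"
      unfolding f_ew[OF Suc.prems(1)] lin using Suc.IH[OF Suc.prems(1), of j] Suc.prems(2) Suc by simp
    finally show ?thesis .
  qed
qed

lemma f_pow_ew:
  assumes "vac x"
  shows "\<exists>\<delta>. ((br f) ^^ k) (ew x k n) = \<delta> *s wv x n \<and> (k \<le> 2 * n + 1 \<longrightarrow> \<delta> \<noteq> 0)"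
proof (induction k)
  case 0
  then show ?case by (auto simp: ew_simps intro!: exI[of _ 1])
next
  case (Suc k)
  have lin: "((br f) ^^ k) (a *s y) = a *s ((br f) ^^ k) y" for a y
    by (induction k) (simp_all add: br_simps)
  from Suc obtain \<delta> where \<delta>: "((br f) ^^ k) (ew x k n) = \<delta> *s wv x n" "k \<le> 2 * n + 1 \<Longrightarrow> \<delta> \<noteq> 0"
    by blast
  let ?c = "- (of_nat (Suc k) * (2 * of_nat n + 1 - of_nat k)) :: complex"
  have "((br f) ^^ Suc k) (ew x (Suc k) n) = ((br f) ^^ k) (f \<cdot> ew x (Suc k) n)"
    by (simp add: funpow_swap1)
  then have "((br f) ^^ Suc k) (ew x (Suc k) n) = (?c * \<delta>) *s wv x n"
    unfolding f_ew[OF assms] lin \<delta>(1) scale_scale .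
  moreover have "?c * \<delta> \<noteq> 0" if "Suc k \<le> 2 * n + 1"
  proof -
    have "of_nat (2 * n + 1) \<noteq> (of_nat k :: complex)"
      using that by (simp only: of_nat_eq_iff)
    then have "2 * of_nat n + 1 - of_nat k \<noteq> (0::complex)" by (simp add: add.commute)
    then show ?thesis using \<delta>(2) that by (simp del: of_nat_Suc)
  qed
  ultimately show ?case by blast
qed

lemma span_seq:
  assumes "z \<in> span {g n | n. True}"
  shows "\<exists>N c. z = (\<Sum>n<N::nat. c n *s g n)"
proof -
  let ?S = "{z. \<exists>N c. (\<forall>n\<ge>N. c n = 0) \<and> z = (\<Sum>n<N. c n *s g n)}"
  have "subspace ?S"
  proof (rule subspaceI)
    show "0 \<in> ?S" by (auto intro!: exI[of _ "0::nat"] exI[of _ "\<lambda>_. 0"])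
    fix a b assume "a \<in> ?S" "b \<in> ?S"
    then obtain N c M d where a: "\<forall>n\<ge>N. c n = 0" "a = (\<Sum>n<N. c n *s g n)"
      and b: "\<forall>n\<ge>M. d n = 0" "b = (\<Sum>n<M. d n *s g n)" by blast
    have "a = (\<Sum>n<max N M. c n *s g n)" "b = (\<Sum>n<max N M. d n *s g n)"
      unfolding a(2) b(2) using a(1) b(1) by (auto intro!: sum.mono_neutral_left) (meson not_less)+
    then have "a + b = (\<Sum>n<max N M. (c n + d n) *s g n)"
      by (simp add: scale_left_distrib sum.distrib)
    then show "a + b \<in> ?S" using a(1) b(1)
      by (auto intro!: exI[of _ "max N M"] exI[of _ "\<lambda>n. c n + d n"])
  next
    fix k a assume "a \<in> ?S"
    then obtain N c where a: "\<forall>n\<ge>N. c n = 0" "a = (\<Sum>n<N. c n *s g n)" by blast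
    then have "k *s a = (\<Sum>n<N. (k * c n) *s g n)"
      by (simp add: scale_sum_right)
    then show "k *s a \<in> ?S" using a(1)
      by (auto intro!: exI[of _ N] exI[of _ "\<lambda>n. k * c n"])
  qed
  moreover have "g n \<in> ?S" for n
    by (auto intro!: exI[of _ "Suc n"] exI[of _ "\<lambda>m. if m = n then 1 else 0"] simp: if_distrib[of "\<lambda>k. k *s _"] cong: if_cong)
  ultimately have "span {g n | n. True} \<subseteq> ?S"
    by (intro span_minimal) auto
  with assms show ?thesis by blast
qed

text \<open>Repeated application of \<open>f\<close> moves a nonzero element of a module \<open>W x\<close> to a nonzero
  combination of the lowest weight vectors \<open>wv x n\<close>.\<close>
lemma f_stable_trivial:
  assumes x: "vac x" and P: "subspace P" "P \<subseteq> W x" "\<And>z. z \<in> P \<Longrightarrow> f \<cdot> z \<in> P"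
    and low: "\<And>N c n. (\<Sum>n<N. c n *s wv x n) \<in> P \<Longrightarrow> n < N \<Longrightarrow> c n = 0"
    and z: "z \<in> P"
  shows "z = 0"
proof -
  define B where "B k = {ew x i n | i n. i < k}" for k
  have lin: "((br f) ^^ k) (a + b) = ((br f) ^^ k) a + ((br f) ^^ k) b"
    "((br f) ^^ k) (c *s a) = c *s ((br f) ^^ k) a" for k a b c
    by (induction k) (simp_all add: br_simps)
  have lin0: "((br f) ^^ k) 0 = 0" for k
    by (induction k) simp_all
  have lins: "((br f) ^^ k) (\<Sum>n<N. h n) = (\<Sum>n<N. ((br f) ^^ k) (h n))" for k h and N :: nat
    by (induction N) (simp_all add: lin lin0)
  have Pf: "((br f) ^^ k) y \<in> P" if "y \<in> P" for k y
    by (induction k) (use that P(3) in auto)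
  have *: "\<forall>y \<in> P. y \<in> span (B k) \<longrightarrow> y = 0" for k
  proof (induction k)
    case 0 then show ?case by (simp add: B_def)
  next
    case (Suc k)
    show ?case
    proof (intro ballI impI)
      fix y assume y: "y \<in> P" "y \<in> span (B (Suc k))"
      have "B (Suc k) = B k \<union> {ew x k n | n. True}"
        by (auto simp: B_def less_Suc_eq)
      with y(2) obtain a b where ab: "y = a + b" "a \<in> span (B k)" "b \<in> span {ew x k n | n. True}"
        by (auto simp: span_Un)
      obtain N c where b: "b = (\<Sum>n<N. c n *s ew x k n)" using span_seq[OF ab(3)] by blast
      obtain \<delta> where \<delta>: "\<And>n. ((br f) ^^ k) (ew x k n) = \<delta> n *s wv x n" "\<And>n. k \<le> 2 * n + 1 \<Longrightarrow> \<delta> n \<noteq> 0"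
        using f_pow_ew[OF x, of k] by metis
      have "subspace {y. ((br f) ^^ k) y = 0}"
        by (auto simp: subspace_def lin lin0)
      then have "span (B k) \<subseteq> {y. ((br f) ^^ k) y = 0}"
        by (intro span_minimal) (auto simp: B_def f_pow_ew_zero[OF x])
      then have "((br f) ^^ k) y = (\<Sum>n<N. (c n * \<delta> n) *s wv x n)"
        using ab(2) by (auto simp: ab(1) lin b lins \<delta>(1))
      with Pf[OF y(1), of k] have c: "c n * \<delta> n = 0" if "n < N" for n
        using low[of "\<lambda>n. c n * \<delta> n" N] that by simp
      \<comment> \<open>Beyond \<open>k = 2 * n + 1\<close> the factor \<open>\<delta> n\<close> may
        vanish, but then the vector \<open>ew x k n\<close> is itself zero.\<close>
      have "c n *s ew x k n = 0" if "n < N" for n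
      proof (cases "k \<le> 2 * n + 1")
        case True then show ?thesis using c[OF that] \<delta>(2) by simp
      next
        case False then show ?thesis using ew_zero[OF x, of n k] by simp
      qed
      then have "b = 0" unfolding b by (intro sum.neutral) auto
      then show "y = 0" using ab Suc y(1) by simp
    qed
  qed
  have "W x \<subseteq> (\<Union>k. span (B k))"
  proof -
    have mono: "span (B k) \<subseteq> span (B m)" if "k \<le> m" for k m
      using that by (intro span_mono) (auto simp: B_def)
    have "subspace (\<Union>k. span (B k))"
    proof (rule subspaceI)
      show "0 \<in> (\<Union>k. span (B k))" by (auto simp: span_zero)
      fix a b assume "a \<in> (\<Union>k. span (B k))" "b \<in> (\<Union>k. span (B k))"
      then obtain k m where "a \<in> span (B k)" "b \<in> span (B m)" by blast
      then have "a \<in> span (B (max k m))" "b \<in> span (B (max k m))"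
        using mono[of k "max k m"] mono[of m "max k m"] by auto
      then show "a + b \<in> (\<Union>k. span (B k))" using span_add by blast
    next
      fix c a assume "a \<in> (\<Union>k. span (B k))"
      then show "c *s a \<in> (\<Union>k. span (B k))" using span_scale by blast
    qed
    moreover have "ew x i n \<in> span (B (Suc i))" for i n
      by (rule span_base) (auto simp: B_def)
    ultimately show ?thesis unfolding W_def by (intro span_minimal) auto
  qed
  then show ?thesis using * P(2) z by blast
qed

end

section \<open>Structure of the presented algebra\<close>

context sl2_triple_pair
begin

lemma T_e_pow:
  assumes "subspace S" "\<And>x. x \<in> S \<Longrightarrow> e \<cdot> x \<in> S" "ft \<cdot> z \<in> S" "hT \<cdot> z \<in> S" "eT \<cdot> z \<in> S"
  shows "ft \<cdot> ((br e) ^^ j) z \<in> S \<and> hT \<cdot> ((br e) ^^ j) z \<in> S \<and> eT \<cdot> ((br e) ^^ j) z \<in> S"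
  by (induction j)
    (simp_all add: assms ft_e hT_e eT_e subspace_diff subspace_scale)

text \<open>The alternative in the hypothesis on \<open>ft\<close> allows two stages: a family may
  be closed under \<open>ft\<close> only up to operators already known to preserve
  \<open>W x\<close>. The \<open>e\<close>-powers of \<open>s\<close> come first, those of
  \<open>y\<close> second.\<close>

lemma W_stable:
  assumes x: "vac x" and Z: "Z \<subseteq> Ev" "\<And>z. z \<in> Z \<Longrightarrow> e \<cdot> z \<in> Z"
    "\<And>z. z \<in> Z \<Longrightarrow> ft \<cdot> z \<in> Z \<or> (\<forall>q\<in>W x. (ft \<cdot> z) \<cdot> q \<in> W x)"
    "\<And>z. z \<in> Z \<Longrightarrow> z \<cdot> x \<in> W x"
    and z: "z \<in> Z" and q: "q \<in> W x"
  shows "z \<cdot> q \<in> W x"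
proof -
  have wv: "\<forall>z\<in>Z. z \<cdot> wv x n \<in> W x" for n
  proof (induction n)
    case 0 then show ?case using Z(4) by (simp add: wv_simps)
  next
    case (Suc n)
    show ?case
    proof
      fix z assume z: "z \<in> Z"
      have "(ft \<cdot> z) \<cdot> wv x n \<in> W x"
        using Z(3)[OF z] Suc ew_in_W[of x 0 n] by (auto simp: ew_simps)
      moreover have "ft \<cdot> z \<cdot> wv x n \<in> W x"
        using Suc z W_ft_hT_eT[OF x] by blast
      moreover have "z \<cdot> wv x (Suc n) = ft \<cdot> z \<cdot> wv x n - (ft \<cdot> z) \<cdot> wv x n"
        using jacobi_Ev[OF ft_Ev, of z "wv x n"] by (simp add: wv_simps)
      ultimately show "z \<cdot> wv x (Suc n) \<in> W x" by (simp add: W_closed)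
    qed
  qed
  have "\<forall>z\<in>Z. z \<cdot> ew x i n \<in> W x" for i n
  proof (induction i)
    case 0 then show ?case using wv by (simp add: ew_simps)
  next
    case (Suc i)
    have "z \<cdot> ew x (Suc i) n = e \<cdot> z \<cdot> ew x i n - (e \<cdot> z) \<cdot> ew x i n" for z
      using jacobi_Ev[OF e_Ev, of z "ew x i n"] by (simp add: ew_simps)
    then show ?case using Suc Z(2) by (simp add: W_closed W_e)
  qed
  then show ?thesis using W_br[of z x q] z q by blast
qed

end

inductive_set (in lie_superalgebra) subalg :: "'a set \<Rightarrow> 'a set" for B where
  base: "x \<in> B \<Longrightarrow> x \<in> subalg B"
| zero: "0 \<in> subalg B"
| add: "x \<in> subalg B \<Longrightarrow> z \<in> subalg B \<Longrightarrow> x + z \<in> subalg B"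
| scale: "x \<in> subalg B \<Longrightarrow> k *s x \<in> subalg B"
| br: "x \<in> subalg B \<Longrightarrow> z \<in> subalg B \<Longrightarrow> x \<cdot> z \<in> subalg B"

context lie_superalgebra
begin

lemma subspace_subalg: "subspace (subalg B)"
  by (auto simp: subspace_def subalg.zero subalg.add subalg.scale)

lemma subalg_Ev: "B \<subseteq> Ev \<Longrightarrow> x \<in> subalg B \<Longrightarrow> x \<in> Ev"
  by (rotate_tac, induction rule: subalg.induct)
    (auto simp: Ev_closed subspace_0[OF subspace_Ev])

end

text \<open>Write differential operators on functions \<open>p + q \<theta>\<close> as two by two matrices with block
  indices 0 and 1. In that model \<open>u = E01\<close>, \<open>v = - d E10\<close>, \<open>f = d\<close>, \<open>ft = d E00\<close>,
  \<open>y = - d d / 2\<close>, and \<open>c\<close> has eigenvalues 1, 0, -1 on the blocks 01, diagonal, 10. The axioms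
  are symmetric under exchanging \<open>u\<close> with \<open>v\<close> and changing the signs of \<open>c\<close> and \<open>y\<close>.\<close>

locale lie_core = sl2_triple_pair +
  fixes u v c y :: 'a
  assumes u_Od [simp]: "u \<in> Od" and v_Od [simp]: "v \<in> Od" and c_Ev [simp]: "c \<in> Ev" and y_Ev [simp]: "y \<in> Ev"
    and vac_u: "vac u" and vac_v: "vac v"
    and c_u: "c \<cdot> u = u" and c_v: "c \<cdot> v = - v"
    and c_e: "c \<cdot> e = 0" and c_f: "c \<cdot> f = 0" and c_ft: "c \<cdot> ft = 0" and c_y: "c \<cdot> y = 0"
    and u_v: "u \<cdot> v = - f"
    and u_u: "u \<cdot> u = 0" and u_eu: "u \<cdot> e \<cdot> u = 0" and eu_eu: "(e \<cdot> u) \<cdot> e \<cdot> u = 0"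
    and v_v: "v \<cdot> v = 0" and v_ev: "v \<cdot> e \<cdot> v = 0" and ev_ev: "(e \<cdot> v) \<cdot> e \<cdot> v = 0"
    and u_ev: "2 *s u \<cdot> e \<cdot> v = c - H" and v_eu: "2 *s v \<cdot> e \<cdot> u = - c - H"
    and ft_y: "ft \<cdot> y = 0"
    and y_u: "y \<cdot> u = 0" and y_v: "y \<cdot> v = 0"
    and y_eu: "y \<cdot> e \<cdot> u = ft \<cdot> u" and y_ev: "y \<cdot> e \<cdot> v = - (ft \<cdot> v)"
    and y_eq: "2 *s y = (ft \<cdot> u) \<cdot> v"
    and u_ftu: "u \<cdot> ft \<cdot> u = 0" and eu_ftu: "(e \<cdot> u) \<cdot> ft \<cdot> u = 0"
    and v_ftv: "v \<cdot> ft \<cdot> v = 0" and ev_ftv: "(e \<cdot> v) \<cdot> ft \<cdot> v = 0"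
begin

section \<open>Brackets of low degree between the two odd modules\<close>

lemma Od_simps [simp]: "e \<cdot> u \<in> Od" "e \<cdot> v \<in> Od" "ft \<cdot> u \<in> Od" "ft \<cdot> v \<in> Od"
  "e \<cdot> ft \<cdot> u \<in> Od" "e \<cdot> ft \<cdot> v \<in> Od" "ft \<cdot> ft \<cdot> u \<in> Od" "ft \<cdot> ft \<cdot> v \<in> Od"
  by (simp_all add: Od_closed)

lemma vac_simps:
  "f \<cdot> u = 0" "H \<cdot> u = u" "e \<cdot> e \<cdot> u = 0" "3 *s ft \<cdot> e \<cdot> u = e \<cdot> ft \<cdot> u - (3 * \<mu>) *s u"
  "f \<cdot> v = 0" "H \<cdot> v = v" "e \<cdot> e \<cdot> v = 0" "3 *s ft \<cdot> e \<cdot> v = e \<cdot> ft \<cdot> v - (3 * \<mu>) *s v"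
  using vac_u vac_v by (simp_all add: vac_def)

lemma ft_f: "ft \<cdot> f = 0"
  using antisym_Ev[of f ft] f_ft by simp

lemma v_u: "v \<cdot> u = - f"
  using sym_Od[of u v] u_v by simp

lemma y_eq': "u \<cdot> ft \<cdot> v = (-2) *s y"
proof -
  have "ft \<cdot> u \<cdot> v = 0" by (simp add: u_v br_minus ft_f)
  then show ?thesis using jacobi_Ev[OF ft_Ev, of u v]
    by (simp add: eq_neg_iff_add_eq_0 add.commute flip: y_eq)
qed

lemma lie_core_swap: "lie_core scale br Ev Od e f ft \<mu> v u (- c) (- y)"
proof -
  have "2 *s (- y) = (ft \<cdot> v) \<cdot> u"
    using y_eq' sym_Od[of "ft \<cdot> v" u] by simp
  then show ?thesis
    using sym_Od[of u v]
    by unfold_locales (simp_all add: Ev_closed vac_u vac_v br_minus c_u c_v c_e c_f c_ft c_y u_v u_u u_eu eu_eu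
      v_v v_ev ev_ev u_ev v_eu ft_y y_u y_v y_eu y_ev u_ftu eu_ftu v_ftv ev_ftv)
qed

text \<open>In the block matrix model this is \<open>-2 d d E00\<close>, four times the upper
  diagonal block of \<open>y\<close>.\<close>

definition "s = hT \<cdot> y"

lemma s_Ev [simp]: "s \<in> Ev" by (simp add: s_def Ev_closed)

lemma ft_H: "ft \<cdot> H = (-2) *s ft"
  using antisym_Ev[of H ft] H_ft by (simp add: H_def Ev_closed)

lemma ft_ey: "ft \<cdot> e \<cdot> y = - s"
  by (simp add: ft_e ft_y s_def)

text \<open>Four unknown brackets and four linear equations: \<open>ft\<close> applied to
  \<open>u_ev\<close> and \<open>v_eu\<close>, and \<open>e\<close> applied to the two descriptions
  of \<open>y\<close>. Each equation contains two unknowns, so the four formulas are solved for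
  together.\<close>

lemma ev_ftu: "2 *s (e \<cdot> v) \<cdot> ft \<cdot> u = 3 *s ft - (3 * \<mu>) *s f + e \<cdot> y"
  and eu_ftv: "2 *s (e \<cdot> u) \<cdot> ft \<cdot> v = 3 *s ft - (3 * \<mu>) *s f - e \<cdot> y"
  and v_eftu: "2 *s v \<cdot> e \<cdot> ft \<cdot> u = 3 *s e \<cdot> y - 3 *s ft + (3 * \<mu>) *s f"
  and u_eftv: "2 *s u \<cdot> e \<cdot> ft \<cdot> v = (-3) *s e \<cdot> y - 3 *s ft + (3 * \<mu>) *s f"
proof -
  have c': "ft \<cdot> c = 0" using antisym_Ev[of c ft] c_ft by simp
  have a: "ft \<cdot> (2 *s u \<cdot> e \<cdot> v) = ft \<cdot> (c - H)" by (simp only: u_ev)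
  have a': "u \<cdot> (3 *s ft \<cdot> e \<cdot> v) = u \<cdot> (e \<cdot> ft \<cdot> v - (3 * \<mu>) *s v)" by (simp only: vac_simps)
  have b: "ft \<cdot> (2 *s v \<cdot> e \<cdot> u) = ft \<cdot> (- c - H)" by (simp only: v_eu)
  have b': "v \<cdot> (3 *s ft \<cdot> e \<cdot> u) = v \<cdot> (e \<cdot> ft \<cdot> u - (3 * \<mu>) *s u)" by (simp only: vac_simps)
  have d: "e \<cdot> (2 *s y) = e \<cdot> (ft \<cdot> u) \<cdot> v" by (simp only: y_eq)
  have d': "e \<cdot> u \<cdot> ft \<cdot> v = e \<cdot> ((-2) *s y)" by (simp only: y_eq')
  note sy = sym_Od[of "ft \<cdot> u" "e \<cdot> v"] sym_Od[of "ft \<cdot> v" "e \<cdot> u"] sym_Od[of "e \<cdot> ft \<cdot> u" v]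
    v_u sym_Od[of "e \<cdot> ft \<cdot> v" u]
  have goal: "coord h (2 *s (e \<cdot> v) \<cdot> ft \<cdot> u) = coord h (3 *s ft - (3 * \<mu>) *s f + e \<cdot> y)
    \<and> coord h (2 *s (e \<cdot> u) \<cdot> ft \<cdot> v) = coord h (3 *s ft - (3 * \<mu>) *s f - e \<cdot> y)
    \<and> coord h (2 *s v \<cdot> e \<cdot> ft \<cdot> u) = coord h (3 *s e \<cdot> y - 3 *s ft + (3 * \<mu>) *s f)
    \<and> coord h (2 *s u \<cdot> e \<cdot> ft \<cdot> v) = coord h ((-3) *s e \<cdot> y - 3 *s ft + (3 * \<mu>) *s f)"
    if d0: "dual h" for h
  proof -
    define p where "p = coord h ((e \<cdot> v) \<cdot> ft \<cdot> u)"
    define r where "r = coord h ((e \<cdot> u) \<cdot> ft \<cdot> v)"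
    define k where "k = coord h (v \<cdot> e \<cdot> ft \<cdot> u)"
    define l where "l = coord h (u \<cdot> e \<cdot> ft \<cdot> v)"
    define F where "F = coord h f"
    define T where "T = coord h ft"
    define Y where "Y = coord h (e \<cdot> y)"
    have 1: "3 * p + l + 3 * \<mu> * F = 3 * T"
      using coord_cong[OF a, of h] coord_cong[OF a', of h]
      by (simp add: sy jacobi_Ev[OF ft_Ev, of u "e \<cdot> v"] u_v br_simps c' ft_H dual_simps[OF d0] p_def l_def F_def T_def; algebra)
    have 2: "3 * r + k + 3 * \<mu> * F = 3 * T"
      using coord_cong[OF b, of h] coord_cong[OF b', of h]
      by (simp add: sy jacobi_Ev[OF ft_Ev, of v "e \<cdot> u"] u_v br_simps c' ft_H dual_simps[OF d0] r_def k_def F_def T_def; algebra)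
    have 3: "2 * Y = k + p"
      using coord_cong[OF d, of h]
      by (simp add: sy jacobi_Ev[OF e_Ev, of "ft \<cdot> u" v] br_simps dual_simps[OF d0] p_def k_def Y_def)
    have 4: "- 2 * Y = r + l"
      using coord_cong[OF d', of h]
      by (simp add: sy jacobi_Ev[OF e_Ev, of u "ft \<cdot> v"] br_simps dual_simps[OF d0] r_def l_def Y_def)
    have "2 * p = 3 * T - 3 * \<mu> * F + Y" "2 * r = 3 * T - 3 * \<mu> * F - Y"
      "2 * k = 3 * Y - 3 * T + 3 * \<mu> * F" "2 * l = - 3 * Y - 3 * T + 3 * \<mu> * F"
      using 1 2 3 4 by algebra+
    then show ?thesis
      by (simp add: dual_simps[OF d0] p_def r_def k_def l_def F_def T_def Y_def)
  qed
  show "2 *s (e \<cdot> v) \<cdot> ft \<cdot> u = 3 *s ft - (3 * \<mu>) *s f + e \<cdot> y"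
    "2 *s (e \<cdot> u) \<cdot> ft \<cdot> v = 3 *s ft - (3 * \<mu>) *s f - e \<cdot> y"
    "2 *s v \<cdot> e \<cdot> ft \<cdot> u = 3 *s e \<cdot> y - 3 *s ft + (3 * \<mu>) *s f"
    "2 *s u \<cdot> e \<cdot> ft \<cdot> v = (-3) *s e \<cdot> y - 3 *s ft + (3 * \<mu>) *s f"
    using goal by (auto intro!: vec_eqI)
qed

text \<open>The case \<open>n = 1\<close> of \<open>hT_wv\<close> with its scalar made
  explicit.\<close>

lemma hT_ftu: "5 *s hT \<cdot> ft \<cdot> u = 2 *s e \<cdot> ft \<cdot> ft \<cdot> u + (3 * \<mu> + 6) *s ft \<cdot> u"
  (is "?l = ?r")
proof (rule vec_eqI)
  fix h assume d: "dual h"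
  have "ft \<cdot> (3 *s hT \<cdot> u) = ft \<cdot> (2 *s e \<cdot> ft \<cdot> u + (3 * \<mu>) *s u)"
    by (simp only: hT_vac[OF vac_u])
  from coord_cong[OF this, of h] coord_cong[OF hT_ft'[of u], of h]
  show "coord h ?l = coord h ?r"
    by (simp add: br_simps ft_e[of "ft \<cdot> u"] dual_simps[OF d] algebra_simps)
qed

lemma ft_e_ftu: "5 *s ft \<cdot> e \<cdot> ft \<cdot> u = 3 *s e \<cdot> ft \<cdot> ft \<cdot> u - (3 * \<mu> + 6) *s ft \<cdot> u"
  (is "?l = ?r")
proof (rule vec_eqI)
  fix h assume d: "dual h"
  show "coord h ?l = coord h ?r"
    using coord_cong[OF hT_ftu, of h] by (simp add: ft_e[of "ft \<cdot> u"] dual_simps[OF d]; algebra)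
qed

lemma v_ftu: "v \<cdot> ft \<cdot> u = 2 *s y"
  using sym_Od[of v "ft \<cdot> u"] by (simp add: y_eq)

lemma ev_ftftu: "6 *s (e \<cdot> v) \<cdot> ft \<cdot> ft \<cdot> u =
    (-3) *s s - 2 *s (e \<cdot> ft \<cdot> v) \<cdot> ft \<cdot> u + (12 * \<mu>) *s y"
  (is "?l = ?r")
proof (rule vec_eqI)
  fix h assume d: "dual h"
  have 1: "ft \<cdot> (2 *s (e \<cdot> v) \<cdot> ft \<cdot> u) = ft \<cdot> (3 *s ft - (3 * \<mu>) *s f + e \<cdot> y)"
    by (simp only: ev_ftu)
  have 2: "(3 *s ft \<cdot> e \<cdot> v) \<cdot> ft \<cdot> u = (e \<cdot> ft \<cdot> v - (3 * \<mu>) *s v) \<cdot> ft \<cdot> u"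
    by (simp only: vac_simps)
  show "coord h ?l = coord h ?r"
    using coord_cong[OF 1, of h] coord_cong[OF 2, of h]
    by (simp add: jacobi_Ev[OF ft_Ev, of "e \<cdot> v" "ft \<cdot> u"] br_simps ft_f ft_ey self_br_Ev v_ftu dual_simps[OF d]; algebra)
qed

lemma v_eftftu: "3 *s v \<cdot> e \<cdot> ft \<cdot> ft \<cdot> u =
    (6 * \<mu> + 12) *s y - 5 *s (ft \<cdot> v) \<cdot> e \<cdot> ft \<cdot> u - (15 / 2) *s s"
  (is "?l = ?r")
proof (rule vec_eqI)
  fix h assume d: "dual h"
  have 1: "ft \<cdot> (2 *s v \<cdot> e \<cdot> ft \<cdot> u) = ft \<cdot> (3 *s e \<cdot> y - 3 *s ft + (3 * \<mu>) *s f)"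
    by (simp only: v_eftu)
  have 2: "v \<cdot> (5 *s ft \<cdot> e \<cdot> ft \<cdot> u) = v \<cdot> (3 *s e \<cdot> ft \<cdot> ft \<cdot> u - (3 * \<mu> + 6) *s ft \<cdot> u)"
    by (simp only: ft_e_ftu)
  show "coord h ?l = coord h ?r"
    using coord_cong[OF 1, of h] coord_cong[OF 2, of h]
    by (simp add: jacobi_Ev[OF ft_Ev, of v "e \<cdot> ft \<cdot> u"] br_simps ft_f ft_ey self_br_Ev v_ftu dual_simps[OF d] field_simps; algebra)
qed

text \<open>Comes from \<open>ft \<cdot> v \<cdot> ft \<cdot> u = 0\<close> by applying
  \<open>e\<close>; the two preceding lemmas remove the brackets that contain
  \<open>ft \<cdot> ft \<cdot> u\<close>.\<close>

lemma eftv_ftu: "2 *s (e \<cdot> ft \<cdot> v) \<cdot> ft \<cdot> u = 2 *s (ft \<cdot> v) \<cdot> e \<cdot> ft \<cdot> u + 9 *s s - (12 * (\<mu> + 1)) *s y"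
  (is "?l = ?r")
proof (rule vec_eqI)
  fix h assume d: "dual h"
  have "ft \<cdot> v \<cdot> ft \<cdot> u = 0" by (simp add: v_ftu br_simps ft_y)
  then have "(ft \<cdot> v) \<cdot> ft \<cdot> u + v \<cdot> ft \<cdot> ft \<cdot> u = 0"
    using jacobi_Ev[OF ft_Ev, of v "ft \<cdot> u"] by simp
  then have 1: "e \<cdot> ((ft \<cdot> v) \<cdot> ft \<cdot> u + v \<cdot> ft \<cdot> ft \<cdot> u) = 0" by simp
  show "coord h ?l = coord h ?r"
    using coord_cong[OF 1, of h] coord_cong[OF v_eftftu, of h] coord_cong[OF ev_ftftu, of h]
    by (simp add: jacobi_Ev[OF e_Ev, of v "ft \<cdot> ft \<cdot> u"] jacobi_Ev[OF e_Ev, of "ft \<cdot> v" "ft \<cdot> u"] br_simps dual_simps[OF d] field_simps; algebra)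
qed

text \<open>Obtained by bracketing \<open>ev_ftu\<close> with \<open>e\<close> and then with
  \<open>ft\<close>. The bracket of \<open>e \<cdot> ft \<cdot> v\<close> with
  \<open>e \<cdot> ft \<cdot> u\<close> remains unknown, but it is symmetric in \<open>u\<close> and
  \<open>v\<close>.\<close>

lemma ft_eey:
  "30 *s eT \<cdot> y - 30 *s e \<cdot> s + (90 * (\<mu> - 1)) *s ft = 10 *s (e \<cdot> ft \<cdot> v) \<cdot> e \<cdot> ft \<cdot> u - 9 *s e \<cdot> s
     - 6 *s e \<cdot> (e \<cdot> ft \<cdot> v) \<cdot> ft \<cdot> u + (36 * \<mu>) *s e \<cdot> y - (18 * \<mu> + 36) *s (e \<cdot> v) \<cdot> ft \<cdot> u
     - (30 * \<mu>) *s v \<cdot> e \<cdot> ft \<cdot> u"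
proof (rule vec_eqI)
  fix h assume d: "dual h"
  have ft_hT: "ft \<cdot> hT = (-2) *s ft" by (rule ft_hT)
  have eev: "e \<cdot> (e \<cdot> v) \<cdot> z = (e \<cdot> v) \<cdot> e \<cdot> z" for z
    using jacobi_Ev[OF e_Ev, of "e \<cdot> v" z] by (simp add: vac_simps)
  have eR: "e \<cdot> ft = hT" "e \<cdot> f = H" by (simp_all add: hT_def H_def)
  have "ft \<cdot> e \<cdot> (2 *s (e \<cdot> v) \<cdot> ft \<cdot> u) = ft \<cdot> e \<cdot> (3 *s ft - (3 * \<mu>) *s f + e \<cdot> y)"
    by (simp only: ev_ftu)
  moreover have "ft \<cdot> e \<cdot> (3 *s ft - (3 * \<mu>) *s f + e \<cdot> y) = (6 * \<mu> - 6) *s ft - 2 *s e \<cdot> s + 2 *s eT \<cdot> y"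
    by (rule vec_eqI) (simp add: br_simps eR ft_hT ft_H ft_e_e[of y] ft_y dual_simps algebra_simps flip: s_def)
  ultimately have 1: "2 *s ft \<cdot> (e \<cdot> v) \<cdot> e \<cdot> ft \<cdot> u = (6 * \<mu> - 6) *s ft - 2 *s e \<cdot> s + 2 *s eT \<cdot> y"
    by (simp add: br_simps eev)
  have 2: "(3 *s ft \<cdot> e \<cdot> v) \<cdot> e \<cdot> ft \<cdot> u = (e \<cdot> ft \<cdot> v - (3 * \<mu>) *s v) \<cdot> e \<cdot> ft \<cdot> u"
    by (simp only: vac_simps)
  have 3: "(e \<cdot> v) \<cdot> (5 *s ft \<cdot> e \<cdot> ft \<cdot> u) = (e \<cdot> v) \<cdot> (3 *s e \<cdot> ft \<cdot> ft \<cdot> u - (3 * \<mu> + 6) *s ft \<cdot> u)"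
    by (simp only: ft_e_ftu)
  have 4: "e \<cdot> (6 *s (e \<cdot> v) \<cdot> ft \<cdot> ft \<cdot> u) = e \<cdot> ((-3) *s s - 2 *s (e \<cdot> ft \<cdot> v) \<cdot> ft \<cdot> u + (12 * \<mu>) *s y)"
    by (simp only: ev_ftftu)
  show "coord h (30 *s eT \<cdot> y - 30 *s e \<cdot> s + (90 * (\<mu> - 1)) *s ft) = coord h (10 *s (e \<cdot> ft \<cdot> v) \<cdot> e \<cdot> ft \<cdot> u - 9 *s e \<cdot> s
     - 6 *s e \<cdot> (e \<cdot> ft \<cdot> v) \<cdot> ft \<cdot> u + (36 * \<mu>) *s e \<cdot> y - (18 * \<mu> + 36) *s (e \<cdot> v) \<cdot> ft \<cdot> u
     - (30 * \<mu>) *s v \<cdot> e \<cdot> ft \<cdot> u)"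
    using coord_cong[OF 1, of h] coord_cong[OF 2, of h] coord_cong[OF 3, of h] coord_cong[OF 4, of h]
    by (simp add: jacobi_Ev[OF ft_Ev, of "e \<cdot> v" "e \<cdot> ft \<cdot> u"] br_simps eev dual_simps[OF d]; algebra)
qed

text \<open>Comparing \<open>ft_eey\<close> with its mirror image eliminates the unknown symmetric
  bracket, while \<open>y\<close> and \<open>s\<close> change sign. In the model both sides only see
  the upper diagonal block. The identity is what makes the span of the \<open>e\<close>-powers of
  \<open>s\<close> stable under \<open>ft\<close>.\<close>

lemma eT_y: "4 *s eT \<cdot> y = e \<cdot> s"
  (is "?l = ?r")
proof (rule vec_eqI)
  interpret sw: lie_core scale br Ev Od e f ft \<mu> v u "- c" "- y" by (rule lie_core_swap)
  fix h assume d: "dual h"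
  have sws: "sw.s = - s" by (simp add: sw.s_def s_def br_minus)
  have sy: "(e \<cdot> ft \<cdot> u) \<cdot> e \<cdot> ft \<cdot> v = (e \<cdot> ft \<cdot> v) \<cdot> e \<cdot> ft \<cdot> u"
    "(e \<cdot> ft \<cdot> u) \<cdot> ft \<cdot> v = (ft \<cdot> v) \<cdot> e \<cdot> ft \<cdot> u"
    by (simp_all add: sym_Od)
  have 1: "e \<cdot> (2 *s (e \<cdot> ft \<cdot> v) \<cdot> ft \<cdot> u) = e \<cdot> (2 *s (ft \<cdot> v) \<cdot> e \<cdot> ft \<cdot> u + 9 *s s - (12 * (\<mu> + 1)) *s y)"
    by (simp only: eftv_ftu)
  show "coord h ?l = coord h ?r"
    using coord_cong[OF ft_eey, of h] coord_cong[OF sw.ft_eey, of h] coord_cong[OF 1, of h]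
      coord_cong[OF ev_ftu, of h] coord_cong[OF eu_ftv, of h]
      coord_cong[OF v_eftu, of h] coord_cong[OF u_eftv, of h]
    by (simp add: sws sy br_simps dual_simps[OF d]; algebra)
qed

lemma ft_s: "ft \<cdot> s = 0"
  using hT_ft'[of y] by (simp add: s_def ft_y)

lemma hT_s: "hT \<cdot> s = 4 *s s"
proof -
  have "ft \<cdot> (4 *s eT \<cdot> y) = ft \<cdot> e \<cdot> s" by (simp only: eT_y)
  moreover have "ft \<cdot> eT \<cdot> y = - s"
    using eT_ft'[of y] by (simp add: ft_y s_def eq_neg_iff_add_eq_0)
  moreover have "ft \<cdot> e \<cdot> s = - (hT \<cdot> s)"
    by (simp add: ft_e ft_s)
  ultimately show ?thesis by (simp add: br_simps)
qed

lemma eT_s: "eT \<cdot> s = e \<cdot> s"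
proof -
  have "6 *s eT \<cdot> s = 6 *s e \<cdot> s"
  proof (rule vec_eqI)
    fix h assume d: "dual h"
    have "hT \<cdot> (4 *s eT \<cdot> y) = hT \<cdot> e \<cdot> s" by (simp only: eT_y)
    then have 1: "4 *s hT \<cdot> eT \<cdot> y = 4 *s e \<cdot> s - 2 *s eT \<cdot> s"
      by (simp add: br_simps hT_e hT_s)
    have 2: "eT \<cdot> s = hT \<cdot> eT \<cdot> y + 2 *s eT \<cdot> y"
      unfolding s_def by (rule eT_hT')
    show "coord h (6 *s eT \<cdot> s) = coord h (6 *s e \<cdot> s)"
      using coord_cong[OF 1, of h] coord_cong[OF 2, of h] coord_cong[OF eT_y, of h]
      unfolding dual_simps[OF d] by algebra
  qed
  then show ?thesis by simp
qed

lemma ft_y_z: "ft \<cdot> y \<cdot> z = y \<cdot> ft \<cdot> z"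
  using jacobi_Ev[OF ft_Ev, of y z] by (simp add: ft_y)

lemma ft_s_z: "ft \<cdot> s \<cdot> z = s \<cdot> ft \<cdot> z"
  using jacobi_Ev[OF ft_Ev, of s z] by (simp add: ft_s)

lemma s_z: "s \<cdot> z = hT \<cdot> y \<cdot> z - y \<cdot> hT \<cdot> z"
  using jacobi_Ev[of hT y z] by (simp add: s_def)

section \<open>Stability of the odd modules under \<open>y\<close>\<close>

definition "ypow = range (\<lambda>j. ((br e) ^^ j) y)"
text \<open>A span, because it has to be stable under \<open>ft\<close>; for \<open>ypow\<close> a
  bare set is enough, since \<open>ft\<close> carries it into \<open>spow\<close>.\<close>

definition "spow = span (range (\<lambda>j. ((br e) ^^ j) s))"

lemma ypow_Ev: "z \<in> ypow \<Longrightarrow> z \<in> Ev"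
proof -
  have "((br e) ^^ j) y \<in> Ev" for j by (induction j) (simp_all add: Ev_closed)
  then show "z \<in> ypow \<Longrightarrow> z \<in> Ev" by (auto simp: ypow_def)
qed

lemma spow_Ev: "spow \<subseteq> Ev"
proof -
  have "((br e) ^^ j) s \<in> Ev" for j by (induction j) (simp_all add: Ev_closed)
  then show ?thesis unfolding spow_def by (intro span_minimal subspace_Ev) auto
qed

lemma e_ypow: "z \<in> ypow \<Longrightarrow> e \<cdot> z \<in> ypow"
  by (auto simp: ypow_def) (metis comp_apply funpow.simps(2) rangeI)

lemma s_pow_in: "((br e) ^^ j) s \<in> spow"
  unfolding spow_def by (rule span_base) auto

lemma e_spow: "z \<in> spow \<Longrightarrow> e \<cdot> z \<in> spow"
proof (rule span_br_closed[of "range (\<lambda>j. ((br e) ^^ j) s)" _ spow])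
  have "e \<cdot> ((br e) ^^ j) s \<in> spow" for j
    using s_pow_in[of "Suc j"] by simp
  then show "x \<in> range (\<lambda>j. ((br e) ^^ j) s) \<Longrightarrow> e \<cdot> x \<in> spow" for x by auto
qed (simp_all add: spow_def)

lemma subspace_spow: "subspace spow"
  by (simp add: spow_def)

lemma ft_spow: "z \<in> spow \<Longrightarrow> ft \<cdot> z \<in> spow"
proof (rule span_br_closed[of "range (\<lambda>j. ((br e) ^^ j) s)" _ spow])
  have "ft \<cdot> s \<in> spow" "hT \<cdot> s \<in> spow" "eT \<cdot> s \<in> spow"
    using s_pow_in[of 0] s_pow_in[of 1] subspace_spow
    by (simp_all add: ft_s hT_s eT_s subspace_0 subspace_scale)
  then have "ft \<cdot> ((br e) ^^ j) s \<in> spow" for j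
    using T_e_pow[OF subspace_spow e_spow] by blast
  then show "x \<in> range (\<lambda>j. ((br e) ^^ j) s) \<Longrightarrow> ft \<cdot> x \<in> spow" for x by auto
qed (simp_all add: subspace_spow flip: spow_def)

lemma ft_ypow: "z \<in> ypow \<Longrightarrow> ft \<cdot> z \<in> spow"
proof -
  have "eT \<cdot> y = (1/4) *s (4 *s eT \<cdot> y)" by simp
  then have "ft \<cdot> y \<in> spow" "hT \<cdot> y \<in> spow" "eT \<cdot> y \<in> spow"
    using s_pow_in[of 0] s_pow_in[of 1] subspace_spow unfolding eT_y
    by (simp_all add: ft_y subspace_0 subspace_scale flip: s_def)
  then have "ft \<cdot> ((br e) ^^ j) y \<in> spow" for j
    using T_e_pow[OF subspace_spow e_spow] by blast
  then show "z \<in> ypow \<Longrightarrow> ft \<cdot> z \<in> spow" by (auto simp: ypow_def)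
qed

text \<open>The two vectors \<open>u\<close> and \<open>v\<close> differ only in the sign \<open>\<sigma>\<close> with which \<open>y\<close> acts.\<close>
context
  fixes x :: 'a and \<sigma> :: complex
  assumes vac: "vac x" and y_x: "y \<cdot> x = 0" and y_ex: "y \<cdot> e \<cdot> x = \<sigma> *s ft \<cdot> x"
begin

lemma vacx: "f \<cdot> x = 0" "H \<cdot> x = x" "e \<cdot> e \<cdot> x = 0" "3 *s ft \<cdot> e \<cdot> x = e \<cdot> ft \<cdot> x - (3 * \<mu>) *s x"
  using vac by (simp_all add: vac_def)

lemma s_x: "s \<cdot> x = (- 2 * \<sigma>) *s ft \<cdot> ft \<cdot> x"
  (is "?l = ?r")
proof (rule vec_eqI)
  fix h assume d: "dual h"
  have 1: "y \<cdot> (3 *s hT \<cdot> x) = y \<cdot> (2 *s e \<cdot> ft \<cdot> x + (3 * \<mu>) *s x)"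
    by (simp only: hT_vac[OF vac])
  have 2: "s \<cdot> x = - (y \<cdot> hT \<cdot> x)"
    using s_z[of x] by (simp add: y_x)
  have 3: "y \<cdot> e \<cdot> ft \<cdot> x = \<sigma> *s ft \<cdot> ft \<cdot> x + y \<cdot> hT \<cdot> x"
  proof -
    have "e \<cdot> ft \<cdot> x = ft \<cdot> e \<cdot> x + hT \<cdot> x" by (simp add: ft_e)
    then show ?thesis by (simp add: br_simps y_ex flip: ft_y_z)
  qed
  show "coord h ?l = coord h ?r"
    using coord_cong[OF 1, of h] coord_cong[OF 2, of h] coord_cong[OF 3, of h]
    by (simp add: dual_simps[OF d] br_simps y_x; algebra)
qed

text \<open>Computing \<open>y \<cdot> hT \<cdot> e \<cdot> x\<close> brings in
  \<open>y \<cdot> eT \<cdot> x\<close>, and \<open>eT_y\<close> expresses the latter through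
  \<open>s\<close>.\<close>

lemma s_ex: "s \<cdot> e \<cdot> x = (2/3 * \<sigma>) *s hT \<cdot> ft \<cdot> x + (2 * \<mu> * \<sigma>) *s ft \<cdot> x - (2/3 * \<sigma>) *s e \<cdot> ft \<cdot> ft \<cdot> x"
  (is "?l = ?r")
proof (rule vec_eqI)
  fix h assume d: "dual h"
  have 1: "s \<cdot> e \<cdot> x = \<sigma> *s hT \<cdot> ft \<cdot> x - y \<cdot> hT \<cdot> e \<cdot> x"
    using s_z[of "e \<cdot> x"] by (simp add: y_ex br_simps)
  have 2: "e \<cdot> e \<cdot> ft \<cdot> x = 2 *s hT \<cdot> e \<cdot> x + 2 *s eT \<cdot> x"
  proof (rule vec_eqI)
    fix h assume d: "dual h"
    have "0 = e \<cdot> e \<cdot> ft \<cdot> x - 2 *s e \<cdot> hT \<cdot> x + 2 *s eT \<cdot> x"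
      using ft_e_e[of x] by (simp add: vacx)
    from coord_cong[OF this, of h] coord_cong[OF hT_e[of x], of h]
    show "coord h (e \<cdot> e \<cdot> ft \<cdot> x) = coord h (2 *s hT \<cdot> e \<cdot> x + 2 *s eT \<cdot> x)"
      unfolding dual_simps[OF d] by algebra
  qed
  have "e \<cdot> (3 *s hT \<cdot> x) = e \<cdot> (2 *s e \<cdot> ft \<cdot> x + (3 * \<mu>) *s x)"
    by (simp only: hT_vac[OF vac])
  then have 3: "3 *s hT \<cdot> e \<cdot> x + 6 *s eT \<cdot> x = 2 *s e \<cdot> e \<cdot> ft \<cdot> x + (3 * \<mu>) *s e \<cdot> x"
    by (simp add: br_simps hT_e scale_right_diff_distrib)
  have 4: "3 *s hT \<cdot> e \<cdot> x = e \<cdot> e \<cdot> ft \<cdot> x - (3 * \<mu>) *s e \<cdot> x"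
  proof (rule vec_eqI)
    fix h assume d: "dual h"
    show "coord h (3 *s hT \<cdot> e \<cdot> x) = coord h (e \<cdot> e \<cdot> ft \<cdot> x - (3 * \<mu>) *s e \<cdot> x)"
      using coord_cong[OF 2, of h] coord_cong[OF 3, of h] by (simp add: dual_simps[OF d]; algebra)
  qed
  have 5: "y \<cdot> (3 *s hT \<cdot> e \<cdot> x) = y \<cdot> (e \<cdot> e \<cdot> ft \<cdot> x - (3 * \<mu>) *s e \<cdot> x)"
    by (simp only: 4)
  have 6: "y \<cdot> e \<cdot> e \<cdot> ft \<cdot> x = 2 *s y \<cdot> hT \<cdot> e \<cdot> x + 2 *s y \<cdot> eT \<cdot> x"
    unfolding 2 by (simp add: br_simps)
  have 7: "y \<cdot> eT \<cdot> x = - ((eT \<cdot> y) \<cdot> x)"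
    using jacobi_Ev[of eT y x] by (simp add: y_x eq_neg_iff_add_eq_0 add.commute)
  have "(4 *s eT \<cdot> y) \<cdot> x = (e \<cdot> s) \<cdot> x" by (simp only: eT_y)
  then have 8: "4 *s (eT \<cdot> y) \<cdot> x = e \<cdot> s \<cdot> x - s \<cdot> e \<cdot> x"
    using jacobi_Ev[OF e_Ev, of s x] by (simp add: br_simps)
  show "coord h ?l = coord h ?r"
    using coord_cong[OF 1, of h] coord_cong[OF 5, of h] coord_cong[OF 6, of h]
      coord_cong[OF 7, of h] coord_cong[OF 8, of h]
    by (simp add: dual_simps[OF d] br_simps y_ex s_x field_simps; algebra)
qed

lemma ftx_in_W: "ft \<cdot> x \<in> W x" "ft \<cdot> ft \<cdot> x \<in> W x" "x \<in> W x"
  using ew_in_W[of x 0 1] ew_in_W[of x 0 2] ew_in_W[of x 0 0] by (simp_all add: ew_simps wv_def numeral_2_eq_2)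

lemma spow_W: "z \<in> spow \<Longrightarrow> q \<in> W x \<Longrightarrow> z \<cdot> q \<in> W x"
proof (rule W_stable[OF vac, of spow])
  \<comment> \<open>The induction carries \<open>x\<close> and \<open>e \<cdot> x\<close> together;
    since \<open>e \<cdot> e \<cdot> x = 0\<close>, this pair closes up under the Jacobi
    identity.\<close>
  have j: "(((br e) ^^ j) s) \<cdot> x \<in> W x \<and> (((br e) ^^ j) s) \<cdot> e \<cdot> x \<in> W x" for j
  proof (induction j)
    case 0
    then show ?case using ftx_in_W by (simp add: s_x s_ex W_closed W_e W_ft_hT_eT[OF vac])
  next
    case (Suc j)
    let ?z = "((br e) ^^ j) s"
    have "((br e) ^^ Suc j) s = e \<cdot> ?z" by simp
    moreover have "(e \<cdot> ?z) \<cdot> q = e \<cdot> ?z \<cdot> q - ?z \<cdot> e \<cdot> q" for q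
      using jacobi_Ev[OF e_Ev, of ?z q] by simp
    ultimately show ?case using Suc by (simp add: vacx W_closed W_e)
  qed
  fix z assume z: "z \<in> spow"
  have "subspace {z. z \<cdot> x \<in> W x}"
    by (auto simp: subspace_def br_simps W_closed)
  then have "spow \<subseteq> {z. z \<cdot> x \<in> W x}"
    unfolding spow_def using j by (intro span_minimal) auto
  then show "z \<cdot> x \<in> W x" using z by blast
qed (use spow_Ev e_spow ft_spow in auto)

lemma y_W: "q \<in> W x \<Longrightarrow> y \<cdot> q \<in> W x"
proof (rule W_stable[OF vac, of ypow])
  show "y \<in> ypow" by (auto simp: ypow_def intro!: image_eqI[where x = 0])
  have j: "(((br e) ^^ j) y) \<cdot> x \<in> W x \<and> (((br e) ^^ j) y) \<cdot> e \<cdot> x \<in> W x" for j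
  proof (induction j)
    case 0
    then show ?case using ftx_in_W by (simp add: y_x y_ex W_closed)
  next
    case (Suc j)
    let ?z = "((br e) ^^ j) y"
    have "((br e) ^^ Suc j) y = e \<cdot> ?z" by simp
    moreover have "(e \<cdot> ?z) \<cdot> q = e \<cdot> ?z \<cdot> q - ?z \<cdot> e \<cdot> q" for q
      using jacobi_Ev[OF e_Ev, of ?z q] by simp
    ultimately show ?case using Suc by (simp add: vacx W_closed W_e)
  qed
  then show "z \<in> ypow \<Longrightarrow> z \<cdot> x \<in> W x" for z by (auto simp: ypow_def)
  show "z \<in> ypow \<Longrightarrow> ft \<cdot> z \<in> ypow \<or> (\<forall>q\<in>W x. (ft \<cdot> z) \<cdot> q \<in> W x)" for z
    using ft_ypow spow_W by blast
qed (use ypow_Ev e_ypow in auto)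

lemma s_wv: "s \<cdot> wv x n = (- 2 * \<sigma>) *s wv x (n + 2)"
proof (induction n)
  case 0 then show ?case by (simp add: wv_def s_x numeral_2_eq_2)
next
  case (Suc n)
  have "s \<cdot> wv x (Suc n) = ft \<cdot> s \<cdot> wv x n"
    by (simp add: ft_s_z wv_simps)
  then show ?case by (simp add: Suc br_simps wv_simps)
qed

lemma ey_x: "(e \<cdot> y) \<cdot> x = (- \<sigma>) *s ft \<cdot> x" "(e \<cdot> y) \<cdot> e \<cdot> x = \<sigma> *s e \<cdot> ft \<cdot> x"
  using jacobi_Ev[OF e_Ev, of y x] jacobi_Ev[OF e_Ev, of y "e \<cdot> x"]
  by (simp_all add: y_x y_ex vacx br_simps eq_neg_iff_add_eq_0)

text \<open>Moving \<open>ft\<close> past \<open>e \<cdot> y\<close> adds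
  \<open>s \<cdot> wv x n\<close> at every step, whence a coefficient linear in
  \<open>n\<close>.\<close>

lemma ey_wv: "(e \<cdot> y) \<cdot> wv x n = (- \<sigma> * (2 * of_nat n + 1)) *s wv x (Suc n)"
proof (induction n)
  case 0 then show ?case by (simp add: wv_def ey_x)
next
  case (Suc n)
  have "(e \<cdot> y) \<cdot> wv x (Suc n) = ft \<cdot> (e \<cdot> y) \<cdot> wv x n + s \<cdot> wv x n"
    using jacobi_Ev[OF ft_Ev, of "e \<cdot> y" "wv x n"] by (simp add: wv_simps ft_ey br_minus)
  also have "\<dots> = (- \<sigma> * (2 * of_nat (Suc n) + 1)) *s wv x (Suc (Suc n))"
    by (rule vec_eqI) (simp add: Suc br_simps wv_simps s_wv dual_simps algebra_simps)
  finally show ?case .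
qed

end

section \<open>The degree zero subalgebra and the triangular decomposition\<close>

definition "E0 = subalg {e, f, ft, y, c}"

lemma E0_simps [simp]: "e \<in> E0" "f \<in> E0" "ft \<in> E0" "y \<in> E0" "c \<in> E0" "0 \<in> E0"
  by (auto simp: E0_def intro: subalg.intros)

lemma subspace_E0: "subspace E0"
  by (simp add: E0_def subspace_subalg)

lemma E0_closed: "a \<in> E0 \<Longrightarrow> b \<in> E0 \<Longrightarrow> a + b \<in> E0" "a \<in> E0 \<Longrightarrow> b \<in> E0 \<Longrightarrow> a - b \<in> E0"
  "a \<in> E0 \<Longrightarrow> - a \<in> E0" "a \<in> E0 \<Longrightarrow> k *s a \<in> E0"
  by (simp_all add: subspace_E0 subspace_add subspace_diff subspace_neg subspace_scale)

lemma E0_br: "a \<in> E0 \<Longrightarrow> b \<in> E0 \<Longrightarrow> a \<cdot> b \<in> E0"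
  by (simp add: E0_def subalg.br)

lemma E0_scaleD: "k *s a \<in> E0 \<Longrightarrow> k \<noteq> 0 \<Longrightarrow> a \<in> E0"
  using E0_closed(4)[of "k *s a" "inverse k"] by simp

lemma H_E0 [simp]: "H \<in> E0"
  unfolding H_def by (rule E0_br) simp_all

lemma s_E0 [simp]: "s \<in> E0"
  unfolding s_def hT_def by (intro E0_br) simp_all

lemma E0_Ev [simp]: "a \<in> E0 \<Longrightarrow> a \<in> Ev"
  unfolding E0_def by (rule subalg_Ev) auto

lemma c_E0: "a \<in> E0 \<Longrightarrow> c \<cdot> a = 0"
  unfolding E0_def
proof (induction rule: subalg.induct)
  case (base x)
  then show ?case using self_br_Ev[of c] by (auto simp: c_e c_f c_ft c_y)
next
  case (br x z)
  then show ?case using jacobi_Ev[of c x z] by simp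
qed (simp_all add: br_simps)

lemma c_W:
  assumes "c \<cdot> x = k *s x" "q \<in> W x"
  shows "c \<cdot> q = k *s q"
proof -
  have w: "c \<cdot> wv x n = k *s wv x n" for n
  proof (induction n)
    case (Suc n)
    then show ?case using jacobi_Ev[of c ft "wv x n"] by (simp add: wv_simps c_ft br_simps)
  qed (simp add: wv_def assms)
  have "c \<cdot> ew x i n = k *s ew x i n" for i n
  proof (induction i)
    case (Suc i)
    then show ?case using jacobi_Ev[of c e "ew x i n"] by (simp add: ew_simps c_e br_simps)
  qed (simp add: ew_simps w)
  moreover have "subspace {q. c \<cdot> q = k *s q}"
    by (auto simp: subspace_def br_simps scale_right_distrib mult.commute)
  ultimately have "W x \<subseteq> {q. c \<cdot> q = k *s q}"
    unfolding W_def by (intro span_minimal) auto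
  then show ?thesis using assms(2) by blast
qed

lemma c_Wu: "q \<in> W u \<Longrightarrow> c \<cdot> q = q"
  using c_W[of u 1 q] by (simp add: c_u)

lemma c_Wv: "q \<in> W v \<Longrightarrow> c \<cdot> q = - q"
  using c_W[of v "-1" q] by (simp add: c_v)

lemma W_Od: "x \<in> Od \<Longrightarrow> q \<in> W x \<Longrightarrow> q \<in> Od"
proof -
  assume x: "x \<in> Od"
  then have w: "wv x n \<in> Od" for n
    by (induction n) (simp_all add: wv_def Od_closed)
  have "ew x i n \<in> Od" for i n
    by (induction i) (simp_all add: w ew_simps Od_closed flip: ew_simps(2))
  then have "W x \<subseteq> Od" unfolding W_def by (intro span_minimal subspace_Od) auto
  then show "q \<in> W x \<Longrightarrow> q \<in> Od" by blast
qed

lemma E0_W: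
  assumes "a \<in> E0" "x \<in> {u, v}"
  shows "q \<in> W x \<Longrightarrow> a \<cdot> q \<in> W x"
  using assms(1) unfolding E0_def
proof (induction arbitrary: q rule: subalg.induct)
  case (base a)
  have "vac x" using assms(2) vac_u vac_v by auto
  moreover have "y \<cdot> q \<in> W x"
    using y_W[of u 1 q] y_W[of v "-1" q] base assms(2) by (auto simp: vac_u vac_v y_u y_v y_eu y_ev)
  moreover have "c \<cdot> q \<in> W x"
    using c_Wu c_Wv base assms(2) by (auto simp: W_closed)
  ultimately show ?case using base W_e W_f_H W_ft_hT_eT by auto
next
  case (br a b)
  have "a \<in> E0" using br unfolding E0_def by simp
  then have "(a \<cdot> b) \<cdot> q = a \<cdot> b \<cdot> q - b \<cdot> a \<cdot> q"
    using jacobi_Ev[of a b q] by simp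
  then show ?case using br by (simp add: W_closed)
qed (simp_all add: br_simps W_closed)

lemma E0_Wu: "a \<in> E0 \<Longrightarrow> q \<in> W u \<Longrightarrow> a \<cdot> q \<in> W u" and E0_Wv: "a \<in> E0 \<Longrightarrow> q \<in> W v \<Longrightarrow> a \<cdot> q \<in> W v"
  using E0_W by blast+

text \<open>\<open>gu\<close> and \<open>ge\<close> annihilate \<open>u\<close> and \<open>[e, u]\<close> respectively and raise the index of
  \<open>wv\<close>. Commuting them past \<open>u\<close> and \<open>[e, u]\<close> gives the inductions on \<open>n\<close> below; the
  vanishing coefficient of \<open>ge_wvv\<close> at \<open>n = 1\<close> is why \<open>eu_v2_E0\<close> is treated by hand.\<close>

definition "gu = e \<cdot> y + ft"
definition "ge = e \<cdot> y - 3 *s ft + (3 * \<mu>) *s f"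

lemma g_E0 [simp]: "gu \<in> E0" "ge \<in> E0"
  unfolding gu_def ge_def by (intro E0_closed E0_br; simp)+

lemma gu_u: "gu \<cdot> u = 0"
  using ey_x(1)[of u 1] by (simp add: vac_u y_u y_eu gu_def br_simps)

lemma ge_eu: "ge \<cdot> e \<cdot> u = 0"
  using ey_x(2)[of u 1] by (simp add: vac_u y_u y_eu ge_def br_simps f_e vac_simps)

lemma gu_u_z: "gu \<cdot> u \<cdot> z = u \<cdot> gu \<cdot> z"
  using jacobi_Ev[of gu u z] by (simp add: gu_u)

lemma ge_eu_z: "ge \<cdot> (e \<cdot> u) \<cdot> z = (e \<cdot> u) \<cdot> ge \<cdot> z"
  using jacobi_Ev[of ge "e \<cdot> u" z] by (simp add: ge_eu)

lemma gu_wvu: "gu \<cdot> wv u n = (- 2 * of_nat n) *s wv u (Suc n)"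
  by (rule vec_eqI) (simp add: gu_def br_simps ey_wv[of u 1] vac_u y_u y_eu wv_simps dual_simps algebra_simps)

lemma ge_wvu: "ge \<cdot> wv u n = (- (2 * of_nat n + 4)) *s wv u (Suc n)"
  by (rule vec_eqI) (simp add: ge_def br_simps ey_wv[of u 1] vac_u y_u y_eu wv_simps W_f_H_wv dual_simps algebra_simps)

lemma gu_wvv: "gu \<cdot> wv v n = (2 * of_nat n + 2) *s wv v (Suc n)"
  by (rule vec_eqI) (simp add: gu_def br_simps ey_wv[of v "-1"] vac_v y_v y_ev wv_simps dual_simps algebra_simps)

lemma ge_wvv: "ge \<cdot> wv v n = (2 * of_nat n - 2) *s wv v (Suc n)"
  by (rule vec_eqI) (simp add: ge_def br_simps ey_wv[of v "-1"] vac_v y_v y_ev wv_simps W_f_H_wv dual_simps algebra_simps)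

lemma shifted_nat_nonzero: "of_nat n * 2 + 4 \<noteq> (0::complex)" "of_nat n * 2 + 2 \<noteq> (0::complex)"
  using of_nat_eq_0_iff[of "n * 2 + 4", where 'a = complex] of_nat_eq_0_iff[of "n * 2 + 2", where 'a = complex]
  by (simp_all add: add.commute del: of_nat_eq_0_iff)

lemma u_wvu: "u \<cdot> wv u n = 0 \<and> (e \<cdot> u) \<cdot> wv u n = 0"
proof (induction n)
  case 0 then show ?case using u_u sym_Od[of u "e \<cdot> u"] u_eu by (simp add: wv_def)
next
  case (Suc n)
  have "(- (2 * of_nat n + 4)) *s (e \<cdot> u) \<cdot> wv u (Suc n) = (e \<cdot> u) \<cdot> ge \<cdot> wv u n"
    by (simp add: ge_wvu br_simps)
  also have "\<dots> = 0" using Suc by (simp flip: ge_eu_z)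
  finally have 1: "(e \<cdot> u) \<cdot> wv u (Suc n) = 0"
    using shifted_nat_nonzero[of n] by (simp add: neg_eq_iff_add_eq_0 mult.commute add.commute eq_neg_iff_add_eq_0)
  \<comment> \<open>The coefficient in \<open>gu_wvu\<close> vanishes at \<open>n = 0\<close>, where
    the axiom \<open>u_ftu\<close> takes over; the coefficient in \<open>ge_wvu\<close> never
    vanishes.\<close>
  have "u \<cdot> wv u (Suc n) = 0"
  proof (cases n)
    case 0 then show ?thesis by (simp add: wv_def u_ftu)
  next
    case (Suc m)
    have "(- 2 * of_nat n) *s u \<cdot> wv u (Suc n) = u \<cdot> gu \<cdot> wv u n"
      by (simp add: gu_wvu br_simps)
    also have "\<dots> = 0" using Suc.IH by (simp flip: gu_u_z)
    finally show ?thesis using Suc by (simp del: of_nat_Suc)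
  qed
  then show ?case using 1 by simp
qed

lemma eu_e: "(e \<cdot> u) \<cdot> e \<cdot> z = e \<cdot> (e \<cdot> u) \<cdot> z"
  using jacobi_Ev[OF e_Ev, of "e \<cdot> u" z] by (simp add: vac_simps)

lemma u_e: "u \<cdot> e \<cdot> z = e \<cdot> u \<cdot> z - (e \<cdot> u) \<cdot> z"
  using jacobi_Ev[OF e_Ev, of u z] by simp

lemma u_Wu: "q \<in> W u \<Longrightarrow> u \<cdot> q = 0 \<and> (e \<cdot> u) \<cdot> q = 0"
proof -
  have "u \<cdot> ew u i n = 0 \<and> (e \<cdot> u) \<cdot> ew u i n = 0" for i n
    by (induction i) (simp_all add: ew_simps u_wvu eu_e u_e flip: ew_simps(2))
  moreover have "subspace {q. u \<cdot> q = 0 \<and> (e \<cdot> u) \<cdot> q = 0}"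
    by (auto simp: subspace_def br_simps)
  ultimately have "W u \<subseteq> {q. u \<cdot> q = 0 \<and> (e \<cdot> u) \<cdot> q = 0}"
    unfolding W_def by (intro span_minimal) auto
  then show "q \<in> W u \<Longrightarrow> u \<cdot> q = 0 \<and> (e \<cdot> u) \<cdot> q = 0" by blast
qed

text \<open>It is enough to control the generator \<open>u'\<close>: the Jacobi identity moves each
  letter \<open>ft\<close> or \<open>e\<close> of \<open>p\<close> either in front of the whole
  bracket, where \<open>S\<close> absorbs it, or onto \<open>q\<close>, where \<open>W x\<close>
  does.\<close>

lemma W_W:
  assumes S: "subspace S" "\<And>z. z \<in> S \<Longrightarrow> e \<cdot> z \<in> S" "\<And>z. z \<in> S \<Longrightarrow> ft \<cdot> z \<in> S"
    and u: "\<And>q. q \<in> W x \<Longrightarrow> u' \<cdot> q \<in> S" and x: "vac x" and p: "p \<in> W u'" and q: "q \<in> W x"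
  shows "p \<cdot> q \<in> S"
proof -
  have w: "\<forall>q\<in>W x. wv u' n \<cdot> q \<in> S" for n
  proof (induction n)
    case 0 then show ?case using u by (simp add: wv_def)
  next
    case (Suc n)
    have "wv u' (Suc n) \<cdot> q = ft \<cdot> wv u' n \<cdot> q - wv u' n \<cdot> ft \<cdot> q" for q
      using jacobi_Ev[OF ft_Ev, of "wv u' n" q] by (simp add: wv_simps)
    then show ?case using Suc S W_ft_hT_eT[OF x] by (simp add: subspace_diff)
  qed
  have "\<forall>q\<in>W x. ew u' i n \<cdot> q \<in> S" for i n
  proof (induction i)
    case 0 then show ?case using w by (simp add: ew_simps)
  next
    case (Suc i)
    have "ew u' (Suc i) n \<cdot> q = e \<cdot> ew u' i n \<cdot> q - ew u' i n \<cdot> e \<cdot> q" for q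
      using jacobi_Ev[OF e_Ev, of "ew u' i n" q] by (simp add: ew_simps)
    then show ?case using Suc S W_e by (simp add: subspace_diff)
  qed
  moreover have "subspace {p. \<forall>q\<in>W x. p \<cdot> q \<in> S}"
    using S(1) by (auto simp: subspace_def br_simps)
  ultimately have "W u' \<subseteq> {p. \<forall>q\<in>W x. p \<cdot> q \<in> S}"
    unfolding W_def by (intro span_minimal) auto
  then show ?thesis using p q by blast
qed

lemma Wu_Wu: "p \<in> W u \<Longrightarrow> q \<in> W u \<Longrightarrow> p \<cdot> q = 0"
  using W_W[of "{0}" u u p q] u_Wu by (auto simp: subspace_def vac_u)

text \<open>A detour that ends with the wanted bracket: \<open>gu\<close> yields
  \<open>u \<cdot> ft \<cdot> ft \<cdot> v\<close>, then \<open>ft \<cdot> y = 0\<close> yields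
  \<open>(ft \<cdot> u) \<cdot> ft \<cdot> v\<close>, then \<open>eftv_ftu\<close> yields
  \<open>(e \<cdot> ft \<cdot> u) \<cdot> ft \<cdot> v\<close>, and the mirror image of
  \<open>ev_ftftu\<close> does the rest.\<close>

lemma eu_v2_E0: "(e \<cdot> u) \<cdot> ft \<cdot> ft \<cdot> v \<in> E0"
proof -
  interpret sw: lie_core scale br Ev Od e f ft \<mu> v u "- c" "- y" by (rule lie_core_swap)
  have sws: "sw.s = - s" by (simp add: sw.s_def s_def br_minus)
  have "4 *s u \<cdot> ft \<cdot> ft \<cdot> v = u \<cdot> gu \<cdot> wv v 1"
    by (simp add: gu_wvv br_simps) (simp add: wv_def)
  also have "\<dots> = gu \<cdot> u \<cdot> ft \<cdot> v" by (simp add: gu_u_z wv_def)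
  also have "\<dots> \<in> E0" unfolding y_eq' by (intro E0_br E0_closed) simp_all
  finally have u2: "u \<cdot> ft \<cdot> ft \<cdot> v \<in> E0" by (rule E0_scaleD) simp
  have "ft \<cdot> u \<cdot> ft \<cdot> v = 0" by (simp add: y_eq' br_simps ft_y)
  then have "(ft \<cdot> u) \<cdot> ft \<cdot> v = - (u \<cdot> ft \<cdot> ft \<cdot> v)"
    using jacobi_Ev[OF ft_Ev, of u "ft \<cdot> v"] by (simp add: eq_neg_iff_add_eq_0)
  then have *: "e \<cdot> (ft \<cdot> u) \<cdot> ft \<cdot> v \<in> E0"
    using u2 by (auto intro!: E0_br E0_closed)
  have "2 *s (e \<cdot> ft \<cdot> u) \<cdot> ft \<cdot> v = e \<cdot> (ft \<cdot> u) \<cdot> ft \<cdot> v - (9/2) *s s + (6 * (\<mu> + 1)) *s y"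
  proof (rule vec_eqI)
    fix h assume d: "dual h"
    have sy: "(e \<cdot> ft \<cdot> v) \<cdot> ft \<cdot> u = (ft \<cdot> u) \<cdot> e \<cdot> ft \<cdot> v" "(ft \<cdot> v) \<cdot> e \<cdot> ft \<cdot> u = (e \<cdot> ft \<cdot> u) \<cdot> ft \<cdot> v"
      by (simp_all add: sym_Od)
    show "coord h (2 *s (e \<cdot> ft \<cdot> u) \<cdot> ft \<cdot> v) = coord h (e \<cdot> (ft \<cdot> u) \<cdot> ft \<cdot> v - (9/2) *s s + (6 * (\<mu> + 1)) *s y)"
      using coord_cong[OF eftv_ftu, of h]
      by (simp add: sy jacobi_Ev[OF e_Ev, of "ft \<cdot> u" "ft \<cdot> v"] dual_simps[OF d] field_simps; algebra)
  qed
  also have "\<dots> \<in> E0" using * by (intro E0_closed) simp_all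
  finally have g: "(e \<cdot> ft \<cdot> u) \<cdot> ft \<cdot> v \<in> E0" by (rule E0_scaleD) simp
  have "6 *s (e \<cdot> u) \<cdot> ft \<cdot> ft \<cdot> v \<in> E0"
    unfolding sw.ev_ftftu sws using g by (intro E0_closed) simp_all
  then show "(e \<cdot> u) \<cdot> ft \<cdot> ft \<cdot> v \<in> E0" by (rule E0_scaleD) simp
qed

lemma u_wvv: "u \<cdot> wv v n \<in> E0"
proof (induction n)
  case 0 then show ?case by (simp add: wv_def u_v E0_closed)
next
  case (Suc n)
  have "(2 * of_nat n + 2) *s u \<cdot> wv v (Suc n) = gu \<cdot> u \<cdot> wv v n"
    by (simp add: gu_wvv br_simps gu_u_z)
  also have "\<dots> \<in> E0" using Suc by (simp add: E0_br)
  finally show ?case by (rule E0_scaleD) (use shifted_nat_nonzero(2)[of n] in \<open>simp add: mult.commute\<close>)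
qed

lemma eu_wvv: "(e \<cdot> u) \<cdot> wv v n \<in> E0"
proof -
  have "2 *s (e \<cdot> u) \<cdot> v \<in> E0"
    using v_eu sym_Od[of "e \<cdot> u" v] by (auto intro!: E0_closed)
  then have 0: "(e \<cdot> u) \<cdot> v \<in> E0" by (rule E0_scaleD) simp
  have "2 *s (e \<cdot> u) \<cdot> ft \<cdot> v \<in> E0"
    unfolding eu_ftv by (intro E0_closed E0_br) simp_all
  then have 1: "(e \<cdot> u) \<cdot> ft \<cdot> v \<in> E0" by (rule E0_scaleD) simp
  have "(e \<cdot> u) \<cdot> wv v (n + 2) \<in> E0" for n
  proof (induction n)
    case 0 then show ?case using eu_v2_E0 by (simp add: wv_def numeral_2_eq_2)
  next
    case (Suc n)
    have "(2 * of_nat (n + 2) - 2) *s (e \<cdot> u) \<cdot> wv v (Suc n + 2) = ge \<cdot> (e \<cdot> u) \<cdot> wv v (n + 2)"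
      unfolding ge_eu_z ge_wvv br_scale_right by simp
    also have "\<dots> \<in> E0" using Suc by (simp add: E0_br)
    finally show ?case by (rule E0_scaleD) (use shifted_nat_nonzero(2)[of n] in \<open>simp add: algebra_simps\<close>)
  qed
  from this[of "n - 2"] 0 1 show ?thesis
    by (cases n rule: nat.exhaust; cases "n - 1" rule: nat.exhaust) (simp_all add: wv_def)
qed

lemma u_Wv: "q \<in> W v \<Longrightarrow> u \<cdot> q \<in> E0 \<and> (e \<cdot> u) \<cdot> q \<in> E0"
proof -
  have "u \<cdot> ew v i n \<in> E0 \<and> (e \<cdot> u) \<cdot> ew v i n \<in> E0" for i n
    by (induction i) (simp_all add: ew_simps u_wvv eu_wvv eu_e u_e E0_br E0_closed flip: ew_simps(2))
  moreover have "subspace {q. u \<cdot> q \<in> E0 \<and> (e \<cdot> u) \<cdot> q \<in> E0}"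
    by (auto simp: subspace_def br_simps E0_closed)
  ultimately have "W v \<subseteq> {q. u \<cdot> q \<in> E0 \<and> (e \<cdot> u) \<cdot> q \<in> E0}"
    unfolding W_def by (intro span_minimal) auto
  then show "q \<in> W v \<Longrightarrow> u \<cdot> q \<in> E0 \<and> (e \<cdot> u) \<cdot> q \<in> E0" by blast
qed

lemma Wu_Wv: "p \<in> W u \<Longrightarrow> q \<in> W v \<Longrightarrow> p \<cdot> q \<in> E0"
  by (rule W_W[of E0 v u p q]) (simp_all add: subspace_E0 E0_br u_Wv vac_v)

lemma Wu_W_mem: "u \<in> W u" "e \<cdot> u \<in> W u" "ft \<cdot> u \<in> W u" "v \<in> W v" "e \<cdot> v \<in> W v" "ft \<cdot> v \<in> W v"
  using ew_in_W[of _ 0 0] ew_in_W[of _ 1 0] ew_in_W[of _ 0 1] by (simp_all add: ew_def wv_def)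

lemma Wv_Wv: "p \<in> W v \<Longrightarrow> q \<in> W v \<Longrightarrow> p \<cdot> q = 0"
proof -
  interpret sw: lie_core scale br Ev Od e f ft \<mu> v u "- c" "- y" by (rule lie_core_swap)
  show "p \<in> W v \<Longrightarrow> q \<in> W v \<Longrightarrow> p \<cdot> q = 0" by (rule sw.Wu_Wu)
qed

lemma subalg_decomp:
  assumes "x \<in> subalg {u, e \<cdot> u, v, e \<cdot> v, ft \<cdot> u, ft \<cdot> v, f}"
  shows "\<exists>a\<in>W u. \<exists>b\<in>E0. \<exists>d\<in>W v. x = a + b + d"
  using assms
proof (induction rule: subalg.induct)
  case (base x)
  then consider "x \<in> W u" | "x \<in> W v" | "x \<in> E0" using Wu_W_mem by auto
  then show ?case
  proof cases
    case 1 then show ?thesis by (intro bexI[of _ x] bexI[of _ 0]) (simp_all add: W_closed)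
  next
    case 2 then show ?thesis by (intro bexI[of _ 0] bexI[of _ x]) (simp_all add: W_closed)
  next
    case 3 then show ?thesis by (intro bexI[of _ 0] bexI[of _ x]) (simp_all add: W_closed)
  qed
next
  case zero
  show ?case by (intro bexI[of _ 0]) (simp_all add: W_closed)
next
  case (add x z)
  then obtain a b d a' b' d' where *: "a \<in> W u" "b \<in> E0" "d \<in> W v" "x = a + b + d"
    "a' \<in> W u" "b' \<in> E0" "d' \<in> W v" "z = a' + b' + d'" by blast
  then show ?case
    by (intro bexI[of _ "a + a'"] bexI[of _ "b + b'"] bexI[of _ "d + d'"]) (simp_all add: W_closed E0_closed)
next
  case (scale x k)
  then obtain a b d where *: "a \<in> W u" "b \<in> E0" "d \<in> W v" "x = a + b + d" by blast
  then show ?case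
    by (intro bexI[of _ "k *s a"] bexI[of _ "k *s b"] bexI[of _ "k *s d"]) (simp_all add: W_closed E0_closed scale_right_distrib)
next
  case (br x z)
  then obtain a b d a' b' d' where *: "a \<in> W u" "b \<in> E0" "d \<in> W v" "x = a + b + d"
    "a' \<in> W u" "b' \<in> E0" "d' \<in> W v" "z = a' + b' + d'" by blast
  have "d \<cdot> a' = a' \<cdot> d"
    using * W_Od[of u a'] W_Od[of v d] by (intro sym_Od) simp_all
  then have 1: "d \<cdot> a' \<in> E0" using Wu_Wv * by simp
  have 2: "a \<cdot> b' = - (b' \<cdot> a)" "d \<cdot> b' = - (b' \<cdot> d)"
    using antisym_Ev * by simp_all
  have "x \<cdot> z = (b \<cdot> a' - b' \<cdot> a) + (a \<cdot> d' + b \<cdot> b' + d \<cdot> a') + (b \<cdot> d' - b' \<cdot> d)"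
    unfolding *(4) *(8) using * by (simp add: br_simps 2 Wu_Wu Wv_Wv)
  then show ?case using * 1
    by (intro bexI[of _ "b \<cdot> a' - b' \<cdot> a"] bexI[of _ "a \<cdot> d' + b \<cdot> b' + d \<cdot> a'"]
        bexI[of _ "b \<cdot> d' - b' \<cdot> d"])
      (simp_all add: W_closed E0_closed E0_Wu E0_Wv Wu_Wv E0_br)
qed

text \<open>\<open>K\<close> will be the kernel of the evaluation by differential operators, where \<open>wv u n\<close> and
  \<open>wv v n\<close> become multiples of the \<open>n\<close>-th and \<open>(n+1)\<close>-st power of the derivative and
  \<open>\<kappa> n\<close> is \<open>n + 1\<close> up to sign.\<close>
context
  fixes K :: "'a set" and \<kappa> :: "nat \<Rightarrow> complex"
  assumes K: "subspace K" "\<And>a x. x \<in> K \<Longrightarrow> a \<cdot> x \<in> K"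
    and low_u: "\<And>N c n. (\<Sum>n<N. c n *s wv u n) \<in> K \<Longrightarrow> n < N \<Longrightarrow> c n = 0"
    and low_v: "\<And>N c n. (\<Sum>n<N. c n *s wv v n) \<in> K \<Longrightarrow> n < N \<Longrightarrow> c n = 0"
    and \<kappa>: "\<And>n. \<kappa> n \<noteq> 0" "\<And>n. u \<cdot> (e \<cdot> u) \<cdot> wv v n - \<kappa> n *s wv u n \<in> K"
begin

lemma K_Wu: "z \<in> K \<Longrightarrow> z \<in> W u \<Longrightarrow> z = 0"
  by (rule f_stable_trivial[OF vac_u, of "K \<inter> W u"])
    (use K low_u in \<open>auto simp: subspace_inter subspace_W W_f_H vac_u\<close>)

lemma K_Wv: "z \<in> K \<Longrightarrow> z \<in> W v \<Longrightarrow> z = 0"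
  by (rule f_stable_trivial[OF vac_v, of "K \<inter> W v"])
    (use K low_v in \<open>auto simp: subspace_inter subspace_W W_f_H vac_v\<close>)

section \<open>Injectivity of the evaluation on the presented algebra\<close>

definition "\<psi> q = u \<cdot> (e \<cdot> u) \<cdot> q"

lemma \<psi>_linear: "\<psi> (a + b) = \<psi> a + \<psi> b" "\<psi> (k *s a) = k *s \<psi> a" "\<psi> 0 = 0"
  by (simp_all add: \<psi>_def br_simps)

lemma u_E0: "b \<in> E0 \<Longrightarrow> u \<cdot> b \<in> W u" "b \<in> E0 \<Longrightarrow> (e \<cdot> u) \<cdot> b \<in> W u"
  using antisym_Ev[of b] E0_Wu[of b] Wu_W_mem by (simp_all add: W_closed)

lemma \<psi>_W: "q \<in> W v \<Longrightarrow> \<psi> q \<in> W u"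
  unfolding \<psi>_def using u_Wv u_E0 by blast

text \<open>The hypothesis on \<open>\<kappa>\<close> holds only modulo \<open>K\<close>. The
  difference also lies in \<open>W u\<close>, which meets \<open>K\<close> trivially, so the
  equation is exact.\<close>

lemma \<psi>_wv: "\<psi> (wv v n) = \<kappa> n *s wv u n"
proof -
  have "wv v n \<in> W v" "wv u n \<in> W u"
    using ew_in_W[of _ 0 n] by (simp_all add: ew_simps)
  then have "\<psi> (wv v n) - \<kappa> n *s wv u n \<in> W u" by (simp add: \<psi>_W W_closed)
  with \<kappa>(2)[of n] have "\<psi> (wv v n) - \<kappa> n *s wv u n = 0"
    by (intro K_Wu) (simp_all add: \<psi>_def)
  then show ?thesis by simp
qed

lemma Od_sq_zero: "a \<in> Od \<Longrightarrow> a \<cdot> a = 0 \<Longrightarrow> a \<cdot> a \<cdot> z = 0"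
proof -
  assume "a \<in> Od" "a \<cdot> a = 0"
  then have "a \<cdot> a \<cdot> z = - (a \<cdot> a \<cdot> z)"
    using jacobi_Od[of a a z] by simp
  then have "a \<cdot> a \<cdot> z + a \<cdot> a \<cdot> z = 0" by (simp only: eq_neg_iff_add_eq_0)
  then have "2 *s a \<cdot> a \<cdot> z = 0" using scale_left_distrib[of 1 1 "a \<cdot> a \<cdot> z"] by simp
  then show ?thesis by simp
qed

lemma u_u_z: "u \<cdot> u \<cdot> z = 0" "(e \<cdot> u) \<cdot> (e \<cdot> u) \<cdot> z = 0"
  by (rule Od_sq_zero; simp add: u_u eu_eu)+

lemma eu_u_z: "(e \<cdot> u) \<cdot> u \<cdot> z = - \<psi> z"
  using jacobi_Od[of u "e \<cdot> u" z] by (simp add: \<psi>_def u_eu)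

lemma f_u_z: "f \<cdot> u \<cdot> z = u \<cdot> f \<cdot> z"
  using jacobi_Ev[OF f_Ev, of u z] by (simp add: vac_simps)

lemma f_eu: "f \<cdot> e \<cdot> u = - u"
  by (simp add: f_e vac_simps)

lemma f_eu_z: "f \<cdot> (e \<cdot> u) \<cdot> z = (e \<cdot> u) \<cdot> f \<cdot> z - u \<cdot> z"
  using jacobi_Ev[OF f_Ev, of "e \<cdot> u" z] by (simp add: f_eu br_simps)

text \<open>The span of \<open>u\<close> and \<open>e \<cdot> u\<close> is a two-dimensional module
  of the diagonal sl(2) whose elements anticommute as operators. So \<open>\<psi>\<close> is the
  action of its exterior square, the trivial module, and hence commutes with \<open>e\<close> and
  \<open>f\<close>.\<close>

lemma e_\<psi>: "\<psi> (e \<cdot> q) = e \<cdot> \<psi> q"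
  by (simp add: \<psi>_def eu_e u_e u_u_z)

lemma f_\<psi>: "\<psi> (f \<cdot> q) = f \<cdot> \<psi> q"
  by (simp add: \<psi>_def f_u_z f_eu_z u_u_z br_simps)

lemma \<psi>_ew: "\<psi> (ew v i n) = \<kappa> n *s ew u i n"
  by (induction i) (simp_all add: ew_simps(1) \<psi>_wv e_\<psi> br_simps flip: ew_simps(2))

lemma \<psi>_surj: "z \<in> W u \<Longrightarrow> \<exists>q\<in>W v. \<psi> q = z"
proof -
  have "subspace (\<psi> ` W v)"
  proof (rule subspaceI)
    show "0 \<in> \<psi> ` W v" using \<psi>_linear(3) W_closed(1) by (metis image_eqI)
  qed (auto simp: W_closed simp flip: \<psi>_linear)
  moreover have "ew u i n \<in> \<psi> ` W v" for i n
    using \<kappa>(1)[of n] by (intro image_eqI[of _ _ "inverse (\<kappa> n) *s ew v i n"])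
      (simp_all add: \<psi>_linear \<psi>_ew W_closed)
  ultimately have "W u \<subseteq> \<psi> ` W v"
    unfolding W_def[of u] by (intro span_minimal) auto
  then show "z \<in> W u \<Longrightarrow> \<exists>q\<in>W v. \<psi> q = z" by blast
qed

text \<open>By \<open>f_\<psi>\<close> the kernel is stable under \<open>f\<close>, so it is enough
  to look at combinations of lowest weight vectors, where \<open>\<psi>\<close> is diagonal with
  entries \<open>\<kappa> n\<close>.\<close>

lemma \<psi>_inj: "q \<in> W v \<Longrightarrow> \<psi> q = 0 \<Longrightarrow> q = 0"
proof (rule f_stable_trivial[OF vac_v, of "{q \<in> W v. \<psi> q = 0}"])
  show "subspace {q \<in> W v. \<psi> q = 0}"
    by (auto simp: subspace_def \<psi>_linear W_closed)
  fix N :: nat and c n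
  assume "(\<Sum>n<N. c n *s wv v n) \<in> {q \<in> W v. \<psi> q = 0}" and n: "n < N"
  moreover have "\<psi> (\<Sum>n<N. c n *s wv v n) = (\<Sum>n<N. (c n * \<kappa> n) *s wv u n)"
    by (induction N) (simp_all add: \<psi>_linear \<psi>_wv)
  ultimately have "(\<Sum>n<N. (c n * \<kappa> n) *s wv u n) \<in> K"
    using K(1) by (simp add: subspace_0)
  from low_u[OF this n] \<kappa>(1) show "c n = 0" by simp
qed (auto simp: W_f_H vac_v f_\<psi>)

text \<open>Here \<open>q\<close> and \<open>q'\<close> serve as coordinates: bracketing the sum
  with \<open>u\<close> gives \<open>\<psi> q'\<close>, and with \<open>e \<cdot> u\<close> gives
  \<open>- \<psi> q\<close>.\<close>

definition "S0 = {u \<cdot> q + (e \<cdot> u) \<cdot> q' | q q'. q \<in> W v \<and> q' \<in> W v}"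

lemma S0I: "q \<in> W v \<Longrightarrow> q' \<in> W v \<Longrightarrow> u \<cdot> q + (e \<cdot> u) \<cdot> q' \<in> S0"
  by (auto simp: S0_def)

lemma S0I': "q \<in> W v \<Longrightarrow> u \<cdot> q \<in> S0" "q \<in> W v \<Longrightarrow> (e \<cdot> u) \<cdot> q \<in> S0"
  using S0I[of q 0] S0I[of 0 q] by (simp_all add: W_closed)

lemma subspace_S0: "subspace S0"
proof (rule subspaceI)
  show "0 \<in> S0" using S0I'(1)[of 0] by (simp add: W_closed)
  fix a b assume "a \<in> S0" "b \<in> S0"
  then obtain q q' p p' where "q \<in> W v" "q' \<in> W v" "p \<in> W v" "p' \<in> W v"
    "a = u \<cdot> q + (e \<cdot> u) \<cdot> q'" "b = u \<cdot> p + (e \<cdot> u) \<cdot> p'" unfolding S0_def by blast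
  then show "a + b \<in> S0" using S0I[of "q + p" "q' + p'"] by (simp add: W_closed br_simps add_ac)
next
  fix k a assume "a \<in> S0"
  then obtain q q' where "q \<in> W v" "q' \<in> W v" "a = u \<cdot> q + (e \<cdot> u) \<cdot> q'" unfolding S0_def by blast
  then show "k *s a \<in> S0" using S0I[of "k *s q" "k *s q'"] by (simp add: W_closed br_simps scale_right_distrib)
qed

lemma S0_closed: "0 \<in> S0" "a \<in> S0 \<Longrightarrow> b \<in> S0 \<Longrightarrow> a + b \<in> S0" "a \<in> S0 \<Longrightarrow> b \<in> S0 \<Longrightarrow> a - b \<in> S0"
  "a \<in> S0 \<Longrightarrow> - a \<in> S0" "a \<in> S0 \<Longrightarrow> k *s a \<in> S0"
  by (simp_all add: subspace_S0 subspace_0 subspace_add subspace_diff subspace_neg subspace_scale)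

lemma S0_scaleD: "k *s a \<in> S0 \<Longrightarrow> k \<noteq> 0 \<Longrightarrow> a \<in> S0"
  using S0_closed(5)[of "k *s a" "inverse k"] by simp

lemma S0_E0: "a \<in> S0 \<Longrightarrow> a \<in> E0"
  using u_Wv by (auto simp: S0_def E0_closed)

lemma S0_e_f_H:
  assumes "a \<in> S0"
  shows "e \<cdot> a \<in> S0" "f \<cdot> a \<in> S0" "H \<cdot> a \<in> S0"
proof -
  have e: "e \<cdot> a \<in> S0" if a: "a \<in> S0" for a
  proof -
    obtain q q' where *: "q \<in> W v" "q' \<in> W v" "a = u \<cdot> q + (e \<cdot> u) \<cdot> q'" using a unfolding S0_def by blast
    have "e \<cdot> a = u \<cdot> (e \<cdot> q) + (e \<cdot> u) \<cdot> (q + e \<cdot> q')"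
      by (simp add: *(3) br_simps eu_e u_e)
    then show ?thesis using * S0I by (simp add: W_closed W_e)
  qed
  have f: "f \<cdot> a \<in> S0" if a: "a \<in> S0" for a
  proof -
    obtain q q' where *: "q \<in> W v" "q' \<in> W v" "a = u \<cdot> q + (e \<cdot> u) \<cdot> q'" using a unfolding S0_def by blast
    have "f \<cdot> a = u \<cdot> (f \<cdot> q - q') + (e \<cdot> u) \<cdot> (f \<cdot> q')"
      by (simp add: *(3) br_simps f_u_z f_eu_z)
    then show ?thesis using * S0I by (simp add: W_closed W_f_H vac_v)
  qed
  have "H \<cdot> a = e \<cdot> f \<cdot> a - f \<cdot> e \<cdot> a" by (simp add: f_e)
  then show "e \<cdot> a \<in> S0" "f \<cdot> a \<in> S0" "H \<cdot> a \<in> S0"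
    using assms e f S0_closed by simp_all
qed

text \<open>Every element of \<open>E0\<close> agrees modulo \<open>S0\<close> with one that commutes with \<open>u\<close> and \<open>[e, u]\<close>;
  such elements commute with the diagonal sl(2), which brings \<open>[e, E0]\<close>, \<open>[f, E0]\<close> and
  \<open>[H, E0]\<close> into \<open>S0\<close>.\<close>

definition "Cent = {b \<in> E0. b \<cdot> u = 0 \<and> b \<cdot> e \<cdot> u = 0}"

lemma Cent_closed:
  assumes b: "b \<in> Cent"
  shows "e \<cdot> b \<in> Cent" "f \<cdot> b \<in> Cent" "H \<cdot> b \<in> Cent"
proof -
  have e: "e \<cdot> b \<in> Cent" if "b \<in> Cent" for b
    using that jacobi_Ev[OF e_Ev, of b u] jacobi_Ev[OF e_Ev, of b "e \<cdot> u"]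
    by (auto simp: Cent_def E0_br vac_simps)
  have f: "f \<cdot> b \<in> Cent" if "b \<in> Cent" for b
    using that jacobi_Ev[OF f_Ev, of b u] jacobi_Ev[OF f_Ev, of b "e \<cdot> u"]
    by (auto simp: Cent_def E0_br vac_simps f_eu br_simps)
  have "H \<cdot> b = e \<cdot> f \<cdot> b - f \<cdot> e \<cdot> b" by (simp add: f_e)
  moreover have "subspace Cent"
    by (auto simp: subspace_def Cent_def br_simps E0_closed)
  ultimately show "e \<cdot> b \<in> Cent" "f \<cdot> b \<in> Cent" "H \<cdot> b \<in> Cent"
    using e f b by (simp_all add: subspace_diff)
qed

lemma eu_ev: "(e \<cdot> u) \<cdot> e \<cdot> v = - e"
proof -
  have "e \<cdot> (2 *s u \<cdot> e \<cdot> v) = e \<cdot> (c - H)" by (simp only: u_ev)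
  moreover have "e \<cdot> c = 0" using antisym_Ev[of c e] c_e by simp
  moreover have "e \<cdot> H = 2 *s e" using antisym_Ev[of H e] H_e by (simp add: H_def Ev_closed)
  ultimately have "2 *s (e \<cdot> u) \<cdot> e \<cdot> v = 2 *s (- e)"
    using jacobi_Ev[OF e_Ev, of u "e \<cdot> v"] by (simp add: br_simps vac_simps)
  then show ?thesis by (simp only: scale_cancel_left) simp
qed

text \<open>Since \<open>b\<close> commutes with \<open>u\<close>, \<open>e \<cdot> u\<close> and
  \<open>c\<close>, twice \<open>\<psi> (b \<cdot> v)\<close> is
  \<open>u \<cdot> H \<cdot> b\<close>, which is zero because \<open>H \<cdot> b\<close> is again in
  \<open>Cent\<close>. Injectivity of \<open>\<psi>\<close> gives \<open>b \<cdot> v = 0\<close>,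
  and likewise \<open>b \<cdot> e \<cdot> v = 0\<close>; the diagonal sl(2) arises from brackets of
  these four odd elements.\<close>

lemma Cent_commutes:
  assumes b: "b \<in> Cent"
  shows "e \<cdot> b = 0" "f \<cdot> b = 0" "H \<cdot> b = 0"
proof -
  have bE: "b \<in> E0" "b \<in> Ev" and bu: "b \<cdot> u = 0" "b \<cdot> e \<cdot> u = 0"
    using b by (auto simp: Cent_def)
  have u_Cent: "u \<cdot> z = 0" if "z \<in> Cent" for z
    using that antisym_Ev[of z u] by (auto simp: Cent_def)
  have bc: "b \<cdot> c = 0" using antisym_Ev[of c b] c_E0[OF bE(1)] by simp
  have be: "b \<cdot> a = - (a \<cdot> b)" if "a \<in> Ev" for a using antisym_Ev[OF that] .
  have eub: "(e \<cdot> u) \<cdot> b \<cdot> z = b \<cdot> (e \<cdot> u) \<cdot> z" for z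
    using jacobi_Ev[OF bE(2), of "e \<cdot> u" z] bu by simp
  have v_eu': "2 *s (e \<cdot> u) \<cdot> v = - c - H" using v_eu sym_Od[of v "e \<cdot> u"] by simp
  have "2 *s (e \<cdot> u) \<cdot> b \<cdot> v = b \<cdot> (2 *s (e \<cdot> u) \<cdot> v)"
    by (simp add: eub br_simps)
  also have "\<dots> = H \<cdot> b" unfolding v_eu' by (simp add: br_simps bc be)
  finally have 1: "2 *s (e \<cdot> u) \<cdot> b \<cdot> v = H \<cdot> b" .
  have "2 *s \<psi> (b \<cdot> v) = u \<cdot> (2 *s (e \<cdot> u) \<cdot> b \<cdot> v)" by (simp add: \<psi>_def br_simps)
  also have "\<dots> = 0" unfolding 1 by (rule u_Cent[OF Cent_closed(3)[OF b]])
  finally have "\<psi> (b \<cdot> v) = 0" by simp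
  then have bv: "b \<cdot> v = 0" using E0_Wv[OF bE(1)] Wu_W_mem \<psi>_inj by blast
  then show "H \<cdot> b = 0" using 1 by simp
  have "b \<cdot> f = 0"
    using jacobi_Ev[OF bE(2), of u v] bu bv by (simp add: u_v br_simps)
  then show "f \<cdot> b = 0" using be[of f] by simp
  have 2: "(e \<cdot> u) \<cdot> b \<cdot> e \<cdot> v = e \<cdot> b"
    unfolding eub eu_ev by (simp add: br_simps be)
  have "\<psi> (b \<cdot> e \<cdot> v) = 0"
    unfolding \<psi>_def 2 by (rule u_Cent[OF Cent_closed(1)[OF b]])
  then have "b \<cdot> e \<cdot> v = 0" using E0_Wv[OF bE(1)] Wu_W_mem \<psi>_inj by blast
  then show "e \<cdot> b = 0" using 2 by simp
qed

text \<open>Surjectivity of \<open>\<psi>\<close> allows solving for an element of \<open>S0\<close>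
  that acts on \<open>u\<close> and \<open>e \<cdot> u\<close> as \<open>x\<close> does.\<close>

lemma E0_decomp:
  assumes x: "x \<in> E0"
  shows "\<exists>z\<in>S0. x - z \<in> Cent"
proof -
  have "- (x \<cdot> u) \<in> W u" "x \<cdot> e \<cdot> u \<in> W u"
    using E0_Wu[OF x] Wu_W_mem by (simp_all add: W_closed)
  then obtain q q' where q: "q \<in> W v" "\<psi> q = x \<cdot> e \<cdot> u" and q': "q' \<in> W v" "\<psi> q' = - (x \<cdot> u)"
    using \<psi>_surj by metis
  let ?z = "u \<cdot> q + (e \<cdot> u) \<cdot> q'"
  have z: "?z \<in> S0" "?z \<in> E0" using S0I q q' S0_E0 by auto
  have "?z \<cdot> u = - (u \<cdot> ?z)" "?z \<cdot> e \<cdot> u = - ((e \<cdot> u) \<cdot> ?z)"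
    using antisym_Ev[of ?z u] antisym_Ev[of ?z "e \<cdot> u"] z(2) by simp_all
  moreover have "u \<cdot> ?z = - (x \<cdot> u)" "(e \<cdot> u) \<cdot> ?z = - (x \<cdot> e \<cdot> u)"
    using q(2) q'(2) by (simp_all add: br_simps u_u_z eu_u_z flip: \<psi>_def)
  ultimately have "x - ?z \<in> Cent"
    using x z by (simp add: Cent_def br_diff E0_closed)
  then show ?thesis using z(1) by blast
qed

lemma E0_S0:
  assumes x: "x \<in> E0"
  shows "e \<cdot> x \<in> S0" "f \<cdot> x \<in> S0" "H \<cdot> x \<in> S0"
proof -
  obtain z where z: "z \<in> S0" "x - z \<in> Cent" using E0_decomp[OF x] by blast
  have "e \<cdot> x = e \<cdot> z" "f \<cdot> x = f \<cdot> z" "H \<cdot> x = H \<cdot> z"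
    using Cent_commutes[OF z(2)] by (simp_all add: br_diff)
  then show "e \<cdot> x \<in> S0" "f \<cdot> x \<in> S0" "H \<cdot> x \<in> S0" using S0_e_f_H[OF z(1)] by simp_all
qed

text \<open>The exceptional case of \<open>ftu_Wv\<close>: the bracket has weight 0, and
  \<open>ew v 3 1\<close> ends its string. Here \<open>u \<cdot> ew v 3 1\<close> is a combination
  of second \<open>e\<close>-images of \<open>e \<cdot> y\<close>, \<open>ft\<close> and
  \<open>f\<close>; carrying \<open>ft\<close> inside turns each term into brackets of
  \<open>e\<close> or \<open>f\<close> with \<open>E0\<close>.\<close>

lemma ftu_e3_ftv: "(ft \<cdot> u) \<cdot> ew v 3 1 \<in> S0"
proof -
  have e3: "ew v 3 1 = e \<cdot> e \<cdot> e \<cdot> ft \<cdot> v" by (simp add: ew_def wv_def numeral_3_eq_3)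
  have hT: "hT = e \<cdot> ft" by (simp add: hT_def)
  have TE: "hT \<in> E0" "eT \<in> E0" unfolding eT_def hT_def by (intro E0_br E0_closed; simp)+
  have "e \<cdot> e \<cdot> e \<cdot> u \<cdot> ft \<cdot> v = u \<cdot> ew v 3 1 + 3 *s e \<cdot> e \<cdot> (e \<cdot> u) \<cdot> ft \<cdot> v"
    by (rule vec_eqI) (simp add: e3 u_e eu_e br_simps dual_simps del: One_nat_def)
  then have 1: "u \<cdot> ew v 3 1 = (-2) *s e \<cdot> e \<cdot> e \<cdot> y - (3/2) *s e \<cdot> e \<cdot> (2 *s (e \<cdot> u) \<cdot> ft \<cdot> v)"
    unfolding y_eq' by (simp add: br_simps)
  have "u \<cdot> ew v 3 1 = (-1/2) *s e \<cdot> e \<cdot> e \<cdot> y - (9/2) *s e \<cdot> e \<cdot> ft + (9/2 * \<mu>) *s e \<cdot> e \<cdot> f"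
    unfolding 1 eu_ftv by (rule vec_eqI) (simp add: br_simps dual_simps field_simps)
  then have "ft \<cdot> u \<cdot> ew v 3 1 = (-1/2) *s ft \<cdot> e \<cdot> e \<cdot> e \<cdot> y - (9/2) *s ft \<cdot> e \<cdot> e \<cdot> ft + (9/2 * \<mu>) *s ft \<cdot> e \<cdot> e \<cdot> f"
    by (simp add: br_simps)
  moreover have "ft \<cdot> e \<cdot> e \<cdot> e \<cdot> y \<in> S0"
  proof -
    have "ft \<cdot> e \<cdot> e \<cdot> e \<cdot> y = e \<cdot> (e \<cdot> ft \<cdot> e \<cdot> y - 2 *s hT \<cdot> e \<cdot> y + 2 *s eT \<cdot> y)"
      by (simp add: ft_e_e[of "e \<cdot> y"] br_simps eT_e)
    also have "\<dots> \<in> S0" by (intro E0_S0 E0_closed E0_br TE) simp_all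
    finally show ?thesis .
  qed
  moreover have "ft \<cdot> e \<cdot> e \<cdot> ft \<in> S0"
  proof -
    have "ft \<cdot> e \<cdot> e \<cdot> ft = e \<cdot> (2 *s ft - 2 *s hT \<cdot> ft)"
      using self_br_Ev[of ft] by (simp add: ft_e_e[of ft] br_simps eT_ft hT)
    also have "\<dots> \<in> S0" by (intro E0_S0 E0_closed E0_br TE) simp_all
    finally show ?thesis .
  qed
  moreover have "ft \<cdot> e \<cdot> e \<cdot> f \<in> S0"
  proof -
    have "ft \<cdot> e \<cdot> e \<cdot> f = e \<cdot> (e \<cdot> ft \<cdot> f - 2 *s hT \<cdot> f) - 2 *s f \<cdot> eT"
      using antisym_Ev[of f eT] by (simp add: ft_e_e[of f] br_simps)
    also have "\<dots> \<in> S0" by (intro S0_closed E0_S0 E0_closed E0_br TE) simp_all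
    finally show ?thesis .
  qed
  ultimately have "ft \<cdot> u \<cdot> ew v 3 1 \<in> S0" by (simp add: S0_closed)
  moreover have "u \<cdot> ft \<cdot> ew v 3 1 \<in> S0"
    by (intro S0I' W_ft_hT_eT[OF vac_v]) simp
  moreover have "(ft \<cdot> u) \<cdot> ew v 3 1 = ft \<cdot> u \<cdot> ew v 3 1 - u \<cdot> ft \<cdot> ew v 3 1"
    using jacobi_Ev[OF ft_Ev, of u "ew v 3 1"] by simp
  ultimately show ?thesis by (simp add: S0_closed)
qed

lemma ftu_Wv:
  assumes "q \<in> W v"
  shows "(ft \<cdot> u) \<cdot> q \<in> S0"
proof -
  have f: "f \<cdot> (ft \<cdot> u) \<cdot> z = (ft \<cdot> u) \<cdot> f \<cdot> z" for z
    using jacobi_Ev[OF f_Ev, of "ft \<cdot> u" z] by (simp add: f_ft' vac_simps)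
  have H: "H \<cdot> (ft \<cdot> u) \<cdot> z = 3 *s (ft \<cdot> u) \<cdot> z + (ft \<cdot> u) \<cdot> H \<cdot> z" for z
  proof -
    have "H \<cdot> ft \<cdot> u = 3 *s ft \<cdot> u"
      using W_f_H_wv(2)[OF vac_u, of 1] by (simp add: wv_def)
    then show ?thesis using jacobi_Ev[of H "ft \<cdot> u" z] by (simp add: br_simps)
  qed
  have "(ft \<cdot> u) \<cdot> ew v i n \<in> S0" for i n
  proof -
    have ew: "ew v i n \<in> W v" for i n by simp
    \<comment> \<open>Below the end of its string \<open>ew v i n\<close> is a multiple of an
      \<open>f\<close>-image. At the end, the bracket with \<open>ft \<cdot> u\<close> has weight
      \<open>2 - 2 * n\<close>, so it is a multiple of an \<open>H\<close>-image unless
      \<open>n = 1\<close>.\<close>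
    consider "i \<le> 2 * n" | "i = 2 * n + 1" "n \<noteq> 1" | "i = 3" "n = 1" | "i \<ge> 2 * n + 2" by linarith
    then show ?thesis
    proof cases
      case 1
      let ?k = "- (of_nat (Suc i) * (2 * of_nat n + 1 - of_nat i)) :: complex"
      have "of_nat (2 * n + 1) \<noteq> (of_nat i :: complex)" using 1 by (simp only: of_nat_eq_iff)
      then have "2 * of_nat n + 1 - of_nat i \<noteq> (0::complex)" by (simp add: add.commute)
      then have k: "?k \<noteq> 0" by (simp del: of_nat_Suc)
      have "?k *s (ft \<cdot> u) \<cdot> ew v i n = (ft \<cdot> u) \<cdot> f \<cdot> ew v (Suc i) n"
        by (simp only: f_ew[OF vac_v] br_scale_right)
      also have "\<dots> \<in> S0"
        unfolding f[symmetric] by (rule E0_S0) (rule Wu_Wv[OF Wu_W_mem(3) ew])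
      finally show ?thesis by (rule S0_scaleD[OF _ k])
    next
      case 2
      have "of_nat n \<noteq> (1 :: complex)" using 2(2) by simp
      then have k: "2 - 2 * of_nat n \<noteq> (0 :: complex)" by auto
      have "(2 - 2 * of_nat n) *s (ft \<cdot> u) \<cdot> ew v i n = H \<cdot> (ft \<cdot> u) \<cdot> ew v i n"
        unfolding H H_ew[OF vac_v] 2(1) by (rule vec_eqI) (simp add: br_simps dual_simps algebra_simps)
      also have "\<dots> \<in> S0" by (rule E0_S0) (rule Wu_Wv[OF Wu_W_mem(3) ew])
      finally show ?thesis by (rule S0_scaleD[OF _ k])
    next
      case 3 then show ?thesis using ftu_e3_ftv by simp
    next
      case 4 then show ?thesis by (simp add: ew_zero[OF vac_v] S0_closed)
    qed
  qed
  then show ?thesis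
    using span_br_closed[of "{ew v i n | i n. True}" "ft \<cdot> u" S0 q] subspace_S0 assms by (auto simp: W_def)
qed

lemma S0_ft_y:
  assumes "a \<in> S0"
  shows "ft \<cdot> a \<in> S0" "y \<cdot> a \<in> S0"
proof -
  obtain q q' where *: "q \<in> W v" "q' \<in> W v" "a = u \<cdot> q + (e \<cdot> u) \<cdot> q'" using assms unfolding S0_def by blast
  have 1: "(e \<cdot> ft \<cdot> u) \<cdot> q' \<in> S0"
  proof -
    have "(e \<cdot> ft \<cdot> u) \<cdot> q' = e \<cdot> (ft \<cdot> u) \<cdot> q' - (ft \<cdot> u) \<cdot> e \<cdot> q'"
      using jacobi_Ev[OF e_Ev, of "ft \<cdot> u" q'] by simp
    then show ?thesis using * by (simp add: S0_closed S0_e_f_H ftu_Wv W_e)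
  qed
  have "(3 *s ft \<cdot> e \<cdot> u) \<cdot> q' = (e \<cdot> ft \<cdot> u - (3 * \<mu>) *s u) \<cdot> q'" by (simp only: vac_simps)
  then have "3 *s (ft \<cdot> e \<cdot> u) \<cdot> q' = (e \<cdot> ft \<cdot> u) \<cdot> q' - (3 * \<mu>) *s u \<cdot> q'" by (simp add: br_simps)
  also have "\<dots> \<in> S0" using 1 * by (simp add: S0_closed S0I')
  finally have 2: "(ft \<cdot> e \<cdot> u) \<cdot> q' \<in> S0" by (rule S0_scaleD) simp
  have "ft \<cdot> a = (ft \<cdot> u) \<cdot> q + u \<cdot> ft \<cdot> q + (ft \<cdot> e \<cdot> u) \<cdot> q' + (e \<cdot> u) \<cdot> ft \<cdot> q'"
    unfolding *(3) br_add_right jacobi_Ev[OF ft_Ev, of u q] jacobi_Ev[OF ft_Ev, of "e \<cdot> u" q'] by simp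
  then show "ft \<cdot> a \<in> S0" using * 2 by (simp add: S0_closed S0I' ftu_Wv W_ft_hT_eT vac_v)
  have "y \<cdot> a = u \<cdot> y \<cdot> q + (ft \<cdot> u) \<cdot> q' + (e \<cdot> u) \<cdot> y \<cdot> q'"
    unfolding *(3) br_add_right jacobi_Ev[OF y_Ev, of u q] jacobi_Ev[OF y_Ev, of "e \<cdot> u" q'] by (simp add: y_u y_eu)
  then show "y \<cdot> a \<in> S0" using * by (simp add: S0_closed S0I' ftu_Wv E0_Wv)
qed

lemma E0_subset_S0: "x \<in> E0 \<Longrightarrow> x \<in> S0"
proof -
  have gens: "e \<in> S0" "f \<in> S0" "ft \<in> S0" "y \<in> S0" "c \<in> S0"
  proof -
    have "- ((e \<cdot> u) \<cdot> e \<cdot> v) \<in> S0" by (intro S0_closed S0I' Wu_W_mem)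
    then show "e \<in> S0" by (simp add: eu_ev)
    have "- (u \<cdot> v) \<in> S0" by (intro S0_closed S0I' Wu_W_mem)
    then show f: "f \<in> S0" by (simp add: u_v)
    have "(-1/2) *s u \<cdot> ft \<cdot> v \<in> S0" by (intro S0_closed S0I' Wu_W_mem)
    then show "y \<in> S0" by (simp add: y_eq')
    have "u \<cdot> e \<cdot> v - (e \<cdot> u) \<cdot> v \<in> S0" by (intro S0_closed S0I' Wu_W_mem)
    moreover have "u \<cdot> e \<cdot> v - (e \<cdot> u) \<cdot> v = c"
    proof (rule vec_eqI)
      fix h assume d: "dual h"
      have "2 * coord h (u \<cdot> e \<cdot> v - (e \<cdot> u) \<cdot> v) = 2 * coord h c"
        using coord_cong[OF u_ev, of h] coord_cong[OF v_eu, of h]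
        by (simp add: sym_Od[of v "e \<cdot> u"] dual_simps[OF d]; algebra)
      then show "coord h (u \<cdot> e \<cdot> v - (e \<cdot> u) \<cdot> v) = coord h c" by simp
    qed
    ultimately show "c \<in> S0" by simp
    have "e \<cdot> ft \<cdot> v \<in> W v" by (intro W_e Wu_W_mem)
    \<comment> \<open>The factors 1/4 and -1/12 eliminate \<open>e \<cdot> y\<close> between
      \<open>eu_ftv\<close> and \<open>u_eftv\<close>.\<close>
    then have "(1/4) *s (2 *s (e \<cdot> u) \<cdot> ft \<cdot> v) - (1/12) *s (2 *s u \<cdot> e \<cdot> ft \<cdot> v) + \<mu> *s f \<in> S0"
      by (intro S0_closed S0I' Wu_W_mem f)
    moreover have "(1/4) *s (2 *s (e \<cdot> u) \<cdot> ft \<cdot> v) - (1/12) *s (2 *s u \<cdot> e \<cdot> ft \<cdot> v) + \<mu> *s f = ft"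
      unfolding eu_ftv u_eftv by (rule vec_eqI) (simp add: dual_simps field_simps)
    ultimately show "ft \<in> S0" by simp
  qed
  assume "x \<in> E0"
  \<comment> \<open>Membership and stability go together: \<open>x \<cdot> z\<close> lies in
    \<open>S0\<close> because \<open>z\<close> does and \<open>x\<close> preserves
    \<open>S0\<close>.\<close>
  then have "x \<in> S0 \<and> (\<forall>a\<in>S0. x \<cdot> a \<in> S0)"
    unfolding E0_def
  proof (induction rule: subalg.induct)
    case (base x)
    have "c \<cdot> a \<in> S0" if "a \<in> S0" for a
      using c_E0[OF S0_E0[OF that]] by (simp add: S0_closed)
    with base show ?case by (elim insertE emptyE) (simp_all add: gens S0_e_f_H S0_ft_y)
  next
    case (br x z)
    then have "x \<in> Ev" using S0_E0 E0_Ev by blast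
    then have "(x \<cdot> z) \<cdot> a = x \<cdot> z \<cdot> a - z \<cdot> x \<cdot> a" for a
      using jacobi_Ev[of x z a] by simp
    then show ?case using br by (simp add: S0_closed)
  qed (auto simp: S0_closed br_simps)
  then show "x \<in> S0" by blast
qed

lemma K_subalg_trivial:
  assumes x: "x \<in> K" "x \<in> subalg {u, e \<cdot> u, v, e \<cdot> v, ft \<cdot> u, ft \<cdot> v, f}"
  shows "x = 0"
proof -
  obtain a b d where *: "a \<in> W u" "b \<in> E0" "d \<in> W v" "x = a + b + d"
    using subalg_decomp[OF x(2)] by blast
  \<comment> \<open>The eigenvalues of \<open>c\<close> on the three summands are 1, 0 and -1, so
    one and two brackets with \<open>c\<close> isolate \<open>a\<close> and
    \<open>d\<close>.\<close>
  have 1: "c \<cdot> x = a - d"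
    by (simp add: *(4) br_simps c_Wu[OF *(1)] c_Wv[OF *(3)] c_E0[OF *(2)])
  have "c \<cdot> c \<cdot> x = a + d"
    unfolding 1 by (simp add: br_simps c_Wu[OF *(1)] c_Wv[OF *(3)])
  then have "a - d \<in> K" "a + d \<in> K" using K(2)[OF x(1), of c] K(2)[OF K(2)[OF x(1), of c], of c] 1 by simp_all
  then have "(1/2) *s ((a + d) + (a - d)) \<in> K" "(1/2) *s ((a + d) - (a - d)) \<in> K"
    using K(1) by (simp_all only: subspace_add subspace_diff subspace_scale)
  moreover have "(1/2) *s ((a + d) + (a - d)) = a" "(1/2) *s ((a + d) - (a - d)) = d"
    by (rule vec_eqI, simp add: dual_simps)+
  ultimately have "a \<in> K" "d \<in> K" by simp_all
  then have ad: "a = 0" "d = 0" using K_Wu K_Wv * by auto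
  then have b: "b \<in> K" "b \<in> S0" using x *(2,4) E0_subset_S0 by auto
  then obtain q q' where q: "q \<in> W v" "q' \<in> W v" "b = u \<cdot> q + (e \<cdot> u) \<cdot> q'" unfolding S0_def by blast
  have "u \<cdot> b = \<psi> q'" "(e \<cdot> u) \<cdot> b = - \<psi> q"
    by (simp_all add: q(3) br_simps u_u_z eu_u_z flip: \<psi>_def)
  then have "\<psi> q' \<in> K" "- (- \<psi> q) \<in> K" using K(2)[OF b(1), of u] K(2)[OF b(1), of "e \<cdot> u"] subspace_neg[OF K(1), of "- \<psi> q"] by simp_all
  then have "\<psi> q' = 0" "\<psi> q = 0" using K_Wu \<psi>_W q by auto
  then have "q = 0" "q' = 0" using \<psi>_inj q by auto
  then show ?thesis by (simp add: *(4) ad q(3))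
qed

end

end

section \<open>The generators and relations of the paper\<close>

text \<open>The label \<open>rij\<close> refers to relation (i.j).\<close>

locale sl_presentation = lie_superalgebra +
  fixes X Y Z U :: 'a and lam t :: complex
  assumes X_Od [simp]: "X \<in> Od" and Y_Ev [simp]: "Y \<in> Ev" and Z_Od [simp]: "Z \<in> Od" and U_Od [simp]: "U \<in> Od"
    and t: "t \<noteq> 0"
    and r02: "(X \<cdot> X \<cdot> Y) \<cdot> Y = 2 *s Y" and r03: "(X \<cdot> X \<cdot> Y) \<cdot> X = - X"
    and r04: "Y \<cdot> U = 0" and r05: "U \<cdot> U = (-2) *s Y" and r06: "U \<cdot> X \<cdot> Y = 0"
    and r07: "(X \<cdot> X) \<cdot> X \<cdot> U = 0" and r08: "(X \<cdot> X \<cdot> Y) \<cdot> U = U"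
    and r11: "Y \<cdot> Z = 0" and r12: "(X \<cdot> Y) \<cdot> Z = 0"
    and r13: "X \<cdot> X \<cdot> X \<cdot> X \<cdot> X \<cdot> X \<cdot> X \<cdot> Z = 0" and r14: "(X \<cdot> X \<cdot> Y) \<cdot> Z = 3 *s Z"
    and r15: "3 *s Z \<cdot> X \<cdot> U = U \<cdot> X \<cdot> Z" and r16: "(X \<cdot> U) \<cdot> X \<cdot> Z = 0"
    and r22: "(X \<cdot> Z) \<cdot> X \<cdot> X \<cdot> X \<cdot> Z = (2 * t\<^sup>2 * (lam - 1) * (lam + 2)) *s Y + (2 * t * (2 * lam + 1)) *s X \<cdot> Z"
    and r24: "(X \<cdot> Z) \<cdot> U \<cdot> Z = 0"
begin

definition "e = (1/2) *s X \<cdot> X"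
definition "c = X \<cdot> U"
text \<open>On the two blocks \<open>[X, Z]\<close> acts by the derivative with scalars
  \<open>t * (1 - lam)\<close> and \<open>- t * (lam + 2)\<close>. The constants here and in
  \<open>ft\<close> are those for which \<open>ft\<close> is the derivative on the first block and
  zero on the second.\<close>

definition "\<mu> = (lam + 2) / 3"
definition "ft = (1 / (3 * t)) *s X \<cdot> Z + \<mu> *s Y"
definition "y = (1 / (4 * t)) *s U \<cdot> Z"
definition "up a = (1/2) *s (a + c \<cdot> a)"
definition "um a = (1/2) *s (a - c \<cdot> a)"

lemma Ev_XU [simp]: "e \<in> Ev" "c \<in> Ev" "ft \<in> Ev" "y \<in> Ev" "X \<cdot> Z \<in> Ev" "U \<cdot> Z \<in> Ev" "X \<cdot> X \<in> Ev" "X \<cdot> U \<in> Ev"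
  by (simp_all add: e_def c_def ft_def y_def Ev_closed)

lemma XY_Od [simp]: "X \<cdot> Y \<in> Od" "a \<in> Od \<Longrightarrow> c \<cdot> a \<in> Od" "a \<in> Od \<Longrightarrow> up a \<in> Od" "a \<in> Od \<Longrightarrow> um a \<in> Od"
  by (simp_all add: Od_br_Ev Od_closed up_def um_def)

lemma double_cancel: "a + a = (0::'a) \<Longrightarrow> a = 0"
  using scale_left_distrib[of 1 1 a] by simp

lemma Od_br_twice: "a \<in> Od \<Longrightarrow> a \<cdot> a \<cdot> z = (1/2) *s (a \<cdot> a) \<cdot> z"
proof (rule vec_eqI)
  fix h assume a: "a \<in> Od" and d: "dual h"
  have "2 * coord h (a \<cdot> a \<cdot> z) = coord h ((a \<cdot> a) \<cdot> z)"
    using coord_cong[OF jacobi_Od[OF a a, of z], of h] by (simp add: dual_simps[OF d])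
  then show "coord h (a \<cdot> a \<cdot> z) = coord h ((1/2) *s (a \<cdot> a) \<cdot> z)"
    by (simp add: dual_simps[OF d] flip: \<open>2 * coord h (a \<cdot> a \<cdot> z) = coord h ((a \<cdot> a) \<cdot> z)\<close>)
qed

lemma X_X: "X \<cdot> X \<cdot> z = e \<cdot> z"
  unfolding Od_br_twice[OF X_Od] by (simp add: e_def br_simps)

lemma U_U: "U \<cdot> U \<cdot> z = - (Y \<cdot> z)"
  unfolding Od_br_twice[OF U_Od] by (simp add: r05 br_simps)

lemma X_e: "X \<cdot> e \<cdot> z = e \<cdot> X \<cdot> z"
  by (simp flip: X_X)

text \<open>This is \<open>[X, [X, X]] = 0\<close>: evaluating the triple bracket in two ways gives
  \<open>e \<cdot> X = (-1/2) *s e \<cdot> X\<close>.\<close>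

lemma e_X: "e \<cdot> X = 0"
proof -
  have "X \<cdot> ((1/2) *s X \<cdot> X) = (1/2) *s e \<cdot> X" by (simp only: br_scale_right X_X)
  then have "X \<cdot> e = (1/2) *s e \<cdot> X" by (simp only: e_def)
  moreover have "e \<cdot> X = - (X \<cdot> e)" using antisym_Ev[of e X] by simp
  ultimately have "e \<cdot> X = (-1/2) *s e \<cdot> X" by simp
  then have "e \<cdot> X - (-1/2) *s e \<cdot> X = 0" by simp
  then have "(1 - (-1/2)) *s e \<cdot> X = 0" by (simp only: scale_left_diff_distrib scale_one)
  then show ?thesis by simp
qed

lemma H_simps: "(e \<cdot> Y) \<cdot> Y = 2 *s Y" "(e \<cdot> Y) \<cdot> X = - X" "(e \<cdot> Y) \<cdot> U = U" "(e \<cdot> Y) \<cdot> Z = 3 *s Z"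
  using r02 r03 r08 r14 by (simp_all add: X_X)

lemma H_Ev [simp]: "e \<cdot> Y \<in> Ev" by (simp add: Ev_closed)

lemma antisym_Ev_rev: "a \<in> Ev \<Longrightarrow> a \<cdot> b = - (b \<cdot> a)"
  using antisym_Ev[of a b] by simp

section \<open>The grading by \<open>c\<close> and the degree parts of the odd generators\<close>

lemma c_X: "c \<cdot> X = - (e \<cdot> U)"
proof -
  have "X \<cdot> c = e \<cdot> U" unfolding c_def by (rule X_X)
  then show ?thesis using antisym_Ev_rev[of c X] by simp
qed

text \<open>\<open>c = [X, U]\<close> is a grading element: each odd generator satisfies
  \<open>[c, [c, a]] = a\<close>, so that \<open>up a\<close> and \<open>um a\<close> have degrees 1 and -1.\<close>

lemma c_U: "c \<cdot> U = - (X \<cdot> Y)"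
proof -
  have "U \<cdot> c = X \<cdot> Y"
    unfolding c_def sym_Od[OF U_Od X_Od] U_U using antisym_Ev[OF Y_Ev, of X] by simp
  then show ?thesis using antisym_Ev_rev[of c U] by simp
qed

lemma c_Y: "c \<cdot> Y = 0"
proof -
  have "(X \<cdot> Y) \<cdot> U = 0" using r06 sym_Od[of U "X \<cdot> Y"] by simp
  then have "Y \<cdot> X \<cdot> U = 0"
    using jacobi_Ev[OF Y_Ev, of X U] antisym_Ev[OF Y_Ev, of X] by (simp add: r04 br_simps neg_eq_iff_add_eq_0)
  then show ?thesis using antisym_Ev[of c Y] by (simp add: c_def)
qed

lemma c_e: "c \<cdot> e = 0"
proof -
  have "e \<cdot> c = 0" using r07 by (simp add: e_def c_def br_simps)
  then show "c \<cdot> e = 0" using antisym_Ev[of e c] by simp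
qed

lemma c_e_z: "c \<cdot> e \<cdot> z = e \<cdot> c \<cdot> z"
  using jacobi_Ev[of c e z] by (simp add: c_e)

lemma c_Y_z: "c \<cdot> Y \<cdot> z = Y \<cdot> c \<cdot> z"
  using jacobi_Ev[of c Y z] by (simp add: c_Y)

lemma c_H_z: "c \<cdot> (e \<cdot> Y) \<cdot> z = (e \<cdot> Y) \<cdot> c \<cdot> z"
  using jacobi_Ev[of c "e \<cdot> Y" z] by (simp add: c_e_z c_Y)

lemma Y_e: "Y \<cdot> e \<cdot> z = e \<cdot> Y \<cdot> z - (e \<cdot> Y) \<cdot> z"
  using jacobi_Ev[of e Y z] by simp

lemma c_c_U: "c \<cdot> c \<cdot> U = U"
proof -
  have "c \<cdot> X \<cdot> Y = - ((e \<cdot> U) \<cdot> Y)"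
    using jacobi_Ev[of c X Y] by (simp add: c_X c_Y br_simps)
  also have "\<dots> = Y \<cdot> e \<cdot> U" using antisym_Ev[OF Y_Ev] by simp
  also have "\<dots> = - U" by (simp add: Y_e r04 H_simps)
  finally show ?thesis by (simp add: c_U br_simps)
qed

lemma c_c_X: "c \<cdot> c \<cdot> X = X"
proof -
  have "c \<cdot> c \<cdot> X = e \<cdot> X \<cdot> Y" by (simp add: c_X br_simps c_e_z c_U)
  also have "\<dots> = X \<cdot> e \<cdot> Y" by (simp add: X_X[symmetric])
  also have "\<dots> = X" using antisym_Ev[OF H_Ev, of X] by (simp add: H_simps)
  finally show ?thesis .
qed

lemma c_Z: "3 *s c \<cdot> Z = - (U \<cdot> X \<cdot> Z)"
  using r15 antisym_Ev[of c Z] by (simp add: c_def br_simps) (metis scale_minus_right minus_minus)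

lemma X_U_Z: "X \<cdot> U \<cdot> Z = 4 *s c \<cdot> Z"
  (is "?l = ?r")
proof (rule vec_eqI)
  fix h assume d: "dual h"
  have "U \<cdot> X \<cdot> Z = c \<cdot> Z - X \<cdot> U \<cdot> Z"
    using jacobi_Od[of U X Z] sym_Od[of U X] by (simp add: c_def)
  from coord_cong[OF this, of h] coord_cong[OF c_Z, of h]
  show "coord h ?l = coord h ?r"
    unfolding dual_simps[OF d] by algebra
qed

lemma c_Z1: "c \<cdot> X \<cdot> Z = 0"
  using r16 by (simp add: c_def)

lemma c_Z1_z: "c \<cdot> (X \<cdot> Z) \<cdot> z = (X \<cdot> Z) \<cdot> c \<cdot> z"
  using jacobi_Ev[of c "X \<cdot> Z" z] by (simp add: c_Z1)

text \<open>By \<open>c_Z\<close> a multiple of \<open>c \<cdot> Z\<close> is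
  \<open>U \<cdot> X \<cdot> Z\<close>. As \<open>c\<close> kills \<open>X \<cdot> Z\<close> and
  turns \<open>U\<close> into \<open>- (X \<cdot> Y)\<close>, and as \<open>X \<cdot> Y\<close>
  kills \<open>Z\<close>, only the weight 3 of \<open>Z\<close> under \<open>e \<cdot> Y\<close>
  remains.\<close>

lemma c_c_Z: "c \<cdot> c \<cdot> Z = Z"
proof -
  have "(X \<cdot> Y) \<cdot> X = e \<cdot> Y" using sym_Od[of X "X \<cdot> Y"] by (simp add: X_X)
  then have 1: "(X \<cdot> Y) \<cdot> X \<cdot> Z = 3 *s Z"
    using jacobi_Od[of "X \<cdot> Y" X Z] by (simp add: r12 H_simps)
  have "3 *s c \<cdot> c \<cdot> Z = c \<cdot> (3 *s c \<cdot> Z)" by (simp add: br_simps)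
  also have "\<dots> = - (c \<cdot> U \<cdot> X \<cdot> Z)" unfolding c_Z by (simp add: br_simps)
  also have "\<dots> = 3 *s Z"
    using jacobi_Ev[of c U "X \<cdot> Z"] by (simp add: c_U c_Z1 br_simps 1)
  finally show ?thesis by simp
qed

lemma Y_Z1: "Y \<cdot> X \<cdot> Z = 0"
  using jacobi_Ev[OF Y_Ev, of X Z] by (simp add: r11 r12 br_simps antisym_Ev_rev[OF Y_Ev, of X])

lemma U_c_Z: "U \<cdot> c \<cdot> Z = 0"
proof -
  have "3 *s U \<cdot> c \<cdot> Z = U \<cdot> (3 *s c \<cdot> Z)" by (simp add: br_simps)
  also have "\<dots> = 0" unfolding c_Z by (simp add: br_simps U_U Y_Z1)
  finally show ?thesis by simp
qed

lemma c_UZ: "c \<cdot> U \<cdot> Z = 0"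
  using jacobi_Ev[of c U Z] by (simp add: c_U r12 U_c_Z br_simps)

lemma c_UZ_z: "c \<cdot> (U \<cdot> Z) \<cdot> z = (U \<cdot> Z) \<cdot> c \<cdot> z"
  using jacobi_Ev[of c "U \<cdot> Z" z] by (simp add: c_UZ)

text \<open>If \<open>[a, b]\<close> has degree zero in the grading by eigenvalues of \<open>c\<close>, its components of
  degree \<open>2\<close> and \<open>-2\<close> vanish.\<close>
lemma degree_split:
  assumes a: "c \<cdot> c \<cdot> a = a" and b: "c \<cdot> c \<cdot> b = b" and ab: "c \<cdot> a \<cdot> b = 0"
  shows "up a \<cdot> up b = 0" "um a \<cdot> um b = 0"
    "up a \<cdot> um b = (1/2) *s (a \<cdot> b + (c \<cdot> a) \<cdot> b)" "um a \<cdot> up b = (1/2) *s (a \<cdot> b - (c \<cdot> a) \<cdot> b)"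
proof -
  have J: "c \<cdot> p \<cdot> q = (c \<cdot> p) \<cdot> q + p \<cdot> c \<cdot> q" for p q by (rule jacobi_Ev) simp
  have 1: "(c \<cdot> a) \<cdot> b + a \<cdot> c \<cdot> b = 0" using ab J[of a b] by simp
  have 2: "a \<cdot> b + (c \<cdot> a) \<cdot> c \<cdot> b = 0"
  proof -
    have "c \<cdot> ((c \<cdot> a) \<cdot> b + a \<cdot> c \<cdot> b) = 0" by (simp only: 1 br_zero)
    then have "(a \<cdot> b + (c \<cdot> a) \<cdot> c \<cdot> b) + (a \<cdot> b + (c \<cdot> a) \<cdot> c \<cdot> b) = 0"
      by (simp add: br_simps J[of "c \<cdot> a" b] J[of a "c \<cdot> b"] a b add_ac)
    then show ?thesis by (rule double_cancel)
  qed
  have *: "coord h (up a \<cdot> up b) = coord h 0 \<and> coord h (um a \<cdot> um b) = coord h 0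
    \<and> coord h (up a \<cdot> um b) = coord h ((1/2) *s (a \<cdot> b + (c \<cdot> a) \<cdot> b))
    \<and> coord h (um a \<cdot> up b) = coord h ((1/2) *s (a \<cdot> b - (c \<cdot> a) \<cdot> b))" if d: "dual h" for h
  proof -
    define p q r s where "p = coord h (a \<cdot> b)" and "q = coord h ((c \<cdot> a) \<cdot> b)"
      and "r = coord h (a \<cdot> c \<cdot> b)" and "s = coord h ((c \<cdot> a) \<cdot> c \<cdot> b)"
    have "q + r = 0" "p + s = 0"
      using coord_cong[OF 1, of h] coord_cong[OF 2, of h]
      by (simp_all add: dual_simps[OF d] p_def q_def r_def s_def)
    then have "r = - q" "s = - p" by (simp_all add: eq_neg_iff_add_eq_0 add.commute)
    then show ?thesis
      by (simp add: up_def um_def br_simps dual_simps[OF d] flip: p_def q_def r_def s_def)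
        (simp add: field_simps)
  qed
  show "up a \<cdot> up b = 0" "um a \<cdot> um b = 0"
    "up a \<cdot> um b = (1/2) *s (a \<cdot> b + (c \<cdot> a) \<cdot> b)" "um a \<cdot> up b = (1/2) *s (a \<cdot> b - (c \<cdot> a) \<cdot> b)"
    using * by (auto intro!: vec_eqI)
qed

text \<open>Together with \<open>ft_upU\<close> this exhibits the degree parts of \<open>X\<close>
  and \<open>Z\<close> as \<open>e\<close> and \<open>ft\<close> applied to those of
  \<open>U\<close>, which thereby become the lowest vectors \<open>u\<close> and
  \<open>v\<close>.\<close>

lemma e_upU: "e \<cdot> up U = - up X" "e \<cdot> um U = um X"
proof -
  have "- (c \<cdot> e \<cdot> U) = X" using c_c_X by (simp add: c_X br_simps)
  then have 1: "e \<cdot> U = - (c \<cdot> X)" "e \<cdot> c \<cdot> U = - X"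
    by (simp add: c_X, metis c_e_z minus_minus)
  show "e \<cdot> up U = - up X" "e \<cdot> um U = um X"
    by (rule vec_eqI, simp add: up_def um_def br_simps 1 dual_simps field_simps)+
qed

lemma ft_upU: "ft \<cdot> up U = (1 / t) *s up Z" "ft \<cdot> um U = (- 1 / t) *s um Z"
proof -
  have 1: "(X \<cdot> Z) \<cdot> U = 3 *s c \<cdot> Z"
    using c_Z antisym_Ev[of "X \<cdot> Z" U] by simp
  then have "c \<cdot> (X \<cdot> Z) \<cdot> U = 3 *s Z" by (simp add: br_simps c_c_Z)
  then have 2: "(X \<cdot> Z) \<cdot> c \<cdot> U = 3 *s Z" by (simp add: c_Z1_z)
  have 3: "Y \<cdot> c \<cdot> U = 0" by (simp add: r04 flip: c_Y_z)
  show "ft \<cdot> up U = (1 / t) *s up Z" "ft \<cdot> um U = (- 1 / t) *s um Z"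
    by (rule vec_eqI, simp add: ft_def up_def um_def br_simps 1 2 3 r04 dual_simps t field_simps)+
qed

lemma Z1_X: "(X \<cdot> Z) \<cdot> X = - (e \<cdot> Z)" "(X \<cdot> Z) \<cdot> c \<cdot> X = - (e \<cdot> c \<cdot> Z)"
proof -
  show 1: "(X \<cdot> Z) \<cdot> X = - (e \<cdot> Z)"
    using antisym_Ev[of "X \<cdot> Z" X] by (simp add: X_X)
  show "(X \<cdot> Z) \<cdot> c \<cdot> X = - (e \<cdot> c \<cdot> Z)"
    by (simp add: 1 br_simps flip: c_Z1_z c_e_z)
qed

lemma Y_c_U: "Y \<cdot> c \<cdot> U = 0" by (simp add: r04 flip: c_Y_z)

lemma Y_upU: "Y \<cdot> up U = 0" "Y \<cdot> um U = 0"
  by (simp_all add: up_def um_def br_simps r04 Y_c_U)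

lemma H_upU: "(e \<cdot> Y) \<cdot> up U = up U" "(e \<cdot> Y) \<cdot> um U = um U"
  by (simp_all add: up_def um_def br_simps H_simps flip: c_H_z)

text \<open>The last condition of \<open>vac\<close> for \<open>up U\<close> and
  \<open>um U\<close>, rewritten through \<open>e_upU\<close> and \<open>ft_upU\<close>.\<close>

lemma ft_upX: "3 *s ft \<cdot> up X = (- 1 / t) *s e \<cdot> up Z + (3 * \<mu>) *s up U"
  "3 *s ft \<cdot> um X = (- 1 / t) *s e \<cdot> um Z - (3 * \<mu>) *s um U"
proof -
  have "Y \<cdot> e \<cdot> up U = - up U" "Y \<cdot> e \<cdot> um U = - um U"
    by (simp_all add: Y_e Y_upU H_upU)
  then have 1: "Y \<cdot> up X = up U" "Y \<cdot> um X = - um U"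
    by (simp_all add: e_upU br_simps)
  have 2: "(X \<cdot> Z) \<cdot> up X = - (e \<cdot> up Z)" "(X \<cdot> Z) \<cdot> um X = - (e \<cdot> um Z)"
    by (rule vec_eqI, simp add: up_def um_def br_simps Z1_X dual_simps field_simps)+
  show "3 *s ft \<cdot> up X = (- 1 / t) *s e \<cdot> up Z + (3 * \<mu>) *s up U"
    "3 *s ft \<cdot> um X = (- 1 / t) *s e \<cdot> um Z - (3 * \<mu>) *s um U"
    by (rule vec_eqI, simp add: ft_def br_simps 1 2 dual_simps t field_simps)+
qed

lemma e_e_upU: "e \<cdot> e \<cdot> up U = 0" "e \<cdot> e \<cdot> um U = 0"
proof -
  have "e \<cdot> c \<cdot> X = 0" by (simp add: e_X flip: c_e_z)
  then show "e \<cdot> e \<cdot> up U = 0" "e \<cdot> e \<cdot> um U = 0"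
    by (simp_all only: e_upU br_minus) (simp_all add: br_simps up_def um_def e_X)
qed

lemma H_e: "(e \<cdot> Y) \<cdot> e = (-2) *s e"
proof -
  have *: "(e \<cdot> Y) \<cdot> X \<cdot> X = (-2) *s X \<cdot> X"
    using jacobi_Ev[OF H_Ev, of X X] scale_left_distrib[of "-1" "-1" "X \<cdot> X"] by (simp add: H_simps br_simps)
  have "(e \<cdot> Y) \<cdot> ((1/2) *s X \<cdot> X) = (-2) *s (1/2) *s X \<cdot> X"
    unfolding br_scale_right * by simp
  then show ?thesis unfolding e_def[symmetric] .
qed

lemma e_e_Y: "e \<cdot> e \<cdot> Y = 2 *s e"
  using antisym_Ev[OF H_Ev, of e] H_e by simp

lemma e_upX: "e \<cdot> up X = 0" "e \<cdot> um X = 0"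
  using e_e_upU by (simp_all add: e_upU br_minus)

lemma e_e: "e \<cdot> e = 0"
  by (rule self_br_Ev) simp

text \<open>Two letters \<open>X\<close> make one \<open>e\<close>, so \<open>r13\<close> says that
  the cube of \<open>e\<close> kills \<open>X \<cdot> Z\<close>; on \<open>Y\<close> it vanishes
  because \<open>e \<cdot> e \<cdot> Y\<close> is a multiple of \<open>e\<close>.\<close>

lemma e3_ft: "e \<cdot> e \<cdot> e \<cdot> ft = 0"
proof -
  have "e \<cdot> e \<cdot> e \<cdot> X \<cdot> Z = 0" using r13 by (simp add: X_X X_e)
  then show ?thesis by (simp add: ft_def br_simps e_e_Y e_e)
qed

lemma H_Z1: "(e \<cdot> Y) \<cdot> X \<cdot> Z = 2 *s X \<cdot> Z"
  (is "?l = ?r")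
proof (rule vec_eqI)
  fix h assume d: "dual h"
  show "coord h ?l = coord h ?r"
    using coord_cong[OF jacobi_Ev[OF H_Ev, of X Z], of h] by (simp add: H_simps br_simps dual_simps[OF d])
qed

lemma H_ft: "(e \<cdot> Y) \<cdot> ft = 2 *s ft"
  by (simp add: ft_def br_simps H_Z1 H_simps scale_right_distrib mult.commute)

text \<open>The quadratic relation \<open>r22\<close> becomes the sl(2) relation of the first factor
  once \<open>X \<cdot> Z\<close> is rescaled and shifted by \<open>\<mu> *s Y\<close>.\<close>

lemma ft_e_ft: "ft \<cdot> e \<cdot> ft = (-2) *s ft"
  (is "?l = ?r")
proof (rule vec_eqI)
  fix h assume d: "dual h"
  have 1: "(X \<cdot> Z) \<cdot> e \<cdot> X \<cdot> Z = (2 * t\<^sup>2 * (lam - 1) * (lam + 2)) *s Y + (2 * t * (2 * lam + 1)) *s X \<cdot> Z"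
    using r22 by (simp add: X_X X_e)
  have 2: "(X \<cdot> Z) \<cdot> e \<cdot> Y = (-2) *s X \<cdot> Z" using antisym_Ev[OF H_Ev, of "X \<cdot> Z"] by (simp add: H_Z1)
  have 3: "Y \<cdot> e \<cdot> X \<cdot> Z = (-2) *s X \<cdot> Z" by (simp add: Y_e Y_Z1 H_Z1)
  have 4: "Y \<cdot> e \<cdot> Y = (-2) *s Y" using antisym_Ev[OF H_Ev, of Y] by (simp add: H_simps)
  define p q where "p = coord h Y" and "q = coord h (X \<cdot> Z)"
  have "coord h (ft \<cdot> e \<cdot> ft) = (1 / (3 * t)) * ((1 / (3 * t)) * ((2 * t\<^sup>2 * (lam - 1) * (lam + 2)) * p + (2 * t * (2 * lam + 1)) * q)
      + \<mu> * (- 2 * q)) + \<mu> * ((1 / (3 * t)) * (- 2 * q) + \<mu> * (- 2 * p))"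
    unfolding ft_def br_simps 1 2 3 4 dual_simps[OF d] p_def q_def by (simp add: algebra_simps)
  also have "\<dots> = - 2 * ((1 / (3 * t)) * q + \<mu> * p)"
    using t by (simp add: \<mu>_def field_simps power2_eq_square)
  finally show "coord h ?l = coord h ?r"
    unfolding ft_def dual_simps[OF d] p_def q_def .
qed

lemma UZ_U: "(U \<cdot> Z) \<cdot> U = 0" "(U \<cdot> Z) \<cdot> c \<cdot> U = 0"
proof -
  show 1: "(U \<cdot> Z) \<cdot> U = 0"
    using antisym_Ev[of "U \<cdot> Z" U] by (simp add: U_U r11)
  show "(U \<cdot> Z) \<cdot> c \<cdot> U = 0" by (simp add: 1 flip: c_UZ_z)
qed

lemma UZ_X: "(U \<cdot> Z) \<cdot> X = (-4) *s c \<cdot> Z" "(U \<cdot> Z) \<cdot> c \<cdot> X = (-4) *s Z"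
proof -
  show 1: "(U \<cdot> Z) \<cdot> X = (-4) *s c \<cdot> Z"
    using antisym_Ev[of "U \<cdot> Z" X] by (simp add: X_U_Z)
  show "(U \<cdot> Z) \<cdot> c \<cdot> X = (-4) *s Z" by (simp add: 1 br_simps c_c_Z flip: c_UZ_z)
qed

lemma c_up: "c \<cdot> c \<cdot> a = a \<Longrightarrow> c \<cdot> up a = up a" "c \<cdot> c \<cdot> a = a \<Longrightarrow> c \<cdot> um a = - um a"
  by (rule vec_eqI, simp add: up_def um_def br_simps dual_simps field_simps)+

lemma up_um: "a = up a + um a"
  by (rule vec_eqI) (simp add: up_def um_def dual_simps field_simps)

lemma c_c: "c \<cdot> c = 0"
  by (rule self_br_Ev) simp

lemma UU_split: "up U \<cdot> up U = 0" "um U \<cdot> um U = 0" "up U \<cdot> um U = - Y"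
proof -
  have 1: "c \<cdot> U \<cdot> U = 0" by (simp add: r05 br_simps c_Y)
  have 2: "(c \<cdot> U) \<cdot> U = 0" using r06 sym_Od[of U "X \<cdot> Y"] by (simp add: c_U br_simps)
  show "up U \<cdot> up U = 0" "um U \<cdot> um U = 0" "up U \<cdot> um U = - Y"
    by (simp_all add: degree_split[OF c_c_U c_c_U 1] 2 r05)
qed

lemma UX_split: "up U \<cdot> up X = 0" "um U \<cdot> um X = 0"
  "2 *s up U \<cdot> um X = c - e \<cdot> Y" "2 *s um U \<cdot> up X = c + e \<cdot> Y"
proof -
  have UX: "U \<cdot> X = c" using sym_Od[of X U] by (simp add: c_def)
  then have 1: "c \<cdot> U \<cdot> X = 0" by (simp add: c_c)
  have 2: "(c \<cdot> U) \<cdot> X = - (e \<cdot> Y)" using sym_Od[of X "X \<cdot> Y"] by (simp add: c_U br_simps X_X)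
  show "up U \<cdot> up X = 0" "um U \<cdot> um X = 0"
    "2 *s up U \<cdot> um X = c - e \<cdot> Y" "2 *s um U \<cdot> up X = c + e \<cdot> Y"
    by (simp_all add: degree_split[OF c_c_U c_c_X 1] 2 UX)
qed

lemma XX_split: "up X \<cdot> up X = 0" "um X \<cdot> um X = 0"
proof -
  have "2 *s e = X \<cdot> X" by (simp add: e_def)
  then have 1: "c \<cdot> X \<cdot> X = 0" by (simp add: br_simps c_e flip: \<open>2 *s e = X \<cdot> X\<close>)
  show "up X \<cdot> up X = 0" "um X \<cdot> um X = 0"
    by (simp_all add: degree_split[OF c_c_X c_c_X 1])
qed

lemma ZU_split: "up Z \<cdot> um U = (1/2) *s U \<cdot> Z"
proof -
  have UZ: "Z \<cdot> U = U \<cdot> Z" by (rule sym_Od) simp_all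
  have 1: "c \<cdot> Z \<cdot> U = 0" by (simp add: UZ c_UZ)
  have 2: "(c \<cdot> Z) \<cdot> U = 0" using U_c_Z sym_Od[of U "c \<cdot> Z"] by simp
  show ?thesis by (simp add: degree_split[OF c_c_Z c_c_U 1] 2 UZ)
qed

lemma y_simps: "y \<cdot> up U = 0" "y \<cdot> um U = 0" "y \<cdot> up X = (- 1 / t) *s up Z" "y \<cdot> um X = (1 / t) *s um Z"
  by (rule vec_eqI, simp add: y_def up_def um_def br_simps UZ_U UZ_X dual_simps t field_simps)+

lemma ft_y: "ft \<cdot> y = 0"
  using jacobi_Ev[OF Y_Ev, of U Z] by (simp add: ft_def y_def br_simps r04 r11 r24)

lemma lie_core: "lie_core scale br Ev Od e Y ft \<mu> (up U) (um U) c y"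
proof -
  have "Y \<cdot> Y = 0" by (rule self_br_Ev) simp
  then have Y_ft: "Y \<cdot> ft = 0" by (simp add: ft_def br_simps Y_Z1)
  interpret T: sl2_triple_pair scale br Ev Od e Y ft \<mu>
    by unfold_locales (simp_all add: H_simps H_e H_ft e3_ft ft_e_ft Y_ft)
  have vac: "T.vac (up U)" "T.vac (um U)"
    by (simp_all only: T.vac_def T.H_def Y_upU H_upU e_e_upU e_upU br_minus)
      (simp_all add: e_upX ft_upX ft_upU br_simps)
  have s: "up U \<cdot> up Z = 0" "um U \<cdot> um Z = 0" "up X \<cdot> up Z = 0" "um X \<cdot> um Z = 0"
    by (simp_all add: degree_split[OF c_c_U c_c_Z c_UZ] degree_split[OF c_c_X c_c_Z c_Z1])
  have c_ft: "c \<cdot> ft = 0" "c \<cdot> y = 0" by (simp_all add: ft_def y_def br_simps c_Y c_Z1 c_UZ)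
  have y: "2 *s y = (ft \<cdot> up U) \<cdot> um U"
    by (simp add: ft_upU br_simps ZU_split y_def)
  have v: "2 *s um U \<cdot> e \<cdot> up U = - c - T.H"
    by (simp add: e_upU br_simps UX_split T.H_def)
  have u: "2 *s up U \<cdot> e \<cdot> um U = c - T.H"
    by (simp add: e_upU br_simps UX_split T.H_def)
  show ?thesis
    by unfold_locales (simp_all only: u v y, simp_all add: vac e_upX c_up c_c_U c_e c_Y c_ft UU_split UX_split XX_split e_upU s ft_upU y_simps
      T.H_def ft_y br_simps)
qed

lemma gens_subalg:
  "{X, Y, Z, U} \<subseteq> subalg {up U, e \<cdot> up U, um U, e \<cdot> um U, ft \<cdot> up U, ft \<cdot> um U, Y}" (is "_ \<subseteq> subalg ?B")
proof -
  have "X = (-1) *s e \<cdot> up U + e \<cdot> um U" "Z = t *s ft \<cdot> up U + (- t) *s ft \<cdot> um U"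
    using up_um[of X] up_um[of Z] t by (simp_all add: e_upU ft_upU)
  moreover have "(-1) *s e \<cdot> up U + e \<cdot> um U \<in> subalg ?B" "t *s ft \<cdot> up U + (- t) *s ft \<cdot> um U \<in> subalg ?B"
    "up U + um U \<in> subalg ?B" "Y \<in> subalg ?B"
    by (intro subalg.add subalg.scale subalg.base; simp)+
  ultimately show ?thesis using up_um[of U] by simp
qed

end

section \<open>Differential operators on polynomials in an even and an odd variable\<close>

definition sc :: "complex \<Rightarrow> sv \<Rightarrow> sv" where
  "sc k v = (smult k (fst v), smult k (snd v))"

lemma sc_Pair: "sc k (p, q) = (smult k p, smult k q)"
  by (simp add: sc_def)

lemma sc_simps: "sc k (v + w) = sc k v + sc k w" "sc k (v - w) = sc k v - sc k w" "sc k (- v) = - sc k v"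
  "sc k 0 = 0" "sc 0 v = 0" "sc 1 v = v" "sc (-1) v = - v" "sc k (sc l v) = sc (k * l) v" "sc (k + l) v = sc k v + sc l v"
  by (simp_all add: sc_def prod_eq_iff smult_add_right smult_diff_right smult_add_left)

lemma op_apply: "add_op F G v = F v + G v" "smul_op k F v = sc k (F v)" "zero_op v = 0"
  by (simp_all add: add_op_def smul_op_def zero_op_def sc_def prod_eq_iff)

definition lin_op :: "op \<Rightarrow> bool" where
  "lin_op F \<longleftrightarrow> (\<forall>v w. F (v + w) = F v + F w) \<and> (\<forall>k v. F (sc k v) = sc k (F v))"

lemma lin_op_simps:
  assumes "lin_op F"
  shows "F (v + w) = F v + F w" "F (sc k v) = sc k (F v)" "F 0 = 0" "F (- v) = - F v" "F (v - w) = F v - F w"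
proof -
  show 1: "F (v + w) = F v + F w" "F (sc k v) = sc k (F v)" for v w k
    using assms unfolding lin_op_def by blast+
  show "F 0 = 0" using 1(2)[of 0 0] by (simp add: sc_simps)
  show 2: "F (- v) = - F v" for v using 1(2)[of "-1" v] by (simp add: sc_simps)
  show "F (v - w) = F v - F w" using 1(1)[of v "- w"] by (simp add: 2)
qed

lemma part_apply: "even_part F v = (fst (F (fst v, 0)), snd (F (0, snd v)))"
  "odd_part F v = (fst (F (0, snd v)), snd (F (fst v, 0)))"
  by (simp_all add: even_part_def odd_part_def split_beta)

lemma lin_op_parts:
  assumes F: "lin_op F"
  shows "lin_op (odd_part F)"
proof -
  have a: "F (0, snd v + snd w) = F (0, snd v) + F (0, snd w)" "F (fst v + fst w, 0) = F (fst v, 0) + F (fst w, 0)" for v w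
    using lin_op_simps(1)[OF F, of "(0, snd v)" "(0, snd w)"] lin_op_simps(1)[OF F, of "(fst v, 0)" "(fst w, 0)"]
    by simp_all
  have s: "F (0, smult k (snd v)) = sc k (F (0, snd v))" "F (smult k (fst v), 0) = sc k (F (fst v, 0))" for k v
    using lin_op_simps(2)[OF F, of k "(0, snd v)"] lin_op_simps(2)[OF F, of k "(fst v, 0)"]
    by (simp_all add: sc_Pair)
  have "odd_part F (v + w) = odd_part F v + odd_part F w" "odd_part F (sc k v) = sc k (odd_part F v)" for v w k
    by (simp_all add: part_apply a sc_def[of k v] s) (simp add: sc_def)
  then show ?thesis unfolding lin_op_def by blast
qed

lemma sbr_apply:
  "sbr F G v = F (G v) - G (F v) + sc 2 (odd_part G (odd_part F v))"
  by (simp add: sbr_def op_apply sc_simps)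

lemma lin_op_sbr:
  assumes F: "lin_op F" and G: "lin_op G"
  shows "lin_op (sbr F G)"
proof -
  note l = lin_op_simps(1,2)[OF F] lin_op_simps(1,2)[OF G]
    lin_op_simps(1,2)[OF lin_op_parts[OF F]] lin_op_simps(1,2)[OF lin_op_parts[OF G]]
  have "sbr F G (v + w) = sbr F G v + sbr F G w" "sbr F G (sc k v) = sc k (sbr F G v)" for v w k
    unfolding sbr_apply l by (simp_all add: sc_simps mult.commute)
  then show ?thesis unfolding lin_op_def by blast
qed

definition parity :: "bool \<Rightarrow> op \<Rightarrow> bool" where
  "parity b F \<longleftrightarrow> (\<forall>p. (if b then fst (F (p, 0)) else snd (F (p, 0))) = 0) \<and>
     (\<forall>q. (if b then snd (F (0, q)) else fst (F (0, q))) = 0)"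

lemma odd_part_parity:
  assumes F: "lin_op F" "parity b F"
  shows "odd_part F v = (if b then F v else 0)"
proof -
  have "v = (fst v, 0) + (0, snd v)" by simp
  then have "F v = F (fst v, 0) + F (0, snd v)" using lin_op_simps(1)[OF F(1)] by metis
  then show ?thesis using F(2) by (auto simp: part_apply parity_def prod_eq_iff)
qed

text \<open>From here on brackets of homogeneous operators are plain commutators or anticommutators,
  and \<open>odd_part\<close> can be forgotten.\<close>

lemma sbr_parity:
  assumes "lin_op F" "lin_op G" "parity b F" "parity d G"
  shows "sbr F G v = (if b \<and> d then F (G v) + G (F v) else F (G v) - G (F v))"
proof -
  have "sc 2 z = z + z" for z using sc_simps(9)[of 1 1 z] by (simp add: sc_simps)
  then show ?thesis
    using lin_op_simps(3)[OF assms(2)]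
    by (auto simp: sbr_apply odd_part_parity[OF assms(1,3)] odd_part_parity[OF assms(2,4)] sc_simps)
qed

lemma parity_comp:
  assumes "parity b F" "parity d G"
  shows "parity (b \<noteq> d) (\<lambda>v. F (G v))"
  using assms by (cases b; cases d; simp add: parity_def; metis prod.collapse)

lemma parity_sbr:
  assumes "lin_op F" "lin_op G" "parity b F" "parity d G"
  shows "parity (b \<noteq> d) (sbr F G)"
  using parity_comp[OF assms(3,4)] parity_comp[OF assms(4,3)]
  unfolding parity_def sbr_parity[OF assms] by (cases b; cases d) auto

declare eval_tree.simps [simp del]

lemma eval_lin_parity: "lin_op (eval_tree lam t w) \<and> parity (par w) (eval_tree lam t w)"
proof (induction w)
  case (Gen g)
  show ?case
    by (cases g) (auto simp: eval_tree.simps lin_op_def parity_def opX_def opY_def opZ_def opU_def sc_def pderiv_add pderiv_smult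
      algebra_simps smult_add_right smult_diff_right mult.commute)
next
  case (Br a b)
  then show ?case using lin_op_sbr parity_sbr unfolding par.simps eval_tree.simps by blast
qed

lemma lin_op_eval: "lin_op (eval_tree lam t w)" and parity_eval: "parity (par w) (eval_tree lam t w)"
  using eval_lin_parity by blast+

lemma eval_Br: "eval_tree lam t (Br a b) v = (if par a \<and> par b
    then eval_tree lam t a (eval_tree lam t b v) + eval_tree lam t b (eval_tree lam t a v)
    else eval_tree lam t a (eval_tree lam t b v) - eval_tree lam t b (eval_tree lam t a v))"
  unfolding eval_tree.simps(5) by (rule sbr_parity) (rule lin_op_eval parity_eval)+

lemma eval_antisym: "eval_tree lam t (Br a b) v + sc (sgn a b) (eval_tree lam t (Br b a) v) = 0"
  by (simp add: eval_Br sgn_def sc_simps)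

lemma eval_jacobi: "eval_tree lam t (Br a (Br b c)) v - eval_tree lam t (Br (Br a b) c) v
   - sc (sgn a b) (eval_tree lam t (Br b (Br a c)) v) = 0"
  by (cases "par a"; cases "par b"; cases "par c")
    (simp_all add: eval_Br sgn_def sc_simps lin_op_simps[OF lin_op_eval])

text \<open>Opaque names for the polynomial \<open>x\<close> and for constants, so that the verification of the
  relations takes place in a differential ring.\<close>

definition xv :: "complex poly" where "xv = [:0, 1:]"
definition cp :: "complex \<Rightarrow> complex poly" where "cp k = [:k:]"

lemma smult_cp: "smult k p = cp k * p"
  by (simp add: cp_def)

lemma cp_simps: "cp (a + b) = cp a + cp b" "cp (a - b) = cp a - cp b" "cp (- a) = - cp a" "cp (a * b) = cp a * cp b"
  "cp 1 = 1" "cp 0 = 0" "cp (numeral n) = numeral n" "cp (a ^ m) = cp a ^ m"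
proof -
  show "cp (a * b) = cp a * cp b" for a b by (simp add: cp_def)
  moreover show "cp 1 = 1" by (simp add: cp_def one_pCons)
  ultimately show "cp (a ^ m) = cp a ^ m" by (induction m) simp_all
qed (simp_all add: cp_def one_pCons numeral_poly)

lemma pderiv_ring_simps: "pderiv xv = 1" "pderiv (cp k) = 0" "pderiv (p * q) = p * pderiv q + q * pderiv p"
  "pderiv (p + q) = pderiv p + pderiv q" "pderiv (p - q) = pderiv p - pderiv (q :: complex poly)" "pderiv (- p) = - pderiv (p :: complex poly)"
  "pderiv 1 = 0" "pderiv (numeral n :: complex poly) = 0" "pderiv (0 :: complex poly) = 0"
proof -
  show "pderiv (numeral n :: complex poly) = 0" by (simp add: numeral_poly pderiv_pCons)
qed (simp_all add: xv_def cp_def pderiv_mult pderiv_add pderiv_diff pderiv_minus pderiv_pCons one_pCons)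

section \<open>The differential operators satisfy the relations\<close>

context
  fixes lam t :: complex
begin

abbreviation "evt \<equiv> eval_tree lam t"
abbreviation "la \<equiv> cp lam"
abbreviation "tt \<equiv> cp t"

lemma eval_gens:
  "evt tX (p, q) = (xv * q, xv * pderiv p - la * p)"
  "evt tY (p, q) = (pderiv p, pderiv q)"
  "evt tZ (p, q) = (tt * pderiv q, - (tt * pderiv (pderiv p)))"
  "evt tU (p, q) = (q, - pderiv p)"
  by (simp_all add: eval_tree.simps opX_def opY_def opZ_def opU_def smult_cp flip: xv_def)

text \<open>The premise \<open>n = Suc m\<close> lets the rule be instantiated with
  numerals.\<close>

lemma adX_step: "n = Suc m \<Longrightarrow> evt (adX n w) v = (if par (adX m w)
    then evt tX (evt (adX m w) v) + evt (adX m w) (evt tX v) else evt tX (evt (adX m w) v) - evt (adX m w) (evt tX v))"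
  by (simp add: adX_def eval_Br)

lemma adX_0: "adX 0 w = w"
  by (simp add: adX_def)

lemma par_adX: "par (adX n w) = (par w = even n)"
  by (induction n) (auto simp: adX_def)

lemmas ev_simps = eval_gens par_adX pderiv_ring_simps power2_eq_square power3_eq_cube algebra_simps

text \<open>Start of a table of the composite operators in the relations; the powers of
  \<open>ad X\<close> are built one from the other, so that no relation is expanded down to the
  generators.\<close>

lemma eval_Y1: "evt (adX (Suc 0) tY) (p, q) = (- q, - pderiv p)"
  by (simp add: adX_step[of _ 0] adX_0 ev_simps)

lemma eval_Y2: "evt (adX 2 tY) (p, q) = (- 2 * xv * pderiv p + la * p, - 2 * xv * pderiv q + (la - 1) * q)"
  by (simp add: adX_step[of 2 "Suc 0"] eval_Y1 ev_simps)

lemma eval_XX: "evt (Br tX tX) (p, q) = (2 * xv * (xv * pderiv p - la * p), 2 * xv * (xv * pderiv q + (1 - la) * q))"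
  by (simp add: eval_Br ev_simps)

lemma eval_XU: "evt (Br tX tU) (p, q) = (- la * p, - (la + 1) * q)"
  by (simp add: eval_Br ev_simps)

lemma eval_UU: "evt (Br tU tU) (p, q) = (- 2 * pderiv p, - 2 * pderiv q)"
  by (simp add: eval_Br ev_simps)

lemma eval_UZ: "evt (Br tU tZ) (p, q) = (- 2 * tt * pderiv (pderiv p), - 2 * tt * pderiv (pderiv q))"
  by (simp add: eval_Br ev_simps)

lemma eval_ZZ: "evt (Br tZ tZ) (p, q) = (- 2 * tt\<^sup>2 * pderiv (pderiv (pderiv p)), - 2 * tt\<^sup>2 * pderiv (pderiv (pderiv q)))"
  by (simp add: eval_Br ev_simps)

lemma eval_Z1: "evt (adX (Suc 0) tZ) (p, q) = (tt * (1 - la) * pderiv p, - tt * (la + 2) * pderiv q)"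
  by (simp add: adX_step[of _ 0] adX_0 ev_simps)

lemma eval_Z2: "evt (adX 2 tZ) (p, q) =
    (- tt * (3 * xv * pderiv q + (1 - la) * q), tt * (3 * xv * pderiv (pderiv p) + 2 * (1 - la) * pderiv p))"
  by (simp add: adX_step[of 2 "Suc 0"] eval_Z1 ev_simps)

lemma eval_Z3: "evt (adX 3 tZ) (p, q) =
    (tt * (1 - la) * (la * p - 2 * xv * pderiv p), tt * (la + 2) * (2 * xv * pderiv q + (1 - la) * q))"
  by (simp add: adX_step[of 3 2] eval_Z2 ev_simps)

lemma eval_Z4: "evt (adX 4 tZ) (p, q) =
    (tt * (6 * xv\<^sup>2 * pderiv q + 4 * (1 - la) * xv * q),
     tt * (2 * la * (1 - la) * p - 6 * xv\<^sup>2 * pderiv (pderiv p) - 8 * (1 - la) * xv * pderiv p))"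
  by (simp add: adX_step[of 4 3] eval_Z3 ev_simps)

lemma eval_Z5: "evt (adX 5 tZ) (p, q) =
    (tt * (1 - la) * (2 * xv\<^sup>2 * pderiv p - 2 * la * xv * p),
     - 2 * tt * (la + 2) * (xv\<^sup>2 * pderiv q + (1 - la) * xv * q))"
  by (simp add: adX_step[of 5 4] eval_Z4 ev_simps)

lemma eval_Z6: "evt (adX 6 tZ) (p, q) =
    (- 6 * tt * (xv ^ 3 * pderiv q + (1 - la) * xv\<^sup>2 * q),
     6 * tt * (xv ^ 3 * pderiv (pderiv p) + 2 * (1 - la) * xv\<^sup>2 * pderiv p - la * (1 - la) * xv * p))"
  by (simp add: adX_step[of 6 5] eval_Z5 ev_simps)

lemma eval_Z7: "evt (adX 7 tZ) (p, q) = (0, 0)"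
  by (simp add: adX_step[of 7 6] eval_Z6 ev_simps)

lemmas eval_table = eval_Y1 eval_Y2 eval_XX eval_XU eval_UU eval_UZ eval_ZZ eval_Z1 eval_Z2 eval_Z3 eval_Z7

text \<open>Works on the list rather than on the support of \<open>lc xs\<close>, where repeated
  trees merge and coefficients may cancel; \<open>Ep_lcx\<close> connects the two.\<close>

definition evl :: "(complex \<times> tree) list \<Rightarrow> sv \<Rightarrow> sv" where
  "evl xs v = (\<Sum>(k, w)\<leftarrow>xs. sc k (evt w v))"

lemma eval_XY: "evt (Br tX tY) = evt (adX (Suc 0) tY)"
  by (simp add: adX_def)

lemma paper_rels_evl:
  shows
    "evl [(1, Br tY (adX 1 tY))] v = 0"
    "evl [(1, Br (adX 2 tY) tY), (-2, tY)] v = 0"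
    "evl [(1, Br (adX 2 tY) tX), (1, tX)] v = 0"
    "evl [(1, Br tY tU)] v = 0"
    "evl [(1, Br tU tU), (2, tY)] v = 0"
    "evl [(1, Br tU (adX 1 tY))] v = 0"
    "evl [(1, Br (Br tX tX) (Br tX tU))] v = 0"
    "evl [(1, Br (adX 2 tY) tU), (-1, tU)] v = 0"
    "evl [(1, Br tY tZ)] v = 0"
    "evl [(1, Br (Br tX tY) tZ)] v = 0"
    "evl [(1, adX 7 tZ)] v = 0"
    "evl [(1, Br (adX 2 tY) tZ), (-3, tZ)] v = 0"
    "evl [(3, Br tZ (Br tX tU)), (-1, Br tU (adX 1 tZ))] v = 0"
    "evl [(1, Br (Br tX tU) (adX 1 tZ))] v = 0"
    "evl [(3, Br tZ (adX 3 tZ)), (2, Br (adX 1 tZ) (adX 2 tZ)), (- 6 * t * (2 * lam + 1), tZ)] v = 0"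
    "evl [(1, Br (adX 1 tZ) (adX 3 tZ)), (- 2 * t^2 * (lam - 1) * (lam + 2), tY), (- 2 * t * (2 * lam + 1), adX 1 tZ)] v = 0"
    "evl [(1, Br tZ (Br tU tZ))] v = 0"
    "evl [(1, Br (adX 1 tZ) (Br tU tZ))] v = 0"
    "evl [(1, Br (adX 1 tZ) (Br tZ tZ))] v = 0"
  by (cases v; simp add: evl_def sc_def smult_cp cp_simps eval_table eval_XY par_adX eval_Br[of lam t _ "adX _ _"] eval_Br[of lam t "adX _ _"] eval_Br[of lam t tY] eval_Br[of lam t tZ]
       eval_Br[of lam t tU] eval_Br[of lam t "Br _ _"] ev_simps zero_prod_def)+

lemma paper_rels_eval:
  assumes "f \<in> paper_rels lam t"
  shows "\<exists>xs. f = lc xs \<and> (\<forall>v. evl xs v = 0)"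
proof -
  have "f \<in> lc ` {xs. \<forall>v. evl xs v = 0}"
    using assms paper_rels_evl unfolding paper_rels_def by (elim insertE emptyE) (blast intro: image_eqI)+
  then show ?thesis by blast
qed

end

section \<open>The quotient of the magma algebra\<close>

text \<open>\<open>P\<close> kills a basis of \<open>I\<close> and fixes the vectors that complete
  it to a basis of the whole space.\<close>

lemma (in vector_space) exists_projection:
  assumes I: "subspace I"
  shows "\<exists>P. Vector_Spaces.linear scale scale P \<and> (\<forall>x. x - P x \<in> I) \<and> (\<forall>x\<in>I. P x = 0)"
proof -
  interpret p: vector_space_pair scale scale ..
  obtain B where B: "B \<subseteq> I" "independent B" "I \<subseteq> span B"
    using maximal_independent_subset[of I] by blast
  define C where "C = extend_basis B"
  have C: "B \<subseteq> C" "independent C" "span C = UNIV"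
    unfolding C_def using B(2) by (simp_all add: extend_basis_superset independent_extend_basis)
  obtain P where P: "Vector_Spaces.linear scale scale P" "\<forall>b\<in>C. P b = (if b \<in> B then 0 else b)"
    using p.linear_independent_extend[OF C(2), of "\<lambda>b. if b \<in> B then 0 else b"] by blast
  interpret P: Vector_Spaces.linear scale scale P by (rule P)
  have "subspace {x. x - P x \<in> I}"
  proof (rule subspaceI)
    show "0 \<in> {x. x - P x \<in> I}" using I by (simp add: P.zero subspace_0)
    fix x y assume "x \<in> {x. x - P x \<in> I}" "y \<in> {x. x - P x \<in> I}"
    then have "(x - P x) + (y - P y) \<in> I" using I by (simp add: subspace_add)
    then show "x + y \<in> {x. x - P x \<in> I}" by (simp add: P.add algebra_simps)
  next
    fix k x assume "x \<in> {x. x - P x \<in> I}"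
    then have "scale k (x - P x) \<in> I" using I by (simp add: subspace_scale)
    then show "scale k x \<in> {x. x - P x \<in> I}" by (simp add: P.scale scale_right_diff_distrib)
  qed
  then have "span C \<subseteq> {x. x - P x \<in> I}"
    using P(2) B(1) I by (intro span_minimal) (auto simp: subspace_0)
  moreover have "subspace {x. P x = 0}"
    by (auto simp: subspace_def P.zero P.add P.scale)
  then have "span B \<subseteq> {x. P x = 0}"
    using P(2) C(1) by (intro span_minimal) auto
  ultimately show ?thesis using P(1) B(3) C(3) by blast
qed

text \<open>Finite support is built into the type, so the whole type is a vector space. On all of
  \<open>mag\<close>, the sum in \<open>ev\<close> over an infinite support would be 0 and linearity
  would fail.\<close>

type_synonym fmag = "tree \<Rightarrow>\<^sub>0 complex"

abbreviation "lk \<equiv> Poly_Mapping.lookup"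
abbreviation "ks \<equiv> Poly_Mapping.keys"

definition pscale :: "complex \<Rightarrow> fmag \<Rightarrow> fmag" where
  "pscale k x = Poly_Mapping.map ((*) k) x"

lemma lookup_pscale [simp]: "lk (pscale k x) w = k * lk x w"
  by (simp add: pscale_def map.rep_eq when_def)

interpretation pm: vector_space pscale
  by unfold_locales (auto intro!: poly_mapping_eqI simp: lookup_add algebra_simps)

abbreviation "sg w \<equiv> Poly_Mapping.single (w :: tree) (1 :: complex)"

lemma pm_span: "pm.span (range sg) = UNIV"
proof -
  have "x \<in> pm.span (range sg)" for x :: fmag
  proof -
    have "x = (\<Sum>w\<in>ks x. pscale (lk x w) (sg w))"
    proof (rule poly_mapping_eqI)
      fix v
      have "lk (\<Sum>w\<in>ks x. pscale (lk x w) (sg w)) v = (\<Sum>w\<in>ks x. if w = v then lk x w else 0)"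
        by (simp add: lookup_sum lookup_single when_def if_distrib cong: if_cong)
      also have "\<dots> = lk x v" by (simp add: sum.delta' in_keys_iff)
      finally show "lk x v = lk (\<Sum>w\<in>ks x. pscale (lk x w) (sg w)) v" ..
    qed
    also have "\<dots> \<in> pm.span (range sg)"
      by (intro pm.span_sum pm.span_scale pm.span_base) auto
    finally show ?thesis .
  qed
  then show ?thesis by auto
qed

lemma mmul_fin_supp:
  assumes "finite {w. f w \<noteq> 0}" "finite {w. g w \<noteq> 0}"
  shows "finite {w. mmul f g w \<noteq> 0}"
proof (rule finite_subset)
  show "{w. mmul f g w \<noteq> 0} \<subseteq> (\<lambda>(a, b). Br a b) ` ({w. f w \<noteq> 0} \<times> {w. g w \<noteq> 0})"
  proof
    fix w assume w: "w \<in> {w. mmul f g w \<noteq> 0}"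
    then obtain a b where "w = Br a b" by (cases w) (auto simp: mmul_def)
    with w show "w \<in> (\<lambda>(a, b). Br a b) ` ({w. f w \<noteq> 0} \<times> {w. g w \<noteq> 0})"
      by (auto simp: mmul_def intro!: image_eqI[of _ _ "(a, b)"])
  qed
qed (use assms in auto)

definition pmul :: "fmag \<Rightarrow> fmag \<Rightarrow> fmag" where
  "pmul x y = Abs_poly_mapping (mmul (lk x) (lk y))"

lemma lookup_pmul: "lk (pmul x y) = mmul (lk x) (lk y)"
  by (simp add: pmul_def mmul_fin_supp)

lemma pmul_simps: "pmul (x + y) z = pmul x z + pmul y z" "pmul x (y + z) = pmul x y + pmul x z"
  "pmul (pscale k x) z = pscale k (pmul x z)" "pmul x (pscale k z) = pscale k (pmul x z)"
  "pmul 0 z = 0" "pmul x 0 = 0" "pmul x (y - z) = pmul x y - pmul x z" "pmul (x - y) z = pmul x z - pmul y z"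
  by (auto intro!: poly_mapping_eqI simp: lookup_pmul mmul_def lookup_add lookup_minus algebra_simps split: tree.split)

lemma pmul_sg: "pmul (sg a) (sg b) = sg (Br a b)"
  by (auto intro!: poly_mapping_eqI simp: lookup_pmul mmul_def lookup_single when_def split: tree.split)

definition lcx :: "(complex \<times> tree) list \<Rightarrow> fmag" where
  "lcx xs = (\<Sum>(k, w)\<leftarrow>xs. pscale k (sg w))"

lemma lookup_lcx: "lk (lcx xs) = lc xs"
proof
  show "lk (lcx xs) v = lc xs v" for v
    by (induction xs) (auto simp: lcx_def lc_def lookup_add lookup_single when_def)
qed

lemma lookup_sg: "lk (sg w) = lc [(1, w)]"
  using lookup_lcx[of "[(1, w)]"] by (simp add: lcx_def)

lemma bilinear_span:
  assumes "pm.subspace V" "\<And>a b. a \<in> A \<Longrightarrow> b \<in> B \<Longrightarrow> h a b \<in> V"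
    and "\<And>x y z. h (x + y) z = h x z + h y z" "\<And>x y z. h x (y + z) = h x y + h x z"
    and "\<And>k x z. h (pscale k x) z = pscale k (h x z)" "\<And>k x z. h x (pscale k z) = pscale k (h x z)"
    and "x \<in> pm.span A" "y \<in> pm.span B"
  shows "h x y \<in> V"
proof -
  have h0: "h 0 z = 0" "h z 0 = 0" for z
    using assms(5)[of 0 0 z] assms(6)[of z 0 0] by simp_all
  have "pm.subspace {y. h a y \<in> V}" for a
    using assms(1) by (auto simp: pm.subspace_def assms(4,6) h0)
  then have "pm.span B \<subseteq> {y. h a y \<in> V}" if "a \<in> A" for a
    using assms(2)[OF that] by (intro pm.span_minimal) auto
  moreover have "pm.subspace {x. h x y \<in> V}"
    using assms(1) by (auto simp: pm.subspace_def assms(3,5) h0)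
  ultimately have "pm.span A \<subseteq> {x. h x y \<in> V}"
    using assms(8) by (intro pm.span_minimal) auto
  then show ?thesis using assms(7) by auto
qed

definition pm_ideal :: "mag set \<Rightarrow> fmag set" where
  "pm_ideal S = {x. lk x \<in> mag_ideal S}"

lemma subspace_pm_ideal: "pm.subspace (pm_ideal S)"
proof (rule pm.subspaceI)
  show "0 \<in> pm_ideal S" using mag_ideal.zero[of S] by (simp add: pm_ideal_def zero_poly_mapping.rep_eq)
  fix x y assume "x \<in> pm_ideal S" "y \<in> pm_ideal S"
  then show "x + y \<in> pm_ideal S"
    using mag_ideal.add[of "lk x" S "lk y"] by (simp add: pm_ideal_def plus_poly_mapping.rep_eq)
next
  fix k x assume "x \<in> pm_ideal S"
  moreover have "lk (pscale k x) = (\<lambda>w. k * lk x w)" by auto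
  ultimately show "pscale k x \<in> pm_ideal S"
    using mag_ideal.smul[of "lk x" S k] by (simp add: pm_ideal_def)
qed

lemma lcx_ideal: "lc xs \<in> S \<Longrightarrow> lcx xs \<in> pm_ideal S"
  by (simp add: pm_ideal_def lookup_lcx mag_ideal.base)

lemma pmul_ideal:
  assumes x: "x \<in> pm_ideal S"
  shows "pmul y x \<in> pm_ideal S" "pmul x y \<in> pm_ideal S"
proof -
  have "pm.subspace {y. pmul y x \<in> pm_ideal S \<and> pmul x y \<in> pm_ideal S}"
    using subspace_pm_ideal[of S] by (auto simp: pm.subspace_def pmul_simps)
  moreover have "pmul (sg w) x \<in> pm_ideal S" "pmul x (sg w) \<in> pm_ideal S" for w
    using x mag_ideal.mull[of "lk x" S w] mag_ideal.mulr[of "lk x" S w]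
    by (simp_all add: pm_ideal_def lookup_pmul lookup_sg)
  ultimately have "pm.span (range sg) \<subseteq> {y. pmul y x \<in> pm_ideal S \<and> pmul x y \<in> pm_ideal S}"
    by (intro pm.span_minimal) auto
  then show "pmul y x \<in> pm_ideal S" "pmul x y \<in> pm_ideal S" unfolding pm_span by auto
qed

text \<open>The quotient of the magma algebra by an ideal is realised on all of \<open>fmag\<close>, with the
  product composed with a linear projection whose kernel is the ideal. Even and odd elements are
  only required to be so modulo the ideal, as the projection need not respect parity.\<close>

locale mag_quotient =
  fixes S :: "mag set" and P :: "fmag \<Rightarrow> fmag"
  assumes S: "lie_super_rels \<subseteq> S"
    and P_lin: "Vector_Spaces.linear pscale pscale P"
    and P_diff: "\<And>x. x - P x \<in> pm_ideal S"
    and P_ideal: "\<And>x. x \<in> pm_ideal S \<Longrightarrow> P x = 0"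
begin

lemma P_simps: "P (x + y) = P x + P y" "P (x - y) = P x - P y" "P (pscale k x) = pscale k (P x)" "P (- x) = - P x" "P 0 = 0"
proof -
  interpret l: Vector_Spaces.linear pscale pscale P by (rule P_lin)
  show "P (x + y) = P x + P y" "P (x - y) = P x - P y" "P (pscale k x) = pscale k (P x)" "P (- x) = - P x" "P 0 = 0"
    by (simp_all add: l.add l.diff l.scale l.neg l.zero)
qed

lemma P_eqI: "x - y \<in> pm_ideal S \<Longrightarrow> P x = P y"
  using P_ideal[of "x - y"] by (simp add: P_simps)

lemma P_zeroD: "P x = 0 \<Longrightarrow> x \<in> pm_ideal S"
  using P_diff[of x] by simp

definition qbr :: "fmag \<Rightarrow> fmag \<Rightarrow> fmag" where "qbr x y = P (pmul x y)"

definition Q :: "bool \<Rightarrow> fmag set" where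
  "Q b = pm.span (sg ` {w. par w = b} \<union> pm_ideal S)"

lemma qbr_P: "qbr (P x) y = qbr x y" "qbr x (P y) = qbr x y"
proof -
  have "pmul x y - pmul (P x) y \<in> pm_ideal S" "pmul x y - pmul x (P y) \<in> pm_ideal S"
    using pmul_ideal[OF P_diff] by (simp_all add: pmul_simps flip: pmul_simps(7,8))
  then show "qbr (P x) y = qbr x y" "qbr x (P y) = qbr x y"
    unfolding qbr_def using P_eqI by metis+
qed

lemma ideal_Q: "x \<in> pm_ideal S \<Longrightarrow> x \<in> Q b"
  unfolding Q_def by (rule pm.span_base) auto

lemma sg_Q: "sg w \<in> Q (par w)"
  unfolding Q_def by (rule pm.span_base) auto

lemma subspace_Q: "pm.subspace (Q b)"
  by (simp add: Q_def)

lemma P_Q: "x \<in> Q b \<Longrightarrow> P x \<in> Q b"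
  using pm.subspace_diff[OF subspace_Q, of x b "x - P x"] ideal_Q[OF P_diff[of x]] by simp

lemma pmul_Q: "x \<in> Q b \<Longrightarrow> y \<in> Q d \<Longrightarrow> pmul x y \<in> Q (b \<noteq> d)"
proof (rule bilinear_span[where h = pmul, OF subspace_Q])
  show "x \<in> Q b \<Longrightarrow> x \<in> pm.span (sg ` {w. par w = b} \<union> pm_ideal S)"
    "y \<in> Q d \<Longrightarrow> y \<in> pm.span (sg ` {w. par w = d} \<union> pm_ideal S)" by (simp_all add: Q_def)
  fix x y assume x: "x \<in> sg ` {w. par w = b} \<union> pm_ideal S" and y: "y \<in> sg ` {w. par w = d} \<union> pm_ideal S"
  then consider v w where "x = sg v" "y = sg w" "par v = b" "par w = d" | "pmul x y \<in> pm_ideal S"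
    using pmul_ideal by blast
  then show "pmul x y \<in> Q (b \<noteq> d)"
  proof cases
    case 1
    then show ?thesis using sg_Q[of "Br v w"] by (simp add: pmul_sg)
  qed (rule ideal_Q)
qed (simp_all add: pmul_simps)

lemma qbr_Q: "x \<in> Q b \<Longrightarrow> y \<in> Q d \<Longrightarrow> qbr x y \<in> Q (b \<noteq> d)"
  unfolding qbr_def by (intro P_Q pmul_Q)

lemma antisym_trees: "pmul (sg a) (sg b) + pscale (sgn a b) (pmul (sg b) (sg a)) \<in> pm_ideal S"
proof -
  have "lc [(1, Br a b), (sgn a b, Br b a)] \<in> S" using S unfolding lie_super_rels_def by blast
  then have "lcx [(1, Br a b), (sgn a b, Br b a)] \<in> pm_ideal S" by (rule lcx_ideal)
  then show ?thesis by (simp add: lcx_def pmul_sg)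
qed

lemma jacobi_trees: "pmul (sg a) (pmul (sg b) (sg c)) - pmul (pmul (sg a) (sg b)) (sg c)
    - pscale (sgn a b) (pmul (sg b) (pmul (sg a) (sg c))) \<in> pm_ideal S"
proof -
  have "lc [(1, Br a (Br b c)), (-1, Br (Br a b) c), (- sgn a b, Br b (Br a c))] \<in> S"
    using S unfolding lie_super_rels_def by blast
  then have "lcx [(1, Br a (Br b c)), (-1, Br (Br a b) c), (- sgn a b, Br b (Br a c))] \<in> pm_ideal S"
    by (rule lcx_ideal)
  then show ?thesis by (simp add: lcx_def pmul_sg algebra_simps)
qed

text \<open>Stated for sets of trees with constant sign, so that it covers both odd against odd and
  even against arbitrary.\<close>

lemma antisym_ideal:
  assumes "x \<in> pm.span (sg ` A \<union> pm_ideal S)" "y \<in> pm.span (sg ` B \<union> pm_ideal S)"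
    and "\<And>a b. a \<in> A \<Longrightarrow> b \<in> B \<Longrightarrow> sgn a b = \<epsilon>"
  shows "pmul x y + pscale \<epsilon> (pmul y x) \<in> pm_ideal S"
proof (rule bilinear_span[where h = "\<lambda>x y. pmul x y + pscale \<epsilon> (pmul y x)", OF subspace_pm_ideal _ _ _ _ _ assms(1,2)])
  fix x y assume "x \<in> sg ` A \<union> pm_ideal S" "y \<in> sg ` B \<union> pm_ideal S"
  then consider a b where "x = sg a" "y = sg b" "a \<in> A" "b \<in> B" | "x \<in> pm_ideal S \<or> y \<in> pm_ideal S" by blast
  then show "pmul x y + pscale \<epsilon> (pmul y x) \<in> pm_ideal S"
  proof cases
    case 1 then show ?thesis using antisym_trees[of a b] assms(3)[of a b] by simp
  next
    case 2 then show ?thesis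
      using pmul_ideal pm.subspace_add[OF subspace_pm_ideal] pm.subspace_scale[OF subspace_pm_ideal] by blast
  qed
qed (simp_all add: pmul_simps algebra_simps)

definition jac :: "complex \<Rightarrow> fmag \<Rightarrow> fmag \<Rightarrow> fmag \<Rightarrow> fmag" where
  "jac \<epsilon> x y z = pmul x (pmul y z) - pmul (pmul x y) z - pscale \<epsilon> (pmul y (pmul x z))"

lemma jac_simps: "jac \<epsilon> (x + x') y z = jac \<epsilon> x y z + jac \<epsilon> x' y z" "jac \<epsilon> x (y + y') z = jac \<epsilon> x y z + jac \<epsilon> x y' z"
  "jac \<epsilon> x y (z + z') = jac \<epsilon> x y z + jac \<epsilon> x y z'" "jac \<epsilon> (pscale k x) y z = pscale k (jac \<epsilon> x y z)"
  "jac \<epsilon> x (pscale k y) z = pscale k (jac \<epsilon> x y z)" "jac \<epsilon> x y (pscale k z) = pscale k (jac \<epsilon> x y z)" "jac \<epsilon> x y 0 = 0"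
  by (simp_all add: jac_def pmul_simps algebra_simps)

lemma jac_ideal:
  assumes "x \<in> pm.span (sg ` A \<union> pm_ideal S)" "y \<in> pm.span (sg ` B \<union> pm_ideal S)"
    and \<epsilon>: "\<And>a b. a \<in> A \<Longrightarrow> b \<in> B \<Longrightarrow> sgn a b = \<epsilon>"
  shows "jac \<epsilon> x y z \<in> pm_ideal S"
proof -
  have I: "jac \<epsilon> x y z \<in> pm_ideal S" if "x \<in> pm_ideal S \<or> y \<in> pm_ideal S" for x y z
    unfolding jac_def using that
    by (elim disjE) (intro pm.subspace_diff[OF subspace_pm_ideal] pm.subspace_scale[OF subspace_pm_ideal];
      simp add: pmul_ideal)+
  have z: "jac \<epsilon> x y (sg c) \<in> pm_ideal S" for c
  proof (rule bilinear_span[where h = "\<lambda>x y. jac \<epsilon> x y (sg c)", OF subspace_pm_ideal _ _ _ _ _ assms(1,2)])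
    fix x y assume "x \<in> sg ` A \<union> pm_ideal S" "y \<in> sg ` B \<union> pm_ideal S"
    then consider a b where "x = sg a" "y = sg b" "a \<in> A" "b \<in> B" | "x \<in> pm_ideal S \<or> y \<in> pm_ideal S" by blast
    then show "jac \<epsilon> x y (sg c) \<in> pm_ideal S"
    proof cases
      case 1 then show ?thesis using jacobi_trees[of a b c] \<epsilon>[of a b] by (simp add: jac_def)
    qed (rule I)
  qed (simp_all add: jac_simps)
  have "pm.subspace {z. jac \<epsilon> x y z \<in> pm_ideal S}"
    using subspace_pm_ideal[of S] by (auto simp: pm.subspace_def jac_simps)
  then have "pm.span (range sg) \<subseteq> {z. jac \<epsilon> x y z \<in> pm_ideal S}"
    using z by (intro pm.span_minimal) auto
  then show ?thesis unfolding pm_span by auto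
qed

lemma qbr_jac:
  assumes "jac \<epsilon> x y z \<in> pm_ideal S"
  shows "qbr x (qbr y z) = qbr (qbr x y) z + pscale \<epsilon> (qbr y (qbr x z))"
proof -
  have "P (pmul x (pmul y z)) - P (pmul (pmul x y) z) - pscale \<epsilon> (P (pmul y (pmul x z))) = 0"
    using P_ideal[OF assms] by (simp add: jac_def P_simps)
  moreover have "qbr a (qbr b d) = P (pmul a (pmul b d))" "qbr (qbr a b) d = P (pmul (pmul a b) d)" for a b d
    unfolding qbr_def[of b d] qbr_def[of a b] qbr_P by (simp_all add: qbr_def)
  ultimately show ?thesis by (simp add: algebra_simps)
qed

lemma span_all: "y \<in> pm.span (sg ` UNIV \<union> pm_ideal S)"
proof -
  have "pm.span (range sg) \<subseteq> pm.span (sg ` UNIV \<union> pm_ideal S)" by (intro pm.span_mono) auto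
  then show ?thesis by (auto simp: pm_span)
qed

lemma lie_superalgebra: "lie_superalgebra pscale qbr (Q False) (Q True)"
proof unfold_locales
  fix x y z :: fmag and k
  show "qbr (x + y) z = qbr x z + qbr y z" "qbr x (y + z) = qbr x y + qbr x z"
    "qbr (pscale k x) z = pscale k (qbr x z)" "qbr x (pscale k z) = pscale k (qbr x z)"
    by (simp_all add: qbr_def pmul_simps P_simps)
  show "pm.subspace (Q False)" "pm.subspace (Q True)" by (rule subspace_Q)+
  show "x \<in> Q False \<Longrightarrow> y \<in> Q False \<Longrightarrow> qbr x y \<in> Q False"
    "x \<in> Q False \<Longrightarrow> y \<in> Q True \<Longrightarrow> qbr x y \<in> Q True"
    "x \<in> Q True \<Longrightarrow> y \<in> Q True \<Longrightarrow> qbr x y \<in> Q False"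
    using qbr_Q[of x _ y] by fastforce+
  have ev: "sgn a b = 1" if "a \<in> {w. par w = False}" for a b using that by (simp add: sgn_def)
  have od: "sgn a b = -1" if "a \<in> {w. par w = True}" "b \<in> {w. par w = True}" for a b using that by (simp add: sgn_def)
  show "qbr y x = - qbr x y" if "x \<in> Q False"
  proof -
    have "pmul x y + pscale 1 (pmul y x) \<in> pm_ideal S"
      using antisym_ideal[OF _ span_all ev] that unfolding Q_def by blast
    from P_ideal[OF this] show ?thesis by (simp add: qbr_def P_simps eq_neg_iff_add_eq_0 add.commute)
  qed
  show "qbr y x = qbr x y" if "x \<in> Q True" "y \<in> Q True"
  proof -
    have "pmul x y + pscale (-1) (pmul y x) \<in> pm_ideal S"
      using antisym_ideal[OF _ _ od] that unfolding Q_def by blast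
    from P_ideal[OF this] show ?thesis by (simp add: qbr_def P_simps)
  qed
  show "qbr x (qbr y z) = qbr (qbr x y) z + qbr y (qbr x z)" if "x \<in> Q False"
    using qbr_jac[of 1 x y z] jac_ideal[OF _ span_all ev] that unfolding Q_def by auto
  show "qbr x (qbr y z) = qbr (qbr x y) z - qbr y (qbr x z)" if "x \<in> Q True" "y \<in> Q True"
    using qbr_jac[OF jac_ideal[OF that[unfolded Q_def] od], of z] by simp
qed

definition "\<tau> w = P (sg w)"

lemma \<tau>_Br: "\<tau> (Br a b) = qbr (\<tau> a) (\<tau> b)"
  unfolding \<tau>_def qbr_P by (simp add: qbr_def pmul_sg)

lemma \<tau>_Q: "\<tau> w \<in> Q (par w)"
  unfolding \<tau>_def by (intro P_Q sg_Q)

lemma \<tau>_rel: "lc xs \<in> S \<Longrightarrow> (\<Sum>(k, w)\<leftarrow>xs. pscale k (\<tau> w)) = 0"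
proof -
  have "(\<Sum>(k, w)\<leftarrow>xs. pscale k (\<tau> w)) = P (lcx xs)"
    by (induction xs) (auto simp: lcx_def \<tau>_def P_simps)
  then show "lc xs \<in> S \<Longrightarrow> (\<Sum>(k, w)\<leftarrow>xs. pscale k (\<tau> w)) = 0"
    using lcx_ideal P_ideal by simp
qed

end

section \<open>Evaluation of the magma algebra, and the ideal inside its kernel\<close>

context
  fixes lam t :: complex
begin

definition Ep :: "fmag \<Rightarrow> op" where
  "Ep x v = (\<Sum>w\<in>ks x. sc (lk x w) (eval_tree lam t w v))"

lemma ev_lookup: "ev lam t (lk x) = Ep x"
proof
  show "ev lam t (lk x) v = Ep x v" for v
    by (simp add: ev_def Ep_def sc_def sum_prod flip: keys.rep_eq)
qed

lemma Ep_superset: "finite A \<Longrightarrow> ks x \<subseteq> A \<Longrightarrow> Ep x v = (\<Sum>w\<in>A. sc (lk x w) (eval_tree lam t w v))"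
  unfolding Ep_def by (rule sum.mono_neutral_left) (auto simp: in_keys_iff sc_simps)

lemma Ep_simps: "Ep (x + y) v = Ep x v + Ep y v" "Ep (pscale k x) v = sc k (Ep x v)" "Ep 0 v = 0" "Ep (sg w) v = eval_tree lam t w v"
  "Ep (- x) v = - Ep x v" "Ep (x - y) v = Ep x v - Ep y v"
proof -
  show 1: "Ep (x + y) v = Ep x v + Ep y v" for x y
  proof -
    let ?A = "ks x \<union> ks y"
    have "Ep (x + y) v = (\<Sum>w\<in>?A. sc (lk (x + y) w) (eval_tree lam t w v))"
      by (rule Ep_superset) (use keys_add[of x y] in auto)
    also have "\<dots> = Ep x v + Ep y v"
      by (simp add: lookup_add sc_simps sum.distrib flip: Ep_superset)
    finally show ?thesis .
  qed
  show 2: "Ep (pscale k x) v = sc k (Ep x v)" for k x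
  proof -
    have "Ep (pscale k x) v = (\<Sum>w\<in>ks x. sc (lk (pscale k x) w) (eval_tree lam t w v))"
      by (rule Ep_superset) (auto simp: in_keys_iff)
    also have "\<dots> = sc k (Ep x v)"
      unfolding Ep_def by (induction rule: infinite_finite_induct[of _ "ks x"]) (simp_all add: sc_simps)
    finally show ?thesis .
  qed
  show "Ep 0 v = 0" "Ep (sg w) v = eval_tree lam t w v" by (simp_all add: Ep_def sc_simps)
  have "- x = pscale (-1) x" for x by simp
  then show 3: "Ep (- x) v = - Ep x v" for x using 2[of "-1" x] by (simp add: sc_simps)
  show "Ep (x - y) v = Ep x v - Ep y v" using 1[of x "- y"] by (simp add: 3)
qed

lemma fmag_induct:
  assumes "\<And>w. R (sg w)" "\<And>x y. R x \<Longrightarrow> R y \<Longrightarrow> R (x + y)" "\<And>k x. R x \<Longrightarrow> R (pscale k x)"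
  shows "R x"
proof -
  have "R 0" using assms(3)[OF assms(1), of 0] by simp
  then have "pm.subspace {x. R x}" using assms(2,3) by (auto simp: pm.subspace_def)
  then have "pm.span (range sg) \<subseteq> {x. R x}" using assms(1) by (intro pm.span_minimal) auto
  then show ?thesis by (auto simp: pm_span)
qed

lemma lin_op_Ep: "lin_op (Ep x)"
proof (induction x rule: fmag_induct)
  case (1 w)
  have "Ep (sg w) = eval_tree lam t w" by (rule ext) (rule Ep_simps)
  then show ?case by (simp add: lin_op_eval)
next
  case (2 x y)
  then show ?case unfolding lin_op_def Ep_simps by (metis (no_types, lifting) add.assoc add.commute sc_simps(1))
next
  case (3 k x)
  then show ?case unfolding lin_op_def Ep_simps by (metis mult.commute sc_simps(1) sc_simps(8))
qed

lemma odd_part_Ep: "odd_part (Ep (x + y)) v = odd_part (Ep x) v + odd_part (Ep y) v"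
  "odd_part (Ep (pscale k x)) v = sc k (odd_part (Ep x) v)"
  by (simp_all add: part_apply Ep_simps sc_def)

text \<open>\<open>sbr\<close> is bilinear on linear operators, so the identity extends from trees
  to all elements, one argument at a time.\<close>

lemma Ep_pmul: "Ep (pmul x y) v = sbr (Ep x) (Ep y) v"
proof -
  note lin = lin_op_simps[OF lin_op_Ep] lin_op_simps[OF lin_op_parts[OF lin_op_Ep]]
  have sgE: "Ep (sg w) = eval_tree lam t w" for w by (rule ext) (rule Ep_simps)
  have 1: "Ep (pmul (sg a) (sg b)) v = sbr (Ep (sg a)) (Ep (sg b)) v" for a b v
    by (simp only: pmul_sg sgE eval_tree.simps)
  have 2: "Ep (pmul (sg a) y) v = sbr (Ep (sg a)) (Ep y) v" for a y v
    by (induction y arbitrary: v rule: fmag_induct)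
      (simp_all add: 1 pmul_simps Ep_simps(1,2) sbr_apply odd_part_Ep lin sc_simps mult.commute)
  show ?thesis
    by (induction x arbitrary: v rule: fmag_induct)
      (simp_all add: 2 pmul_simps Ep_simps(1,2) sbr_apply odd_part_Ep lin sc_simps mult.commute)
qed

lemma Ep_lcx: "Ep (lcx xs) v = evl lam t xs v"
  by (induction xs) (auto simp: lcx_def evl_def Ep_simps)

lemma sbr_zero:
  assumes F: "lin_op F" and G: "\<And>v. G v = 0"
  shows "sbr F G v = 0" "sbr G F v = 0"
proof -
  have "odd_part G v = 0" for v by (simp add: part_apply G zero_prod_def)
  then show "sbr F G v = 0" "sbr G F v = 0"
    using lin_op_simps(3)[OF F] lin_op_simps(3)[OF lin_op_parts[OF F]]
    by (simp_all add: sbr_apply G sc_simps)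
qed

text \<open>The witness \<open>x\<close> also records that members of the ideal have finite support,
  where evaluation is linear.\<close>

lemma mag_ideal_kernel:
  "f \<in> mag_ideal (lie_super_rels \<union> paper_rels lam t) \<Longrightarrow> \<exists>x. f = lk x \<and> (\<forall>v. Ep x v = 0)"
proof (induction rule: mag_ideal.induct)
  case (base r)
  have "\<exists>xs. r = lc xs \<and> (\<forall>v. evl lam t xs v = 0)"
    using base
  proof
    assume "r \<in> lie_super_rels"
    then consider a b where "r = lc [(1, Br a b), (sgn a b, Br b a)]"
      | a b c where "r = lc [(1, Br a (Br b c)), (-1, Br (Br a b) c), (- sgn a b, Br b (Br a c))]"
      by (auto simp: lie_super_rels_def)
    then show ?thesis
    proof cases
      case 1 then show ?thesis
        by (intro exI conjI) (assumption, simp add: evl_def eval_antisym sc_simps)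
    next
      case (2 a b c)
      have "sc (- k) v = - sc k v" for k v by (simp add: sc_def)
      then have "evl lam t [(1, Br a (Br b c)), (-1, Br (Br a b) c), (- sgn a b, Br b (Br a c))] v = 0" for v
        using eval_jacobi[of lam t a b c v] by (simp add: evl_def sc_simps algebra_simps)
      then show ?thesis using 2 by blast
    qed
  qed (rule paper_rels_eval)
  then show ?case using Ep_lcx lookup_lcx by metis
next
  case zero
  show ?case by (rule exI[of _ 0]) (simp add: Ep_simps zero_poly_mapping.rep_eq)
next
  case (add a b)
  then obtain x y where "a = lk x" "\<forall>v. Ep x v = 0" "b = lk y" "\<forall>v. Ep y v = 0" by blast
  then show ?case by (intro exI[of _ "x + y"]) (simp add: Ep_simps plus_poly_mapping.rep_eq)
next
  case (smul a c)
  then obtain x where "a = lk x" "\<forall>v. Ep x v = 0" by blast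
  then show ?case by (intro exI[of _ "pscale c x"]) (auto simp: Ep_simps sc_simps)
next
  case (mull a u)
  then obtain x where x: "a = lk x" "\<forall>v. Ep x v = 0" by blast
  then have "Ep (pmul (sg u) x) v = 0" for v
    unfolding Ep_pmul by (intro sbr_zero lin_op_Ep) blast
  then show ?case
    by (intro exI[of _ "pmul (sg u) x"]) (simp add: x lookup_pmul lookup_sg)
next
  case (mulr a u)
  then obtain x where x: "a = lk x" "\<forall>v. Ep x v = 0" by blast
  then have "Ep (pmul x (sg u)) v = 0" for v
    unfolding Ep_pmul by (intro sbr_zero lin_op_Ep) blast
  then show ?case
    by (intro exI[of _ "pmul x (sg u)"]) (simp add: x lookup_pmul lookup_sg)
qed

lemma Ep_sl_gen: "Ep x \<in> sl_gen lam t"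
proof (induction x rule: fmag_induct)
  case (1 w)
  have "eval_tree lam t w \<in> sl_gen lam t"
  proof (induction w)
    case (Gen g) then show ?case by (cases g) (auto simp: eval_tree.simps intro: sl_gen.intros)
  qed (auto simp: eval_tree.simps intro: sl_gen.intros)
  moreover have "Ep (sg w) = eval_tree lam t w" by (rule ext) (rule Ep_simps)
  ultimately show ?case by simp
next
  case (2 x y)
  moreover have "Ep (x + y) = add_op (Ep x) (Ep y)" by (rule ext) (simp add: Ep_simps op_apply)
  ultimately show ?case by (simp add: sl_gen.add)
next
  case (3 k x)
  moreover have "Ep (pscale k x) = smul_op k (Ep x)" by (rule ext) (simp add: Ep_simps op_apply)
  ultimately show ?case by (simp add: sl_gen.smul)
qed

lemma sl_gen_Ep: "F \<in> sl_gen lam t \<Longrightarrow> \<exists>x. F = Ep x"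
proof (induction rule: sl_gen.induct)
  have g: "Ep (sg (Gen g)) = eval_tree lam t (Gen g)" for g by (rule ext) (rule Ep_simps)
  case gX then show ?case using g[of GX] by (metis eval_tree.simps(1))
  case gY then show ?case using g[of GY] by (metis eval_tree.simps(2))
  case gZ then show ?case using g[of GZ] by (metis eval_tree.simps(3))
  case gU then show ?case using g[of GU] by (metis eval_tree.simps(4))
next
  case zero show ?case by (rule exI[of _ 0]) (auto simp: Ep_simps op_apply)
next
  case (add F G)
  then obtain x y where "F = Ep x" "G = Ep y" by blast
  then show ?case by (intro exI[of _ "x + y"]) (auto simp: Ep_simps op_apply)
next
  case (smul F k)
  then obtain x where "F = Ep x" by blast
  then show ?case by (intro exI[of _ "pscale k x"]) (auto simp: Ep_simps op_apply)
next
  case (br F G)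
  then obtain x y where "F = Ep x" "G = Ep y" by blast
  then show ?case by (intro exI[of _ "pmul x y"]) (auto simp: Ep_pmul)
qed

lemma Ep_pmul_parity:
  assumes "parity b (Ep x)" "parity d (Ep z)"
  shows "Ep (pmul x z) v = (if b \<and> d then Ep x (Ep z v) + Ep z (Ep x v) else Ep x (Ep z v) - Ep z (Ep x v))"
  unfolding Ep_pmul by (rule sbr_parity[OF lin_op_Ep lin_op_Ep assms])

end

text \<open>The factor \<open>Suc n\<close> from commuting a power of the derivative with
  multiplication by \<open>xv\<close> is the source of \<open>\<kappa> n\<close>.\<close>

lemma pderiv_funpow_x: "(pderiv ^^ Suc n) (xv * q) = xv * (pderiv ^^ Suc n) q + of_nat (Suc n) * (pderiv ^^ n) q"
proof (induction n)
  case 0 then show ?case by (simp add: pderiv_ring_simps)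
next
  case (Suc n)
  have "pderiv (of_nat m :: complex poly) = 0" for m by (induction m) (simp_all add: pderiv_add)
  then have "pderiv ((pderiv ^^ Suc n) (xv * q)) = xv * (pderiv ^^ Suc (Suc n)) q + (pderiv ^^ Suc n) q
      + of_nat (Suc n) * (pderiv ^^ Suc n) q"
    unfolding Suc by (simp add: pderiv_ring_simps del: of_nat_Suc)
  then show ?case by (simp add: algebra_simps)
qed

lemma pderiv_funpow_linear: "(pderiv ^^ n) (p + q) = (pderiv ^^ n) p + (pderiv ^^ n) q"
  "(pderiv ^^ n) (- p) = - (pderiv ^^ n) (p :: complex poly)" "(pderiv ^^ n) (0 :: complex poly) = 0"
  by (induction n) (simp_all add: pderiv_add pderiv_minus)

text \<open>Evaluating at the powers of \<open>x\<close> shows that the powers of the derivative are independent.\<close>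
lemma pderiv_powers_independent:
  assumes "\<And>q. (\<Sum>n<N. smult (k n) ((pderiv ^^ n) q)) = (0 :: complex poly)" "m < N"
  shows "k m = 0"
proof -
  have *: "coeff ((pderiv ^^ n) (monom 1 m)) 0 = (if n = m then fact m else 0 :: complex)" for n
    by (simp add: coeff_higher_pderiv pochhammer_fact)
  have "coeff (\<Sum>n<N. smult (k n) ((pderiv ^^ n) (monom 1 m))) 0 = (\<Sum>n<N. if n = m then k n * fact m else 0)"
    unfolding coeff_sum coeff_smult * by (intro sum.cong) simp_all
  also have "\<dots> = k m * fact m" using assms(2) by simp
  finally show ?thesis unfolding assms(1) by simp
qed

section \<open>The kernel of the evaluation lies in the ideal\<close>

lemma presentation_kernel:
  fixes lam t :: complex
  assumes t: "t \<noteq> 0" and x: "\<And>v. Ep lam t x v = 0"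
  shows "lk x \<in> mag_ideal (lie_super_rels \<union> paper_rels lam t)"
proof -
  define S where "S = lie_super_rels \<union> paper_rels lam t"
  obtain P where P: "Vector_Spaces.linear pscale pscale P" "\<forall>x. x - P x \<in> pm_ideal S" "\<forall>x\<in>pm_ideal S. P x = 0"
    using pm.exists_projection[OF subspace_pm_ideal[of S]] by blast
  interpret q: mag_quotient S P
    using P by (intro mag_quotient.intro) (auto simp: S_def)
  interpret L: lie_superalgebra pscale q.qbr "q.Q False" "q.Q True"
    by (rule q.lie_superalgebra)
  define X Y Z U where "X = q.\<tau> tX" and "Y = q.\<tau> tY" and "Z = q.\<tau> tZ" and "U = q.\<tau> tU"
  note gens = X_def[symmetric] Y_def[symmetric] Z_def[symmetric] U_def[symmetric]
  have rel: "(\<Sum>(k, w)\<leftarrow>xs. pscale k (q.\<tau> w)) = 0" if "lc xs \<in> paper_rels lam t" for xs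
    using q.\<tau>_rel that by (simp add: S_def)
  have adX: "adX 1 w = Br tX w" "adX 2 w = Br tX (Br tX w)" "adX 3 w = Br tX (Br tX (Br tX w))"
    "adX 7 w = Br tX (Br tX (Br tX (Br tX (Br tX (Br tX (Br tX w))))))" for w
    by (simp_all add: adX_def numeral_eq_Suc)
  note rels = rel[unfolded paper_rels_def adX]
  interpret L: sl_presentation pscale q.qbr "q.Q False" "q.Q True" X Y Z U lam t
  proof unfold_locales
    show "X \<in> q.Q True" "Y \<in> q.Q False" "Z \<in> q.Q True" "U \<in> q.Q True" "t \<noteq> 0"
      using q.\<tau>_Q[of tX] q.\<tau>_Q[of tY] q.\<tau>_Q[of tZ] q.\<tau>_Q[of tU] t by (simp_all add: gens)
    note [simp] = q.\<tau>_Br gens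
    show "q.qbr (q.qbr X (q.qbr X Y)) Y = pscale 2 Y"
      using rels[of "[(1, Br (Br tX (Br tX tY)) tY), (-2, tY)]"] by simp
    show "q.qbr (q.qbr X (q.qbr X Y)) X = - X"
      using rels[of "[(1, Br (Br tX (Br tX tY)) tX), (1, tX)]"] by (simp add: eq_neg_iff_add_eq_0)
    show "q.qbr Y U = 0"
      using rels[of "[(1, Br tY tU)]"] by simp
    show "q.qbr U U = pscale (-2) Y"
      using rels[of "[(1, Br tU tU), (2, tY)]"] by (simp add: eq_neg_iff_add_eq_0)
    show "q.qbr U (q.qbr X Y) = 0"
      using rels[of "[(1, Br tU (Br tX tY))]"] by simp
    show "q.qbr (q.qbr X X) (q.qbr X U) = 0"
      using rels[of "[(1, Br (Br tX tX) (Br tX tU))]"] by simp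
    show "q.qbr (q.qbr X (q.qbr X Y)) U = U"
      using rels[of "[(1, Br (Br tX (Br tX tY)) tU), (-1, tU)]"] by simp
    show "q.qbr Y Z = 0"
      using rels[of "[(1, Br tY tZ)]"] by simp
    show "q.qbr (q.qbr X Y) Z = 0"
      using rels[of "[(1, Br (Br tX tY) tZ)]"] by simp
    show "q.qbr X (q.qbr X (q.qbr X (q.qbr X (q.qbr X (q.qbr X (q.qbr X Z)))))) = 0"
      using rels[of "[(1, Br tX (Br tX (Br tX (Br tX (Br tX (Br tX (Br tX tZ)))))))]"] by simp
    show "q.qbr (q.qbr X (q.qbr X Y)) Z = pscale 3 Z"
      using rels[of "[(1, Br (Br tX (Br tX tY)) tZ), (-3, tZ)]"] by simp
    show "pscale 3 (q.qbr Z (q.qbr X U)) = q.qbr U (q.qbr X Z)"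
      using rels[of "[(3, Br tZ (Br tX tU)), (-1, Br tU (Br tX tZ))]"] by simp
    show "q.qbr (q.qbr X U) (q.qbr X Z) = 0"
      using rels[of "[(1, Br (Br tX tU) (Br tX tZ))]"] by simp
    show "q.qbr (q.qbr X Z) (q.qbr X (q.qbr X (q.qbr X Z))) =
      pscale (2 * t\<^sup>2 * (lam - 1) * (lam + 2)) Y + pscale (2 * t * (2 * lam + 1)) (q.qbr X Z)"
      using rels[of "[(1, Br (Br tX tZ) (Br tX (Br tX (Br tX tZ)))), (- 2 * t^2 * (lam - 1) * (lam + 2), tY),
         (- 2 * t * (2 * lam + 1), Br tX tZ)]"]
      by (simp add: algebra_simps)
    show "q.qbr (q.qbr X Z) (q.qbr U Z) = 0"
      using rels[of "[(1, Br (Br tX tZ) (Br tU tZ))]"] by simp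
  qed
  let ?u = "L.up U" and ?v = "L.um U"
  interpret C: lie_core pscale q.qbr "q.Q False" "q.Q True" L.e Y L.ft L.\<mu> ?u ?v L.c L.y
    by (rule L.lie_core)
  let ?E = "Ep lam t"
  \<comment> \<open>Passing to the representative changes an element by a member of the ideal, which
    evaluates to zero; thus \<open>Ep\<close> descends to the quotient.\<close>
  have EP: "?E (P x) v = ?E x v" for x v
  proof -
    have "lk (x - P x) \<in> mag_ideal S" using P(2) by (simp add: pm_ideal_def)
    from mag_ideal_kernel[OF this[unfolded S_def]]
    obtain z where z: "lk (x - P x) = lk z" "\<forall>v. ?E z v = 0" by (elim exE conjE) (rule that)
    have "x - P x = z" by (rule poly_mapping_eqI) (simp only: z(1))
    then have "?E (x - P x) v = 0" using z by blast
    then show ?thesis by (simp add: Ep_simps)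
  qed
  have E\<tau>: "?E (q.\<tau> w) v = eval_tree lam t w v" for w v
    by (simp add: q.\<tau>_def EP Ep_simps)
  have Eqbr: "?E (q.qbr a b) v = (if i \<and> j then ?E a (?E b v) + ?E b (?E a v) else ?E a (?E b v) - ?E b (?E a v))"
    if "parity i (?E a)" "parity j (?E b)" for a b i j v
    by (simp add: q.qbr_def EP Ep_pmul_parity[OF that])
  have \<tau>s: "L.c = q.\<tau> (Br tX tU)" "q.qbr L.c U = q.\<tau> (Br (Br tX tU) tU)" "q.qbr L.c X = q.\<tau> (Br (Br tX tU) tX)"
    "q.qbr X Z = q.\<tau> (adX (Suc 0) tZ)"
    by (simp_all add: L.c_def q.\<tau>_Br gens adX_def)
  have cU: "eval_tree lam t (Br (Br tX tU) tU) (p, q) = (q, pderiv p)" for p q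
    by (simp add: eval_Br[of lam t "Br _ _"] eval_XU ev_simps)
  have cX: "eval_tree lam t (Br (Br tX tU) tX) (p, q) = (xv * q, cp lam * p - xv * pderiv p)" for p q
    by (simp add: eval_Br[of lam t "Br _ _"] eval_XU ev_simps)
  have half: "smult (1/2) (2 * r) = r" for r :: "complex poly"
    using mult_smult_left[of 2 1 r] by (simp add: numeral_poly)
  have Eu: "?E ?u (p, q) = (q, 0)" and Ev: "?E ?v (p, q) = (0, - pderiv p)" for p q
    using E\<tau>[of tU "(p, q)"] E\<tau>[of "Br (Br tX tU) tU" "(p, q)"]
    by (simp_all add: L.up_def L.um_def Ep_simps cU eval_gens sc_def gens half flip: \<tau>s)
  have EupX: "?E (L.up X) (p, q) = (xv * q, 0)" for p q
    using E\<tau>[of tX "(p, q)"] E\<tau>[of "Br (Br tX tU) tX" "(p, q)"]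
    by (simp add: L.up_def Ep_simps cX eval_gens sc_def gens half flip: \<tau>s)
  have Eft: "?E L.ft (p, q) = (pderiv p, 0)" for p q
  proof -
    have 1: "eval_tree lam t (adX (Suc 0) tZ) (p, q) = (smult (t * (1 - lam)) (pderiv p), smult (- t * (lam + 2)) (pderiv q))"
      by (simp add: eval_Z1 smult_cp cp_simps algebra_simps)
    have 2: "1 / (3 * t) * (t * (1 - lam)) + L.\<mu> = 1" "1 / (3 * t) * (- t * (lam + 2)) + L.\<mu> = 0"
      using t by (simp_all add: L.\<mu>_def field_simps)
    have "?E L.ft (p, q) = (smult (1 / (3 * t) * (t * (1 - lam)) + L.\<mu>) (pderiv p),
        smult (1 / (3 * t) * (- t * (lam + 2)) + L.\<mu>) (pderiv q))"
      using E\<tau>[of tY "(p, q)"] E\<tau>[of "adX (Suc 0) tZ" "(p, q)"]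
      by (simp only: gens L.ft_def Ep_simps \<tau>s(4)[symmetric] 1 eval_gens sc_Pair smult_add_left smult_smult add_Pair)
    then show ?thesis unfolding 2 by simp
  qed
  have parE: "parity True (?E ?u)" "parity False (?E L.ft)" "parity True (?E (L.up X))"
    by (simp_all add: parity_def Eu Eft EupX)
  have Ewu: "?E (C.wv ?u n) (p, q) = ((pderiv ^^ n) q, 0)" for n p q
  proof (induction n arbitrary: p q)
    case 0 then show ?case by (simp add: C.wv_simps(1) Eu)
  next
    case (Suc n)
    have "parity True (?E (C.wv ?u n))" by (simp add: parity_def Suc pderiv_funpow_linear)
    from Eqbr[OF parE(2) this, of "(p, q)"] show ?case
      by (simp add: C.wv_simps(2) Suc Eft pderiv_funpow_linear)
  qed
  have Ewv: "?E (C.wv ?v n) (p, q) = (0, (-1) ^ Suc n * (pderiv ^^ Suc n) p)" for n p q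
  proof (induction n arbitrary: p q)
    case 0 then show ?case by (simp add: C.wv_simps(1) Ev)
  next
    case (Suc n)
    have "parity True (?E (C.wv ?v n))" by (simp add: parity_def Suc pderiv_funpow_linear)
    from Eqbr[OF parE(2) this, of "(p, q)"] show ?case
      by (simp add: C.wv_simps(2) Suc Eft funpow_swap1[of pderiv])
  qed
  define K where "K = {z. \<forall>v. ?E z v = 0}"
  define \<kappa> :: "nat \<Rightarrow> complex" where "\<kappa> n = (-1) ^ n * of_nat (Suc n)" for n
  have K: "pm.subspace K"
    by (auto simp: K_def pm.subspace_def Ep_simps sc_simps)
  have K_qbr: "q.qbr a z \<in> K" if "z \<in> K" for a z
  proof -
    have z: "?E z v = 0" for v using that unfolding K_def by blast
    have "?E (q.qbr a z) v = 0" for v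
      unfolding q.qbr_def EP Ep_pmul by (rule sbr_zero(1)[OF lin_op_Ep z])
    then show ?thesis by (simp add: K_def)
  qed
  have E_sum: "?E (\<Sum>n<N. pscale (k n) (h n)) v = (\<Sum>n<N. sc (k n) (?E (h n) v))" for k h v and N :: nat
    by (induction N) (simp_all add: Ep_simps)
  have low_u: "k n = 0" if "(\<Sum>n<N. pscale (k n) (C.wv ?u n)) \<in> K" "n < N" for k n N
  proof (rule pderiv_powers_independent[OF _ that(2)])
    fix r
    have "fst (?E (\<Sum>n<N. pscale (k n) (C.wv ?u n)) (0, r)) = 0" using that(1) by (simp add: K_def)
    then show "(\<Sum>n<N. smult (k n) ((pderiv ^^ n) r)) = 0"
      by (simp add: E_sum Ewu sc_Pair fst_sum)
  qed
  have low_v: "k n = 0" if "(\<Sum>n<N. pscale (k n) (C.wv ?v n)) \<in> K" "n < N" for k n N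
  proof -
    \<comment> \<open>\<open>wv ?v n\<close> evaluates to the derivative of order
      \<open>Suc n\<close>, so the coefficients are shifted by one place, with 0 at order 0, and
      absorb the signs.\<close>
    define k' where "k' m = (case m of 0 \<Rightarrow> 0 | Suc j \<Rightarrow> k j * (-1) ^ Suc j)" for m
    have "k' (Suc n) = 0"
    proof (rule pderiv_powers_independent[of k' "Suc N"])
      fix r
      have "snd (?E (\<Sum>n<N. pscale (k n) (C.wv ?v n)) (r, 0)) = 0" using that(1) by (simp add: K_def)
      then have "(\<Sum>n<N. smult (k n) ((-1) ^ Suc n * (pderiv ^^ Suc n) r)) = 0"
        by (simp add: E_sum Ewv sc_Pair snd_sum)
      moreover have "smult (k n) ((-1) ^ Suc n * p) = smult (k' (Suc n)) p" for n p
        by (simp add: k'_def smult_cp cp_simps algebra_simps)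
      ultimately show "(\<Sum>n<Suc N. smult (k' n) ((pderiv ^^ n) r)) = 0"
        unfolding sum.lessThan_Suc_shift by (simp add: k'_def[of 0])
    qed (use that(2) in simp)
    then show ?thesis by (simp add: k'_def)
  qed
  have \<kappa>: "\<kappa> n \<noteq> 0" "q.qbr ?u (q.qbr (q.qbr L.e ?u) (C.wv ?v n)) - pscale (\<kappa> n) (C.wv ?u n) \<in> K" for n
  proof -
    show "\<kappa> n \<noteq> 0" by (simp add: \<kappa>_def del: of_nat_Suc)
    let ?s = "(-1) ^ Suc n :: complex poly" and ?D = "pderiv ^^ Suc n" and ?a = "q.qbr L.e ?u"
    have Ea: "?E ?a (p, r) = (- (xv * r), 0)" for p r
      by (simp add: L.e_upU Ep_simps EupX)
    have pa: "parity True (?E ?a)" "parity True (?E (C.wv ?v n))"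
      by (simp_all add: parity_def Ea Ewv pderiv_funpow_linear pderiv_ring_simps del: funpow.simps(2))
    have Eb: "?E (q.qbr ?a (C.wv ?v n)) (p, r) = (- (xv * (?s * ?D p)), - (?s * ?D (xv * r)))" for p r
      using Eqbr[OF pa, of "(p, r)"] by (simp add: Ea Ewv pderiv_funpow_linear(2) del: funpow.simps(2) power_Suc)
    have pb: "parity False (?E (q.qbr ?a (C.wv ?v n)))"
      by (simp add: parity_def Eb pderiv_funpow_linear(3) del: funpow.simps(2) power_Suc)
    have "?E (q.qbr ?u (q.qbr ?a (C.wv ?v n))) (p, r) = (?s * (xv * ?D r - ?D (xv * r)), 0)" for p r
      using Eqbr[OF parE(1) pb, of "(p, r)"]
      by (simp add: Eb Eu pderiv_funpow_linear(3) algebra_simps del: funpow.simps(2) power_Suc)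
    then have 1: "?E (q.qbr ?u (q.qbr ?a (C.wv ?v n))) (p, r) = (- ?s * of_nat (Suc n) * (pderiv ^^ n) r, 0)" for p r
      unfolding pderiv_funpow_x by (simp del: of_nat_Suc)
    have 2: "smult (\<kappa> n) r = - ?s * of_nat (Suc n) * r" for r
    proof -
      have "cp (of_nat m) = of_nat m" for m by (simp add: cp_def of_nat_poly)
      then show ?thesis by (simp add: \<kappa>_def smult_cp cp_simps del: of_nat_Suc)
    qed
    have "?E (q.qbr ?u (q.qbr ?a (C.wv ?v n)) - pscale (\<kappa> n) (C.wv ?u n)) (p, r) = 0" for p r
      unfolding Ep_simps 1 Ewu sc_Pair 2 by (simp add: zero_prod_def)
    then show "q.qbr ?u (q.qbr ?a (C.wv ?v n)) - pscale (\<kappa> n) (C.wv ?u n) \<in> K" by (simp add: K_def)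
  qed
  let ?B = "{?u, q.qbr L.e ?u, ?v, q.qbr L.e ?v, q.qbr L.ft ?u, q.qbr L.ft ?v, Y}"
  have \<tau>_subalg: "q.\<tau> w \<in> L.subalg ?B" for w
  proof (induction w)
    case (Gen g)
    then show ?case using L.gens_subalg by (cases g) (auto simp: gens)
  next
    case (Br a b)
    then show ?case unfolding q.\<tau>_Br by (rule L.subalg.br)
  qed
  have P_subalg: "P z \<in> L.subalg ?B" for z
  proof (induction z rule: fmag_induct)
    case (1 w) then show ?case using \<tau>_subalg by (simp add: q.\<tau>_def)
  qed (simp_all add: q.P_simps L.subalg.add L.subalg.scale)
  have "P x = 0"
  proof (rule C.K_subalg_trivial[where K = K and \<kappa> = \<kappa>])
    have "?E (P x) v = 0" for v unfolding EP by (rule x)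
    then show "P x \<in> K" unfolding K_def by blast
  qed (fact K, fact K_qbr, fact low_u, fact low_v, fact \<kappa>(1), fact \<kappa>(2), fact P_subalg)
  then show ?thesis using q.P_zeroD by (simp add: pm_ideal_def S_def)
qed

theorem theorem4p3:
  fixes lam t :: complex
  assumes "lam \<notin> \<int>" and "t \<noteq> 0"
  shows "(\<forall>f. fin_supp f \<longrightarrow> ev lam t f \<in> sl_gen lam t)
       \<and> sl_gen lam t \<subseteq> ev lam t ` {f. fin_supp f}
       \<and> (\<forall>f. fin_supp f \<longrightarrow>
            (ev lam t f = zero_op \<longleftrightarrow> f \<in> mag_ideal (lie_super_rels \<union> paper_rels lam t)))"
proof (intro conjI allI impI)
  have lk: "\<exists>x. f = lk x" if "fin_supp f" for f
    using that lookup_Abs_poly_mapping[of f] unfolding fin_supp_def by metis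
  show "ev lam t f \<in> sl_gen lam t" if "fin_supp f" for f
    using lk[OF that] Ep_sl_gen by (auto simp: ev_lookup)
  show "sl_gen lam t \<subseteq> ev lam t ` {f. fin_supp f}"
  proof
    fix F assume "F \<in> sl_gen lam t"
    then obtain x where "F = Ep lam t x" using sl_gen_Ep by blast
    then show "F \<in> ev lam t ` {f. fin_supp f}"
      by (intro image_eqI[of _ _ "lk x"]) (simp_all add: ev_lookup fin_supp_def)
  qed
  fix f assume "fin_supp f"
  then obtain x where f: "f = lk x" using lk by blast
  show "ev lam t f = zero_op \<longleftrightarrow> f \<in> mag_ideal (lie_super_rels \<union> paper_rels lam t)"
  proof
    assume "ev lam t f = zero_op"
    then have "Ep lam t x v = 0" for v by (simp add: f ev_lookup op_apply)
    then show "f \<in> mag_ideal (lie_super_rels \<union> paper_rels lam t)"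
      unfolding f by (rule presentation_kernel[OF assms(2)])
  next
    assume "f \<in> mag_ideal (lie_super_rels \<union> paper_rels lam t)"
    from mag_ideal_kernel[OF this] obtain z where z: "f = lk z" "\<forall>v. Ep lam t z v = 0"
      by (elim exE conjE) (rule that)
    show "ev lam t f = zero_op"
      unfolding z(1) ev_lookup using z(2) by (intro ext) (simp only: op_apply)
  qed
qed

end
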